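(* Let $(\mathfrak A,\theta)$ be a unital $\mathbb Z_2$-graded $C^*$-algebra and let $\omega$ be a symmetric state on the minimal infinite Fermi tensor product $\hat\otimes_{\min}^{\mathbb N}\mathfrak A$. The following are equivalent: (1) $\omega$ is extreme in the convex set of symmetric states; (2) $\omega$ is strongly clustering, i.e. $\lim_{n\to\infty}\omega(\alpha_{\sigma_n}(x)y)=\omega(x)\omega(y)$ for all $x,y\in\hat\otimes_{\min}^{\mathbb N}\mathfrak A$; (3) there exists an even state $\rho$ on $\mathfrak A$ such that $\omega=\times^{\mathbb N}\rho$.
   Context: A $\mathbb Z_2$-graded $C^*$-algebra is a pair $(\mathfrak A,\theta)$ with $\theta$ a $*$-automorphism, $\theta^2=\mathrm{id}$; $a$ is even if $\theta(a)=a$, odd if $\theta(a)=-a$, homogeneous if even or odd. A state $\rho$ is even if $\rho\circ\theta=\rho$. For homogeneous $a,b$ put $\varepsilon(a,b)=-1$ if both are odd and $1$ otherwise. The algebraic Fermi tensor product $\mathfrak A_1\hat\otimes\cdots\hat\otimes\mathfrak A_n$ of graded algebras is the algebraic tensor product with, for homogeneous $a_i,b_i\in\mathfrak A_i$, $(a_1\hat\otimes\cdots\hat\otimes a_n)(b_1\hat\otimes\cdots\hat\otimes b_n)=\prod_{i>j}\varepsilon(a_i,b_j)\,a_1b_1\hat\otimes\cdots\hat\otimes a_nb_n$ and $(a_1\hat\otimes\cdots\hat\otimes a_n)^*=\prod_{i<j}\varepsilon(a_i,a_j)\,a_1^*\hat\otimes\cdots\hat\otimes a_n^*$. Its minimal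 completion $\mathfrak A_1\hat\otimes_{\min}\cdots\hat\otimes_{\min}\mathfrak A_n$ is with respect to $\|x\|_{\min}=\sup\|\pi_\varphi(x)\|$, the supremum over product states $\varphi=\omega_1\times\cdots\times\omega_n$, $\varphi(a_1\hat\otimes\cdots\hat\otimes a_n)=\prod_i\omega_i(a_i)$, with all $\omega_i$ even states on $\mathfrak A_i$, and $\pi_\varphi$ the GNS representation. $\hat\otimes^{\mathbb N}_{\min}\mathfrak A$ is the inductive limit of the $n$-fold minimal Fermi products of $\mathfrak A$ with itself under $x\mapsto x\hat\otimes1$. For $j\in\mathbb N=\{1,2,\dots\}$, $i_j:\mathfrak A\to\hat\otimes^{\mathbb N}_{\min}\mathfrak A$ is the embedding in the $j$-th place, so $a_1\hat\otimes\cdots\hat\otimes a_n\hat\otimes1\hat\otimes\cdots=i_1(a_1)\cdots i_n(a_n)$. $\mathbb{P}_{\mathbb N}$ is the group of permutations of $\mathbb N$ moving finitely many points; it acts on $\hat\otimes^{\mathbb N}_{\min}\mathfrak A$ by the $*$-automorphisms $\alpha_\sigma$ determined by $\alpha_\sigma(i_j(a))=i_{\sigma(j)}(a)$. A state is symmetric if it is invariant under all $\alpha_\sigma$. For an even state $\rho$ on $\mathfrak A$, $\times^{\mathbb N}\rho$ is the state on $\hat\otimes^{\mathbb N}_{\min}\mathfrak A$ determined by $\times^{\mathbb N}\rho(a_1\hat\otimes\cdots\hat\otimes a_n\hat\otimes1\hat\otimes\cdots)=\rho(a_1)\cdots\rho(a_n)$. For $n\ge1$, $\sigma_n(k)=k+2^{n-1}$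 for $1\le k\le2^{n-1}$, $\sigma_n(k)=k-2^{n-1}$ for $2^{n-1}<k\le2^n$, $\sigma_n(k)=k$ for $k>2^n$. *)

theory Defs
  imports "HOL-Analysis.Analysis"
begin

section \<open>Complex *-algebras and C*-algebras\<close>

class scaleC =
  fixes scaleC :: "complex \<Rightarrow> 'a \<Rightarrow> 'a" (infixr "*\<^sub>C" 75)

class complex_vector = ab_group_add + scaleC +
  assumes scaleC_add_right: "c *\<^sub>C (x + y) = c *\<^sub>C x + c *\<^sub>C y"
    and scaleC_add_left: "(c + d) *\<^sub>C x = c *\<^sub>C x + d *\<^sub>C x"
    and scaleC_scaleC [simp]: "c *\<^sub>C (d *\<^sub>C x) = (c * d) *\<^sub>C x"
    and scaleC_one [simp]: "1 *\<^sub>C x = x"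

class star =
  fixes star :: "'a \<Rightarrow> 'a"

text \<open>The zero algebra (with \<open>1 = 0\<close>) is not excluded.\<close>

class complex_star_algebra = complex_vector + star + ring + monoid_mult +
  assumes mult_scaleC_left [simp]: "(c *\<^sub>C x) * y = c *\<^sub>C (x * y)"
    and mult_scaleC_right [simp]: "x * (c *\<^sub>C y) = c *\<^sub>C (x * y)"
    and star_add: "star (x + y) = star x + star y"
    and star_scaleC [simp]: "star (c *\<^sub>C x) = cnj c *\<^sub>C star x"
    and star_mult: "star (x * y) = star y * star x"
    and star_star [simp]: "star (star x) = x"

class cstar_algebra = complex_star_algebra + real_normed_algebra + banach +
  assumes scaleR_scaleC: "r *\<^sub>R x = complex_of_real r *\<^sub>C x"
    and norm_scaleC: "norm (c *\<^sub>C x) = cmod c * norm x"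
    and norm_star_mult: "norm (star x * x) = (norm x)\<^sup>2"

class graded_cstar_algebra = cstar_algebra +
  fixes grading :: "'a \<Rightarrow> 'a"
  assumes grading_add: "grading (x + y) = grading x + grading y"
    and grading_scaleC [simp]: "grading (c *\<^sub>C x) = c *\<^sub>C grading x"
    and grading_mult: "grading (x * y) = grading x * grading y"
    and grading_star: "grading (star x) = star (grading x)"
    and grading_grading [simp]: "grading (grading x) = x"

lemma scaleC_zero_right [simp]: "c *\<^sub>C (0::'a::complex_vector) = 0"
  by (metis add_cancel_left_right scaleC_add_right)

lemma scaleC_zero_left [simp]: "0 *\<^sub>C (x::'a::complex_vector) = 0"
  by (metis add_cancel_left_right scaleC_add_left)

lemma scaleC_minus_left [simp]: "(- c) *\<^sub>C (x::'a::complex_vector) = - (c *\<^sub>C x)"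
  by (metis add.left_inverse add_eq_0_iff scaleC_add_left scaleC_zero_left)

lemma scaleC_minus_right [simp]: "c *\<^sub>C (- x::'a::complex_vector) = - (c *\<^sub>C x)"
  by (metis add.left_inverse add_eq_0_iff scaleC_add_right scaleC_zero_right)

lemma scaleC_diff_right: "c *\<^sub>C (x - y::'a::complex_vector) = c *\<^sub>C x - c *\<^sub>C y"
  using scaleC_add_right[of c x "- y"] by simp

lemma scaleC_minus1: "(- 1) *\<^sub>C (x::'a::complex_vector) = - x"
  by simp

lemma scaleC_sum_right: "c *\<^sub>C (\<Sum>i\<in>I. f i :: 'a::complex_vector) = (\<Sum>i\<in>I. c *\<^sub>C f i)"
  by (induction I rule: infinite_finite_induct) (simp_all add: scaleC_add_right)

lemma star_zero [simp]: "star (0::'a::complex_star_algebra) = 0"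
  by (metis add_cancel_left_right star_add)

lemma star_minus [simp]: "star (- x::'a::complex_star_algebra) = - star x"
  by (metis add.left_inverse add_eq_0_iff star_add star_zero)

lemma star_diff: "star (x - y::'a::complex_star_algebra) = star x - star y"
  using star_add[of x "- y"] by simp

lemma star_one [simp]: "star (1::'a::complex_star_algebra) = 1"
  by (metis mult.left_neutral mult.right_neutral star_mult star_star)

lemma grading_zero [simp]: "grading (0::'a::graded_cstar_algebra) = 0"
  by (metis add_cancel_left_right grading_add)

lemma grading_one [simp]: "grading (1::'a::graded_cstar_algebra) = 1"
  by (metis mult.left_neutral mult.right_neutral grading_mult grading_grading)

lemma grading_minus: "grading (- x::'a::graded_cstar_algebra) = - grading x"
  by (metis add.left_inverse add_eq_0_iff grading_add grading_zero)

instantiation complex :: complex_vector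
begin
definition scaleC_complex :: "complex \<Rightarrow> complex \<Rightarrow> complex" where
  [simp]: "scaleC_complex c z = c * z"
instance by standard (simp_all add: algebra_simps)
end

definition clinear :: "('a::complex_vector \<Rightarrow> 'b::complex_vector) \<Rightarrow> bool" where
  "clinear f \<longleftrightarrow> (\<forall>x y. f (x + y) = f x + f y) \<and> (\<forall>c x. f (c *\<^sub>C x) = c *\<^sub>C f x)"

definition is_state :: "('a::complex_star_algebra \<Rightarrow> complex) \<Rightarrow> bool" where
  "is_state \<phi> \<longleftrightarrow> clinear \<phi> \<and> (\<forall>x. \<phi> (star x * x) \<in> \<real>\<^sub>\<ge>\<^sub>0) \<and> \<phi> 1 = 1"

definition even_state :: "('a::graded_cstar_algebra \<Rightarrow> complex) \<Rightarrow> bool" where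
  "even_state \<rho> \<longleftrightarrow> is_state \<rho> \<and> (\<forall>a. \<rho> (grading a) = \<rho> a)"

subsection \<open>Positive functionals\<close>

definition pos_fun :: "('a::complex_star_algebra \<Rightarrow> complex) \<Rightarrow> bool" where
  "pos_fun \<phi> \<longleftrightarrow> clinear \<phi> \<and> (\<forall>x. \<phi> (star x * x) \<in> \<real>\<^sub>\<ge>\<^sub>0)"

lemma is_state_pos_fun: "is_state \<phi> \<Longrightarrow> pos_fun \<phi>"
  by (simp add: is_state_def pos_fun_def)

lemma clinearD:
  assumes "clinear f"
  shows "f (x + y) = f x + f y" "f (c *\<^sub>C x) = c *\<^sub>C f x" "f 0 = 0" "f (- x) = - f x" "f (x - y) = f x - f y"
proof -
  show a: "f (x + y) = f x + f y" for x y using assms by (simp add: clinear_def)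
  show b: "f (c *\<^sub>C x) = c *\<^sub>C f x" for c x using assms by (simp add: clinear_def)
  show "f 0 = 0" using b[of 0 0] by simp
  show c: "f (- x) = - f x" for x using b[of "-1" x] by simp
  show "f (x - y) = f x - f y" using a[of x "-y"] c by simp
qed

lemma clinear_sum: "clinear f \<Longrightarrow> f (\<Sum>i\<in>I. g i) = (\<Sum>i\<in>I. f (g i))"
  by (induction I rule: infinite_finite_induct) (simp_all add: clinearD)

text \<open>The GNS seminorm, i.e. the norm of the class of \<open>y\<close> in the GNS space of \<open>\<phi>\<close>.\<close>

definition gns_seminorm :: "('a::complex_star_algebra \<Rightarrow> complex) \<Rightarrow> 'a \<Rightarrow> real" where
  "gns_seminorm \<phi> y = sqrt (Re (\<phi> (star y * y)))"

lemma pos_fun_nonneg: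
  assumes "pos_fun \<phi>"
  shows "0 \<le> Re (\<phi> (star x * x))" "\<phi> (star x * x) = complex_of_real (Re (\<phi> (star x * x)))"
proof -
  have "\<phi> (star x * x) \<in> \<real>\<^sub>\<ge>\<^sub>0" using assms by (simp add: pos_fun_def)
  then obtain r where "\<phi> (star x * x) = complex_of_real r" "0 \<le> r" by (rule nonneg_Reals_cases)
  then show "0 \<le> Re (\<phi> (star x * x))" "\<phi> (star x * x) = complex_of_real (Re (\<phi> (star x * x)))" by simp_all
qed

lemma gns_seminorm_nonneg: "pos_fun \<phi> \<Longrightarrow> 0 \<le> gns_seminorm \<phi> y"
  by (simp add: gns_seminorm_def pos_fun_nonneg(1))

lemma gns_seminorm_sq: "pos_fun \<phi> \<Longrightarrow> (gns_seminorm \<phi> y)\<^sup>2 = Re (\<phi> (star y * y))"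
  by (simp add: gns_seminorm_def pos_fun_nonneg(1))

lemma pos_fun_expand:
  fixes x :: "'a::complex_star_algebra"
  assumes "clinear \<phi>"
  shows "\<phi> (star (x + c *\<^sub>C y) * (x + c *\<^sub>C y)) =
    \<phi> (star x * x) + c * \<phi> (star x * y) + cnj c * \<phi> (star y * x) + cnj c * c * \<phi> (star y * y)"
proof -
  have "star (x + c *\<^sub>C y) * (x + c *\<^sub>C y) =
    star x * x + c *\<^sub>C (star x * y) + cnj c *\<^sub>C (star y * x) + (cnj c * c) *\<^sub>C (star y * y)"
    by (simp add: star_add distrib_left distrib_right scaleC_add_right add_ac mult_ac)
  then show ?thesis by (simp add: clinearD[OF assms])
qed

lemma pos_fun_hermitian:
  assumes "pos_fun \<phi>"
  shows "\<phi> (star y * x) = cnj (\<phi> (star x * y))"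
proof -
  have lin: "clinear \<phi>" using assms by (simp add: pos_fun_def)
  have im: "Im (\<phi> (star z * z)) = 0" for z
    by (metis Im_complex_of_real assms pos_fun_nonneg(2))
  have 1: "Im (c * \<phi> (star x * y) + cnj c * \<phi> (star y * x)) = 0" if "cmod c = 1" for c
  proof -
    have "cnj c * c = 1" using that by (metis complex_norm_square mult.commute of_real_1 one_power2)
    then show ?thesis
      using pos_fun_expand[OF lin, of x c y] im[of "x + c *\<^sub>C y"] im[of x] im[of y] by simp
  qed
  show ?thesis using 1[of 1] 1[of \<i>] by (simp add: complex_eq_iff)
qed

lemma pos_fun_CS:
  assumes "pos_fun \<phi>"
  shows "cmod (\<phi> (star x * y)) \<le> gns_seminorm \<phi> x * gns_seminorm \<phi> y"
proof -
  have lin: "clinear \<phi>" using assms by (simp add: pos_fun_def)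
  define A where "A = Re (\<phi> (star x * x))"
  define B where "B = Re (\<phi> (star y * y))"
  define z where "z = \<phi> (star x * y)"
  have A: "0 \<le> A" "\<phi> (star x * x) = of_real A" and B: "0 \<le> B" "\<phi> (star y * y) = of_real B"
    using pos_fun_nonneg[OF assms] unfolding A_def B_def by auto
  have h: "\<phi> (star y * x) = cnj z" using pos_fun_hermitian[OF assms] unfolding z_def .
  have key: "0 \<le> A - 2 * t * (cmod z)\<^sup>2 + t\<^sup>2 * (cmod z)\<^sup>2 * B" for t :: real
  proof -
    let ?c = "- (of_real t * cnj z)"
    have zz: "cnj z * z = of_real ((cmod z)\<^sup>2)" "z * cnj z = of_real ((cmod z)\<^sup>2)"
      by (metis complex_norm_square mult.commute of_real_power)+
    have "\<phi> (star (x + ?c *\<^sub>C y) * (x + ?c *\<^sub>C y)) =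
       of_real A + ?c * z + cnj ?c * cnj z + cnj ?c * ?c * of_real B"
      using pos_fun_expand[OF lin, of x ?c y] h A B z_def by simp
    also have "\<dots> = of_real A - 2 * of_real t * (cnj z * z) + (of_real t)\<^sup>2 * (cnj z * z) * of_real B"
      by (simp add: algebra_simps power2_eq_square)
    also have "\<dots> = of_real (A - 2 * t * (cmod z)\<^sup>2 + t\<^sup>2 * (cmod z)\<^sup>2 * B)"
      unfolding zz by simp
    finally show ?thesis using pos_fun_nonneg(1)[OF assms, of "x + ?c *\<^sub>C y"]
      by (metis Re_complex_of_real)
  qed
  have "(cmod z)\<^sup>2 \<le> A * B"
  proof (cases "B = 0")
    case True
    have "(cmod z)\<^sup>2 = 0"
    proof (rule ccontr)
      assume "(cmod z)\<^sup>2 \<noteq> 0"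
      then have "2 * ((A + 1) / (cmod z)\<^sup>2) * (cmod z)\<^sup>2 = 2 * (A + 1)" by simp
      then show False using key[of "(A + 1) / (cmod z)\<^sup>2"] True A by simp
    qed
    then show ?thesis using True by simp
  next
    case False
    then have "0 < B" using B by simp
    have "t\<^sup>2 * w * B = t * w" "2 * t * w = 2 * (w / B)" if "t = 1 / B" for t w
      using that False by (simp_all add: power2_eq_square)
    from this[of "1/B" "(cmod z)\<^sup>2"] key[of "1 / B"] have "0 \<le> A - (cmod z)\<^sup>2 / B" by simp
    then show ?thesis using \<open>0 < B\<close> by (simp add: field_simps)
  qed
  then have "cmod z \<le> sqrt (A * B)" by (rule real_le_rsqrt)
  then show ?thesis by (simp add: z_def gns_seminorm_def A_def B_def real_sqrt_mult)
qed

lemma gns_seminorm_triangle: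
  assumes "pos_fun \<phi>"
  shows "gns_seminorm \<phi> (x + y) \<le> gns_seminorm \<phi> x + gns_seminorm \<phi> y"
proof -
  have lin: "clinear \<phi>" using assms by (simp add: pos_fun_def)
  have "(gns_seminorm \<phi> (x + y))\<^sup>2 = Re (\<phi> (star x * x)) + Re (\<phi> (star y * y)) + 2 * Re (\<phi> (star x * y))"
    using pos_fun_expand[OF lin, of x 1 y] pos_fun_hermitian[OF assms, of y x]
    by (simp add: gns_seminorm_sq[OF assms])
  also have "\<dots> \<le> (gns_seminorm \<phi> x)\<^sup>2 + (gns_seminorm \<phi> y)\<^sup>2 + 2 * (gns_seminorm \<phi> x * gns_seminorm \<phi> y)"
    using pos_fun_CS[OF assms, of x y] complex_Re_le_cmod[of "\<phi> (star x * y)"]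
    by (simp add: gns_seminorm_sq[OF assms])
  also have "\<dots> = (gns_seminorm \<phi> x + gns_seminorm \<phi> y)\<^sup>2"
    by (simp add: power2_eq_square algebra_simps)
  finally show ?thesis
    using gns_seminorm_nonneg[OF assms] by (meson add_nonneg_nonneg power2_le_imp_le)
qed

lemma gns_seminorm_scaleC:
  assumes "pos_fun \<phi>"
  shows "gns_seminorm \<phi> (c *\<^sub>C x) = cmod c * gns_seminorm \<phi> x"
proof -
  have lin: "clinear \<phi>" using assms by (simp add: pos_fun_def)
  have "\<phi> (star (c *\<^sub>C x) * (c *\<^sub>C x)) = of_real ((cmod c)\<^sup>2) * \<phi> (star x * x)"
    by (simp add: clinearD[OF lin] complex_norm_square mult.commute del: of_real_power)
  then have "Re (\<phi> (star (c *\<^sub>C x) * (c *\<^sub>C x))) = (cmod c)\<^sup>2 * Re (\<phi> (star x * x))"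
    by (simp del: of_real_power)
  then show ?thesis by (simp add: gns_seminorm_def real_sqrt_mult)
qed

subsection \<open>Positive functionals on C*-algebras are bounded\<close>

lemma norm_star [simp]: "norm (star x) = norm (x::'a::cstar_algebra)"
proof -
  have le: "norm y \<le> norm (star y)" for y :: 'a
  proof (cases "norm y = 0")
    case False
    have "norm y * norm y \<le> norm (star y) * norm y"
      using norm_star_mult[of y] norm_mult_ineq[of "star y" y] by (simp add: power2_eq_square)
    then show ?thesis using False by (simp add: mult_le_cancel_right)
  qed simp
  show ?thesis using le[of x] le[of "star x"] by simp
qed

lemma norm_one_le: "norm (1::'a::cstar_algebra) \<le> 1"
proof -
  have "norm (1::'a) = (norm (1::'a))\<^sup>2" using norm_star_mult[of "1::'a"] by simp
  then show ?thesis by (auto simp: power2_eq_square)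
qed

lemma norm_pow_le: "norm ((x::'a::cstar_algebra) ^ n) \<le> norm x ^ n"
proof (induction n)
  case (Suc n)
  then show ?case using norm_mult_ineq[of x "x ^ n"]
    by simp (meson mult_left_mono norm_ge_zero order_trans)
qed (simp add: norm_one_le)

lemma star_power: "star (x ^ n) = star (x::'a::complex_star_algebra) ^ n"
  by (induction n) (simp_all add: star_mult power_commutes)

lemma star_scaleR: "star (r *\<^sub>R x) = r *\<^sub>R star (x::'a::cstar_algebra)"
  by (simp add: scaleR_scaleC)

lemma bounded_linear_star: "bounded_linear (star :: 'a::cstar_algebra \<Rightarrow> 'a)"
  by (rule bounded_linear_intro[where K = 1]) (simp_all add: star_add star_scaleR)

lemma abs_half_gchoose_le: "\<bar>(1/2::real) gchoose n\<bar> \<le> 1"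
proof (induction n)
  case (Suc n)
  have eq: "((1/2::real) gchoose Suc n) = ((1/2) gchoose n) * ((1/2 - real n) / real (Suc n))"
    by (simp add: gbinomial_prod_rev field_simps)
  have "\<bar>(1/2 - real n) / real (Suc n)\<bar> \<le> 1" by (simp add: field_simps abs_le_iff)
  then have "\<bar>(1/2::real) gchoose n\<bar> * \<bar>(1/2 - real n) / real (Suc n)\<bar> \<le> 1 * 1"
    using Suc by (intro mult_mono) auto
  then show ?case unfolding eq abs_mult by simp
qed simp

lemma cstar_sqrt_exists:
  fixes h :: "'a::cstar_algebra"
  assumes h: "star h = h" "norm h < 1"
  shows "\<exists>c. star c = c \<and> c * c = 1 - h"
proof -
  define u where "u n = ((1/2::real) gchoose n) * (-1)^n" for n
  define v where "v n = u n *\<^sub>R h ^ n" for n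
  have nv: "norm (v n) \<le> norm h ^ n" for n
  proof -
    have "norm (v n) = \<bar>(1/2::real) gchoose n\<bar> * norm (h ^ n)" by (simp add: v_def u_def abs_mult)
    also have "\<dots> \<le> 1 * norm h ^ n" using abs_half_gchoose_le norm_pow_le by (intro mult_mono) auto
    finally show ?thesis by simp
  qed
  have sn: "summable (\<lambda>n. norm (v n))"
    by (rule summable_comparison_test[OF _ summable_geometric[of "norm h"]]) (use nv h in auto)
  then have s: "summable v" by (rule summable_norm_cancel)
  define c where "c = suminf v"
  have vn: "star (v n) = v n" for n by (simp add: v_def star_scaleR star_power h)
  have "star c = c"
    unfolding c_def using bounded_linear.suminf[OF bounded_linear_star s] vn by simp
  moreover have "c * c = 1 - h"
  proof -
    have cp: "(\<lambda>k. \<Sum>i\<le>k. v i * v (k - i)) sums (c * c)"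
      unfolding c_def by (rule Cauchy_product_sums[OF sn sn])
    have eq: "(\<Sum>i\<le>k. v i * v (k - i)) = (((1::real) gchoose k) * (-1)^k) *\<^sub>R h ^ k" for k
    proof -
      have "(\<Sum>i\<le>k. v i * v (k - i)) = (\<Sum>i\<le>k. (((1/2::real) gchoose i) * ((1/2) gchoose (k - i)) * (-1)^k) *\<^sub>R h ^ k)"
      proof (rule sum.cong)
        fix i assume "i \<in> {..k}"
        then have "h ^ i * h ^ (k - i) = h ^ k" "(-1::real)^i * (-1)^(k - i) = (-1)^k"
          by (simp_all flip: power_add)
        then show "v i * v (k - i) = (((1/2::real) gchoose i) * ((1/2) gchoose (k - i)) * (-1)^k) *\<^sub>R h ^ k"
          by (simp add: v_def u_def mult_ac)
      qed simp
      also have "\<dots> = ((\<Sum>i\<le>k. ((1/2::real) gchoose i) * ((1/2) gchoose (k - i))) * (-1)^k) *\<^sub>R h ^ k"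
        by (simp add: scaleR_sum_left sum_distrib_right)
      also have "(\<Sum>i\<le>k. ((1/2::real) gchoose i) * ((1/2) gchoose (k - i))) = (1/2 + 1/2) gchoose k"
        using gbinomial_Vandermonde[of "1/2::real" "1/2" k] by (simp add: atLeast0AtMost)
      finally show ?thesis by simp
    qed
    have "(\<lambda>k. (((1::real) gchoose k) * (-1)^k) *\<^sub>R h ^ k) sums (\<Sum>k\<in>{0,1}. (((1::real) gchoose k) * (-1)^k) *\<^sub>R h ^ k)"
    proof (rule sums_finite)
      fix k :: nat assume "k \<notin> {0,1}"
      then have "(1 choose k) = 0" by (intro binomial_eq_0) auto
      then have "((1::real) gchoose k) = 0"
        using binomial_gbinomial[of 1 k, where 'a = real] by (metis of_nat_0 of_nat_1)
      then show "(((1::real) gchoose k) * (-1)^k) *\<^sub>R h ^ k = 0" by simp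
    qed simp
    then show ?thesis using cp unfolding eq by (simp add: sums_iff)
  qed
  ultimately show ?thesis by blast
qed

lemma pos_fun_bound:
  fixes \<psi> :: "'a::cstar_algebra \<Rightarrow> complex"
  assumes "pos_fun \<psi>"
  shows "Re (\<psi> (star b * b)) \<le> (norm b)\<^sup>2 * Re (\<psi> 1)"
proof -
  have lin: "clinear \<psi>" using assms by (simp add: pos_fun_def)
  have p1: "0 \<le> Re (\<psi> 1)" using pos_fun_nonneg[OF assms, of 1] by simp
  have le: "Re (\<psi> (star b * b)) \<le> s * Re (\<psi> 1)" if s: "(norm b)\<^sup>2 < s" for s
  proof -
    have s0: "0 < s" using s by (meson le_less_trans zero_le_power2)
    let ?h = "complex_of_real (1 / s) *\<^sub>C (star b * b)"
    have "norm ?h < 1" using s s0 by (simp add: norm_scaleC norm_star_mult norm_divide)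
    moreover have "star ?h = ?h" by (simp add: star_mult)
    ultimately obtain c where c: "star c = c" "c * c = 1 - ?h" using cstar_sqrt_exists by blast
    have "0 \<le> Re (\<psi> (star c * c))" using pos_fun_nonneg[OF assms] by blast
    then have "0 \<le> Re (\<psi> 1) - (1 / s) * Re (\<psi> (star b * b))"
      unfolding c by (simp add: clinearD[OF lin])
    then show ?thesis using s0 by (simp add: field_simps)
  qed
  show ?thesis
  proof (rule field_le_epsilon)
    fix e :: real assume e: "0 < e"
    define d where "d = e / (Re (\<psi> 1) + 1)"
    have d: "0 < d" using e p1 by (simp add: d_def)
    have "d * Re (\<psi> 1) \<le> e"
      using e p1 unfolding d_def by (simp add: field_simps)
    then show "Re (\<psi> (star b * b)) \<le> (norm b)\<^sup>2 * Re (\<psi> 1) + e"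
      using le[of "(norm b)\<^sup>2 + d"] d by (simp add: algebra_simps)
  qed
qed

section \<open>The algebraic Fermi tensor products and their inductive limit\<close>

text \<open>A list \<open>[(c\<^sub>1, as\<^sub>1), \<dots>]\<close> is a formal linear combination of elementary tensors, where a list
  of length \<open>n\<close> stands for the elementary tensor of its entries in the \<open>n\<close>-fold tensor power. All
  rules but the last generate the relations of the \<open>n\<close>-fold algebraic tensor powers; the last
  identifies them along \<open>x \<mapsto> x \<otimes> 1\<close>. The quotient is thus the algebraic inductive limit of the
  \<open>n\<close>-fold powers, and the \<open>n\<close>-fold power itself is \<open>fermi_level n\<close> below.\<close>

inductive tensor_eq ::
  "(complex \<times> 'a::graded_cstar_algebra list) list \<Rightarrow> (complex \<times> 'a list) list \<Rightarrow> bool" where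
  refl: "tensor_eq s s"
| sym: "tensor_eq s t \<Longrightarrow> tensor_eq t s"
| trans: "tensor_eq s t \<Longrightarrow> tensor_eq t u \<Longrightarrow> tensor_eq s u"
| append: "tensor_eq s s' \<Longrightarrow> tensor_eq t t' \<Longrightarrow> tensor_eq (s @ t) (s' @ t')"
| commute: "tensor_eq (s @ t) (t @ s)"
| coeff_zero: "tensor_eq [(0, as)] []"
| coeff_add: "tensor_eq [(c, as), (d, as)] [(c + d, as)]"
| slot_add: "k < length as \<Longrightarrow>
    tensor_eq [(c, as[k := x + y])] [(c, as[k := x]), (c, as[k := y])]"
| slot_scale: "k < length as \<Longrightarrow> tensor_eq [(c, as[k := z *\<^sub>C x])] [(c * z, as[k := x])]"
| append_one: "tensor_eq [(c, as)] [(c, as @ [1])]"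

quotient_type (overloaded) 'a fermi_alg = "(complex \<times> 'a::graded_cstar_algebra list) list" / tensor_eq
  by (auto intro!: equivpI reflpI sympI transpI intro: tensor_eq.intros)

lemma tensor_eq_scale:
  "tensor_eq s t \<Longrightarrow> tensor_eq (map (\<lambda>(c, as). (z * c, as)) s) (map (\<lambda>(c, as). (z * c, as)) t)"
proof (induction rule: tensor_eq.induct)
  case (trans s t u)
  then show ?case by (blast intro: tensor_eq.trans)
next
  case (append s s' t t')
  then show ?case by (auto intro: tensor_eq.append)
next
  case (slot_scale k as c w x)
  then show ?case using tensor_eq.slot_scale[of k as "z * c" w x] by (simp add: mult.assoc)
qed (auto simp: distrib_left intro: tensor_eq.intros)

lemma tensor_eq_swap: "tensor_eq (a @ b @ c @ d) (a @ c @ b @ d)"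
proof -
  have "tensor_eq (b @ c) (c @ b)" by (rule tensor_eq.commute)
  then have "tensor_eq (a @ (b @ c) @ d) (a @ (c @ b) @ d)"
    by (rule tensor_eq.append[OF tensor_eq.refl tensor_eq.append[OF _ tensor_eq.refl]])
  then show ?thesis by simp
qed

lemma tensor_eq_scale_add:
  "tensor_eq (map (\<lambda>(c, as). ((v + w) * c, as)) s)
     (map (\<lambda>(c, as). (v * c, as)) s @ map (\<lambda>(c, as). (w * c, as)) s)"
proof (induction s)
  case (Cons p s)
  obtain c as where p: "p = (c, as)" by force
  let ?V = "map (\<lambda>(c, as). (v * c, as)) s" and ?W = "map (\<lambda>(c, as). (w * c, as)) s"
  have "tensor_eq [((v + w) * c, as)] [(v * c, as), (w * c, as)]"
    by (metis tensor_eq.sym tensor_eq.coeff_add distrib_right)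
  from tensor_eq.append[OF this Cons]
  have "tensor_eq (map (\<lambda>(c, as). ((v + w) * c, as)) (p # s)) ([(v * c, as)] @ [(w * c, as)] @ ?V @ ?W)"
    by (simp add: p)
  moreover have "tensor_eq ([(v * c, as)] @ [(w * c, as)] @ ?V @ ?W) ([(v * c, as)] @ ?V @ [(w * c, as)] @ ?W)"
    by (rule tensor_eq_swap)
  ultimately show ?case by (simp add: p) (blast intro: tensor_eq.trans)
qed (simp add: tensor_eq.refl)

lemma tensor_eq_zero: "tensor_eq (map (\<lambda>(c, as). (0 * c, as)) s) []"
proof (induction s)
  case (Cons p s)
  obtain c as where p: "p = (c, as)" by force
  show ?case using tensor_eq.append[OF tensor_eq.coeff_zero[of as] Cons] by (simp add: p)
qed (simp add: tensor_eq.refl)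

instantiation fermi_alg :: (graded_cstar_algebra) complex_vector
begin

lift_definition zero_fermi_alg :: "'a fermi_alg" is "[]" .

lift_definition plus_fermi_alg :: "'a fermi_alg \<Rightarrow> 'a fermi_alg \<Rightarrow> 'a fermi_alg" is "(@)"
  by (rule tensor_eq.append)

lift_definition scaleC_fermi_alg :: "complex \<Rightarrow> 'a fermi_alg \<Rightarrow> 'a fermi_alg"
  is "\<lambda>z. map (\<lambda>(c, as). (z * c, as))"
  by (rule tensor_eq_scale)

definition uminus_fermi_alg :: "'a fermi_alg \<Rightarrow> 'a fermi_alg" where
  "uminus_fermi_alg x = (- 1) *\<^sub>C x"

definition minus_fermi_alg :: "'a fermi_alg \<Rightarrow> 'a fermi_alg \<Rightarrow> 'a fermi_alg" where
  "minus_fermi_alg x y = x + (- y)"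

instance
proof
  fix x y z :: "'a fermi_alg" and c d :: complex
  show "x + y + z = x + (y + z)" by transfer (simp add: tensor_eq.refl)
  show comm: "x + y = y + x" by transfer (rule tensor_eq.commute)
  show zl: "0 + x = x" by transfer (simp add: tensor_eq.refl)
  show add: "(c + d) *\<^sub>C x = c *\<^sub>C x + d *\<^sub>C x" for c d and x :: "'a fermi_alg"
    by transfer (rule tensor_eq_scale_add)
  show one: "1 *\<^sub>C x = x" for x :: "'a fermi_alg"
    by transfer (simp add: tensor_eq.refl case_prod_beta)
  have zero: "0 *\<^sub>C x = 0" by transfer (rule tensor_eq_zero)
  show "- x + x = 0" using add[of "- 1" 1 x] zero by (simp add: uminus_fermi_alg_def one)
  show "x - y = x + - y" by (simp add: minus_fermi_alg_def)
  show "c *\<^sub>C (x + y) = c *\<^sub>C x + c *\<^sub>C y" by transfer (simp add: tensor_eq.refl)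
  show "c *\<^sub>C d *\<^sub>C x = (c * d) *\<^sub>C x"
  proof transfer
    fix c d and s :: "(complex \<times> 'a list) list"
    have "map (\<lambda>(e, as). (c * e, as)) (map (\<lambda>(e, as). (d * e, as)) s) = map (\<lambda>(e, as). (c * d * e, as)) s"
      by (induction s) auto
    then show "tensor_eq (map (\<lambda>(e, as). (c * e, as)) (map (\<lambda>(e, as). (d * e, as)) s))
        (map (\<lambda>(e, as). (c * d * e, as)) s)"
      by (simp only: tensor_eq.refl)
  qed
qed

end

lift_definition elem_tensor :: "'a::graded_cstar_algebra list \<Rightarrow> 'a fermi_alg" is "\<lambda>as. [(1, as)]" .

text \<open>The linear (\<open>\<kappa>\<close> the identity) or antilinear (\<open>\<kappa> = cnj\<close>) extension of a multilinear map
  given on elementary tensors.\<close>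

definition tensor_ext ::
  "(complex \<Rightarrow> complex) \<Rightarrow> ('a::graded_cstar_algebra list \<Rightarrow> 'b::complex_vector) \<Rightarrow> 'a fermi_alg \<Rightarrow> 'b" where
  "tensor_ext \<kappa> F x = (\<Sum>(c, as)\<leftarrow>rep_fermi_alg x. \<kappa> c *\<^sub>C F as)"

definition multilinear ::
  "(complex \<Rightarrow> complex) \<Rightarrow> ('a::graded_cstar_algebra list \<Rightarrow> 'b::complex_vector) \<Rightarrow> bool" where
  "multilinear \<kappa> F \<longleftrightarrow> \<kappa> \<in> {\<lambda>c. c, cnj} \<and>
    (\<forall>as k x y. k < length as \<longrightarrow> F (as[k := x + y]) = F (as[k := x]) + F (as[k := y])) \<and>
    (\<forall>as k z x. k < length as \<longrightarrow> F (as[k := z *\<^sub>C x]) = \<kappa> z *\<^sub>C F (as[k := x])) \<and>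
    (\<forall>as. F (as @ [1]) = F as)"

lemma formal_sum_cong:
  assumes F: "multilinear \<kappa> F" and "tensor_eq s t"
  shows "(\<Sum>(c, as)\<leftarrow>s. \<kappa> c *\<^sub>C F as) = (\<Sum>(c, as)\<leftarrow>t. \<kappa> c *\<^sub>C F as)"
proof -
  have k: "\<kappa> 0 = 0" "\<kappa> (c + d) = \<kappa> c + \<kappa> d" "\<kappa> (c * d) = \<kappa> c * \<kappa> d" for c d
    using F by (auto simp: multilinear_def)
  show ?thesis using assms(2)
    by (induction rule: tensor_eq.induct)
      (use F in \<open>simp_all add: k multilinear_def add.commute scaleC_add_left scaleC_add_right\<close>)
qed

lemma abs_rep_tensor: "tensor_eq (rep_fermi_alg (abs_fermi_alg s)) s"
  by (metis Quotient_abs_rep Quotient_fermi_alg fermi_alg.abs_eq_iff)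

lemma tensor_ext_abs:
  assumes "multilinear \<kappa> F"
  shows "tensor_ext \<kappa> F (abs_fermi_alg s) = (\<Sum>(c, as)\<leftarrow>s. \<kappa> c *\<^sub>C F as)"
  unfolding tensor_ext_def by (rule formal_sum_cong[OF assms abs_rep_tensor])

lemma fermi_alg_cases: obtains s where "x = abs_fermi_alg s"
  by (metis Quotient_abs_rep Quotient_fermi_alg)

lemma tensor_ext_simps:
  assumes F: "multilinear \<kappa> F"
  shows tensor_ext_add: "tensor_ext \<kappa> F (x + y) = tensor_ext \<kappa> F x + tensor_ext \<kappa> F y"
    and tensor_ext_scaleC: "tensor_ext \<kappa> F (z *\<^sub>C x) = \<kappa> z *\<^sub>C tensor_ext \<kappa> F x"
    and tensor_ext_elem: "tensor_ext \<kappa> F (elem_tensor as) = F as"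
    and tensor_ext_zero: "tensor_ext \<kappa> F 0 = 0"
proof -
  have k: "\<kappa> 1 = 1" "\<kappa> (c * d) = \<kappa> c * \<kappa> d" for c d
    using F by (auto simp: multilinear_def)
  obtain s t where x: "x = abs_fermi_alg s" and y: "y = abs_fermi_alg t" by (metis fermi_alg_cases)
  show "tensor_ext \<kappa> F (x + y) = tensor_ext \<kappa> F x + tensor_ext \<kappa> F y"
    by (simp add: x y plus_fermi_alg.abs_eq tensor_ext_abs[OF F])
  have "(\<Sum>p\<leftarrow>s. case p of (c, as) \<Rightarrow> \<kappa> (z * c) *\<^sub>C F as) = \<kappa> z *\<^sub>C (\<Sum>(c, as)\<leftarrow>s. \<kappa> c *\<^sub>C F as)"
    by (induction s) (auto simp: k scaleC_add_right)
  then show "tensor_ext \<kappa> F (z *\<^sub>C x) = \<kappa> z *\<^sub>C tensor_ext \<kappa> F x"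
    by (simp add: x scaleC_fermi_alg.abs_eq tensor_ext_abs[OF F] o_def case_prod_beta)
  show "tensor_ext \<kappa> F (elem_tensor as) = F as"
    by (simp add: elem_tensor.abs_eq tensor_ext_abs[OF F] k)
  show "tensor_ext \<kappa> F 0 = 0"
    by (simp add: zero_fermi_alg.abs_eq tensor_ext_abs[OF F])
qed

lemma abs_fermi_alg_sum: "abs_fermi_alg s = (\<Sum>(c, as)\<leftarrow>s. c *\<^sub>C elem_tensor as)"
proof (induction s)
  case Nil
  then show ?case by (simp add: zero_fermi_alg.abs_eq)
next
  case (Cons p s)
  obtain c as where p: "p = (c, as)" by force
  have "abs_fermi_alg (p # s) = abs_fermi_alg [p] + abs_fermi_alg s"
    by (simp add: plus_fermi_alg.abs_eq)
  moreover have "abs_fermi_alg [p] = c *\<^sub>C elem_tensor as"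
    by (simp add: p elem_tensor.abs_eq scaleC_fermi_alg.abs_eq)
  ultimately show ?case using Cons by (simp add: p)
qed

lemma elem_tensor_add: "k < length as \<Longrightarrow>
    elem_tensor (as[k := x + y]) = elem_tensor (as[k := x]) + elem_tensor (as[k := y])"
  by (simp add: elem_tensor.abs_eq plus_fermi_alg.abs_eq fermi_alg.abs_eq_iff tensor_eq.slot_add)

lemma elem_tensor_scale: "k < length as \<Longrightarrow>
    elem_tensor (as[k := z *\<^sub>C x]) = z *\<^sub>C elem_tensor (as[k := x])"
  using tensor_eq.slot_scale[of k as 1 z x]
  by (simp add: elem_tensor.abs_eq scaleC_fermi_alg.abs_eq fermi_alg.abs_eq_iff)

lemma elem_tensor_one: "elem_tensor (as @ [1]) = elem_tensor as"
  by (metis elem_tensor.abs_eq fermi_alg.abs_eq_iff tensor_eq.append_one)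

definition tens :: "nat \<Rightarrow> (nat \<Rightarrow> 'a::graded_cstar_algebra) \<Rightarrow> 'a fermi_alg" where
  "tens n f = elem_tensor (map f [0..<n])"

definition entry :: "'a::one list \<Rightarrow> nat \<Rightarrow> 'a" where
  "entry as i = (if i < length as then as ! i else 1)"

lemma elem_tensor_tens: "elem_tensor as = tens (length as) (entry as)"
  unfolding tens_def by (rule arg_cong[of _ _ elem_tensor], rule nth_equalityI) (simp_all add: entry_def)

lemma map_upt_upd: "k < n \<Longrightarrow> map (f(k := x)) [0..<n] = (map f [0..<n])[k := x]"
  by (simp add: list_eq_iff_nth_eq nth_list_update)

lemma tens_cong: "(\<And>i. i < n \<Longrightarrow> f i = g i) \<Longrightarrow> tens n f = tens n g"
  unfolding tens_def by (rule arg_cong[of _ _ elem_tensor]) simp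

lemma tens_add:
  assumes "k < n" "f k = g k + h k" "\<And>i. i < n \<Longrightarrow> i \<noteq> k \<Longrightarrow> g i = f i" "\<And>i. i < n \<Longrightarrow> i \<noteq> k \<Longrightarrow> h i = f i"
  shows "tens n f = tens n g + tens n h"
proof -
  have "map f [0..<n] = (map f [0..<n])[k := g k + h k]"
    "map g [0..<n] = (map f [0..<n])[k := g k]" "map h [0..<n] = (map f [0..<n])[k := h k]"
    using assms by (simp_all add: list_eq_iff_nth_eq nth_list_update)
  then show ?thesis unfolding tens_def using assms(1)
    by (metis elem_tensor_add length_map length_upt minus_nat.diff_0)
qed

lemma tens_scale:
  assumes "k < n" "f k = c *\<^sub>C g k" "\<And>i. i < n \<Longrightarrow> i \<noteq> k \<Longrightarrow> g i = f i"
  shows "tens n f = c *\<^sub>C tens n g"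
proof -
  have "map f [0..<n] = (map f [0..<n])[k := c *\<^sub>C g k]"
    "map g [0..<n] = (map f [0..<n])[k := g k]"
    using assms by (simp_all add: list_eq_iff_nth_eq nth_list_update)
  then show ?thesis unfolding tens_def using assms(1)
    by (metis elem_tensor_scale length_map length_upt minus_nat.diff_0)
qed

lemma tens_zero: "k < n \<Longrightarrow> f k = 0 \<Longrightarrow> tens n f = 0"
  using tens_scale[of k n f 0 f] by simp

lemma tens_Suc: "f n = 1 \<Longrightarrow> tens (Suc n) f = tens n f"
  by (simp add: tens_def elem_tensor_one)

lemma tens_extend: "n \<le> m \<Longrightarrow> tens n f = tens m (\<lambda>i. if i < n then f i else 1)"
proof (induction m rule: dec_induct)
  case base
  show ?case by (rule tens_cong) simp
next
  case (step m)
  then show ?case by (simp add: tens_Suc)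
qed

subsection \<open>Parities and signs\<close>

text \<open>\<open>graded_part p\<close> projects on the odd (\<open>p = True\<close>) or even part. For elementary tensors with
  homogeneous entries, odd exactly at the positions \<open>P\<close> respectively \<open>Q\<close>, \<open>koszul_sign n P Q\<close> is
  the product of \<open>\<epsilon>(a\<^sub>i, b\<^sub>j)\<close> over \<open>i > j\<close>.\<close>

definition graded_part :: "bool \<Rightarrow> 'a::graded_cstar_algebra \<Rightarrow> 'a" where
  "graded_part p a = (1/2) *\<^sub>C (if p then a - grading a else a + grading a)"

definition koszul_sign :: "nat \<Rightarrow> nat set \<Rightarrow> nat set \<Rightarrow> complex" where
  "koszul_sign n P Q = (\<Prod>i<n. \<Prod>j<i. if i \<in> P \<and> j \<in> Q then - 1 else 1)"

lemma graded_part_add: "graded_part p (x + y) = graded_part p x + graded_part p y"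
  by (simp add: graded_part_def grading_add flip: scaleC_add_right) (simp add: algebra_simps)

lemma graded_part_scaleC: "graded_part p (c *\<^sub>C x) = c *\<^sub>C graded_part p x"
  by (simp add: graded_part_def mult.commute flip: scaleC_add_right scaleC_diff_right)

lemma graded_part_zero [simp]: "graded_part p 0 = 0"
  by (simp add: graded_part_def)

lemma half_half: "(1/2) *\<^sub>C (x + x) = (x::'a::complex_vector)"
  by (simp add: scaleC_add_right flip: scaleC_add_left)

lemma graded_part_one [simp]: "graded_part p 1 = (if p then 0 else 1)"
  by (simp add: graded_part_def half_half)

lemma graded_part_sum: "graded_part False x + graded_part True x = x"
  by (simp add: graded_part_def half_half flip: scaleC_add_right)

lemma grading_diff: "grading (x - y) = grading x - grading (y::'a::graded_cstar_algebra)"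
  using grading_add[of x "- y"] by (simp add: grading_minus)

lemma grading_graded_part: "grading (graded_part p x) = (if p then - graded_part p x else graded_part p x)"
  by (cases p) (simp_all add: graded_part_def grading_add grading_diff add.commute scaleC_diff_right)

lemma graded_part_eq_iff: "graded_part p x = x \<longleftrightarrow> grading x = (if p then - x else x)"
proof
  show "graded_part p x = x \<Longrightarrow> grading x = (if p then - x else x)"
    by (metis grading_graded_part)
  show "grading x = (if p then - x else x) \<Longrightarrow> graded_part p x = x"
    by (simp add: graded_part_def half_half split: if_splits)
qed

lemma graded_part_other: "grading x = (if p then - x else x) \<Longrightarrow> q \<noteq> p \<Longrightarrow> graded_part q x = 0"
  by (simp add: graded_part_def split: if_splits)

definition homog :: "nat \<Rightarrow> nat set \<Rightarrow> (nat \<Rightarrow> 'a::graded_cstar_algebra) \<Rightarrow> bool" where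
  "homog n P f \<longleftrightarrow> P \<subseteq> {..<n} \<and> (\<forall>i<n. grading (f i) = (if i \<in> P then - f i else f i))"

lemma homog_graded_part: "P \<subseteq> {..<n} \<Longrightarrow> homog n P (\<lambda>i. graded_part (i \<in> P) (f i))"
  by (simp add: homog_def grading_graded_part)

lemma sum_Pow_Suc: "(\<Sum>P\<in>Pow {..<Suc m}. F P) = (\<Sum>P\<in>Pow {..<m}. F P + F (insert m P))"
  for F :: "nat set \<Rightarrow> 'b::comm_monoid_add"
proof -
  have "Pow {..<Suc m} = Pow {..<m} \<union> insert m ` Pow {..<m}"
    by (simp add: lessThan_Suc Pow_insert)
  moreover have "Pow {..<m} \<inter> insert m ` Pow {..<m} = {}" by auto
  moreover have "inj_on (insert m) (Pow {..<m})"
    by (intro inj_onI) (metis PowD insert_ident lessThan_iff less_irrefl subset_iff)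
  ultimately show ?thesis
    by (simp add: sum.union_disjoint sum.reindex sum.distrib)
qed

lemma tens_expand_aux: "m \<le> n \<Longrightarrow>
  tens n f = (\<Sum>P\<in>Pow {..<m}. tens n (\<lambda>i. if i < m then graded_part (i \<in> P) (f i) else f i))"
proof (induction m)
  case 0
  then show ?case by simp
next
  case (Suc m)
  have "tens n (\<lambda>i. if i < m then graded_part (i \<in> P) (f i) else f i) =
      tens n (\<lambda>i. if i < Suc m then graded_part (i \<in> P) (f i) else f i) +
      tens n (\<lambda>i. if i < Suc m then graded_part (i \<in> insert m P) (f i) else f i)"
    if P: "P \<in> Pow {..<m}" for P
  proof (rule tens_add[where k = m])
    have "m \<notin> P" using P by auto
    then show "(if m < m then graded_part (m \<in> P) (f m) else f m) =
      (if m < Suc m then graded_part (m \<in> P) (f m) else f m) +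
      (if m < Suc m then graded_part (m \<in> insert m P) (f m) else f m)"
      by (simp add: graded_part_sum)
  qed (use Suc.prems in auto)
  then have "(\<Sum>P\<in>Pow {..<m}. tens n (\<lambda>i. if i < m then graded_part (i \<in> P) (f i) else f i)) =
    (\<Sum>P\<in>Pow {..<Suc m}. tens n (\<lambda>i. if i < Suc m then graded_part (i \<in> P) (f i) else f i))"
    unfolding sum_Pow_Suc by (intro sum.cong HOL.refl)
  then show ?case using Suc by simp
qed

lemma tens_expand: "tens n f = (\<Sum>P\<in>Pow {..<n}. tens n (\<lambda>i. graded_part (i \<in> P) (f i)))"
  by (subst tens_expand_aux[OF order_refl]) (auto intro!: sum.cong tens_cong)

subsection \<open>Multiplication and involution\<close>

text \<open>Products and adjoints of elementary tensors with arbitrary entries, obtained by decomposing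
  all entries into their homogeneous parts. As \<open>\<epsilon>\<close> is symmetric, the sign in the adjoint, a product
  of \<open>\<epsilon>(a\<^sub>i, a\<^sub>j)\<close> over \<open>i < j\<close>, is \<open>koszul_sign n P P\<close>.\<close>

definition fermi_mult :: "'a::graded_cstar_algebra list \<Rightarrow> 'a list \<Rightarrow> 'a fermi_alg" where
  "fermi_mult as bs = (let n = max (length as) (length bs) in
    \<Sum>P\<in>Pow {..<n}. \<Sum>Q\<in>Pow {..<n}. koszul_sign n P Q *\<^sub>C
      elem_tensor (map (\<lambda>i. graded_part (i \<in> P) (entry as i) * graded_part (i \<in> Q) (entry bs i)) [0..<n]))"

definition fermi_star :: "'a::graded_cstar_algebra list \<Rightarrow> 'a fermi_alg" where
  "fermi_star as = (let n = length as in
    \<Sum>P\<in>Pow {..<n}. koszul_sign n P P *\<^sub>C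
      elem_tensor (map (\<lambda>i. star (graded_part (i \<in> P) (entry as i))) [0..<n]))"

instantiation fermi_alg :: (graded_cstar_algebra) "{one, times, star}"
begin

definition one_fermi_alg :: "'a fermi_alg" where
  "one_fermi_alg = elem_tensor []"

definition times_fermi_alg :: "'a fermi_alg \<Rightarrow> 'a fermi_alg \<Rightarrow> 'a fermi_alg" where
  "x * y = tensor_ext (\<lambda>c. c) (\<lambda>as. tensor_ext (\<lambda>c. c) (\<lambda>bs. fermi_mult as bs) y) x"

definition star_fermi_alg :: "'a fermi_alg \<Rightarrow> 'a fermi_alg" where
  "star x = tensor_ext cnj fermi_star x"

instance ..

end

definition mult_tens where
  "mult_tens n a b = (\<Sum>P\<in>Pow {..<n}. \<Sum>Q\<in>Pow {..<n}. koszul_sign n P Q *\<^sub>C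
      tens n (\<lambda>i. graded_part (i \<in> P) (a i) * graded_part (i \<in> Q) (b i)))"

definition star_tens where
  "star_tens n a = (\<Sum>P\<in>Pow {..<n}. koszul_sign n P P *\<^sub>C tens n (\<lambda>i. star (graded_part (i \<in> P) (a i))))"

lemma fermi_mult_eq: "fermi_mult as bs = mult_tens (max (length as) (length bs)) (entry as) (entry bs)"
  by (simp add: fermi_mult_def mult_tens_def tens_def Let_def)

lemma fermi_star_eq: "fermi_star as = star_tens (length as) (entry as)"
  by (simp add: fermi_star_def star_tens_def tens_def Let_def)

lemma entry_upd: "k < length as \<Longrightarrow> entry (as[k := x]) = (entry as)(k := x)"
  by (auto simp: entry_def fun_eq_iff nth_list_update)

lemma entry_append_one: "entry (as @ [1]) = entry as"
  by (auto simp: entry_def fun_eq_iff nth_append)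

lemma koszul_sign_Suc:
  assumes "P \<subseteq> {..<n}"
  shows "koszul_sign (Suc n) P Q = koszul_sign n P Q"
proof -
  have "n \<notin> P" using assms by auto
  then show ?thesis by (simp add: koszul_sign_def)
qed

lemma mult_tens_Suc:
  assumes "a n = 1" "b n = 1"
  shows "mult_tens (Suc n) a b = mult_tens n a b"
proof -
  let ?T = "\<lambda>n P Q. koszul_sign n P Q *\<^sub>C tens n (\<lambda>i. graded_part (i \<in> P) (a i) * graded_part (i \<in> Q) (b i))"
  have z1: "?T (Suc n) (insert n P) Q = 0" for P Q
    using tens_zero[of n "Suc n" "\<lambda>i. graded_part (i \<in> insert n P) (a i) * graded_part (i \<in> Q) (b i)"]
    by (simp add: assms)
  have z2: "?T (Suc n) P (insert n Q) = 0" for P Q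
    using tens_zero[of n "Suc n" "\<lambda>i. graded_part (i \<in> P) (a i) * graded_part (i \<in> insert n Q) (b i)"]
    by (simp add: assms)
  have e: "?T (Suc n) P Q = ?T n P Q" if "P \<in> Pow {..<n}" "Q \<in> Pow {..<n}" for P Q
  proof -
    have "n \<notin> P" "n \<notin> Q" using that by auto
    then show ?thesis using that by (simp add: koszul_sign_Suc tens_Suc assms)
  qed
  show ?thesis unfolding mult_tens_def sum_Pow_Suc z1 z2
    by (simp only: sum.neutral_const add_0_right) (intro sum.cong e HOL.refl)
qed

lemma star_tens_Suc:
  assumes "a n = 1"
  shows "star_tens (Suc n) a = star_tens n a"
proof -
  let ?T = "\<lambda>n P. koszul_sign n P P *\<^sub>C tens n (\<lambda>i. star (graded_part (i \<in> P) (a i)))"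
  have z1: "?T (Suc n) (insert n P) = 0" for P
    using tens_zero[of n "Suc n" "\<lambda>i. star (graded_part (i \<in> insert n P) (a i))"]
    by (simp add: assms)
  have e: "?T (Suc n) P = ?T n P" if "P \<in> Pow {..<n}" for P
  proof -
    have "n \<notin> P" using that by auto
    then show ?thesis using that by (simp add: koszul_sign_Suc tens_Suc assms)
  qed
  show ?thesis unfolding star_tens_def sum_Pow_Suc z1
    by (simp only: sum.neutral_const add_0_right) (intro sum.cong e HOL.refl)
qed

lemma mult_tens_mono:
  "m \<le> n \<Longrightarrow> (\<And>i. m \<le> i \<Longrightarrow> a i = 1) \<Longrightarrow> (\<And>i. m \<le> i \<Longrightarrow> b i = 1) \<Longrightarrow> mult_tens n a b = mult_tens m a b"
  by (induction n rule: dec_induct) (simp_all add: mult_tens_Suc)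

lemma mult_tens_left:
  assumes k: "k < n"
  shows "mult_tens n (a(k := x + y)) b = mult_tens n (a(k := x)) b + mult_tens n (a(k := y)) b"
    and "mult_tens n (a(k := c *\<^sub>C x)) b = c *\<^sub>C mult_tens n (a(k := x)) b"
proof -
  let ?t = "\<lambda>z P Q. tens n (\<lambda>i. graded_part (i \<in> P) ((a(k := z)) i) * graded_part (i \<in> Q) (b i))"
  have "?t (x + y) P Q = ?t x P Q + ?t y P Q" for P Q
    by (rule tens_add[OF k]) (simp_all add: graded_part_add distrib_right)
  then show "mult_tens n (a(k := x + y)) b = mult_tens n (a(k := x)) b + mult_tens n (a(k := y)) b"
    unfolding mult_tens_def by (simp only: scaleC_add_right sum.distrib)
  have "?t (c *\<^sub>C x) P Q = c *\<^sub>C ?t x P Q" for P Q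
    by (rule tens_scale[OF k]) (simp_all add: graded_part_scaleC)
  then show "mult_tens n (a(k := c *\<^sub>C x)) b = c *\<^sub>C mult_tens n (a(k := x)) b"
    unfolding mult_tens_def by (simp only: scaleC_sum_right scaleC_scaleC mult.commute)
qed

lemma mult_tens_right:
  assumes k: "k < n"
  shows "mult_tens n a (b(k := x + y)) = mult_tens n a (b(k := x)) + mult_tens n a (b(k := y))"
    and "mult_tens n a (b(k := c *\<^sub>C x)) = c *\<^sub>C mult_tens n a (b(k := x))"
proof -
  let ?t = "\<lambda>z P Q. tens n (\<lambda>i. graded_part (i \<in> P) (a i) * graded_part (i \<in> Q) ((b(k := z)) i))"
  have "?t (x + y) P Q = ?t x P Q + ?t y P Q" for P Q
    by (rule tens_add[OF k]) (simp_all add: graded_part_add distrib_left)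
  then show "mult_tens n a (b(k := x + y)) = mult_tens n a (b(k := x)) + mult_tens n a (b(k := y))"
    unfolding mult_tens_def by (simp only: scaleC_add_right sum.distrib)
  have "?t (c *\<^sub>C x) P Q = c *\<^sub>C ?t x P Q" for P Q
    by (rule tens_scale[OF k]) (simp_all add: graded_part_scaleC)
  then show "mult_tens n a (b(k := c *\<^sub>C x)) = c *\<^sub>C mult_tens n a (b(k := x))"
    unfolding mult_tens_def by (simp only: scaleC_sum_right scaleC_scaleC mult.commute)
qed

lemma star_tens_lin:
  assumes k: "k < n"
  shows "star_tens n (a(k := x + y)) = star_tens n (a(k := x)) + star_tens n (a(k := y))"
    and "star_tens n (a(k := c *\<^sub>C x)) = cnj c *\<^sub>C star_tens n (a(k := x))"
proof -
  let ?t = "\<lambda>z P. tens n (\<lambda>i. star (graded_part (i \<in> P) ((a(k := z)) i)))"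
  have "?t (x + y) P = ?t x P + ?t y P" for P
    by (rule tens_add[OF k]) (simp_all add: graded_part_add star_add)
  then show "star_tens n (a(k := x + y)) = star_tens n (a(k := x)) + star_tens n (a(k := y))"
    unfolding star_tens_def by (simp only: scaleC_add_right sum.distrib)
  have "?t (c *\<^sub>C x) P = cnj c *\<^sub>C ?t x P" for P
    by (rule tens_scale[OF k]) (simp_all add: graded_part_scaleC)
  then show "star_tens n (a(k := c *\<^sub>C x)) = cnj c *\<^sub>C star_tens n (a(k := x))"
    unfolding star_tens_def by (simp only: scaleC_sum_right scaleC_scaleC mult.commute)
qed

lemma entry_ge: "length as \<le> i \<Longrightarrow> entry as i = 1"
  by (simp add: entry_def)

lemma multilinear_fermi_mult_right: "multilinear (\<lambda>c. c) (\<lambda>bs. fermi_mult as bs)"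
proof -
  have "fermi_mult as (bs @ [1]) = fermi_mult as bs" for bs
    unfolding fermi_mult_eq entry_append_one by (rule mult_tens_mono) (auto simp: entry_ge)
  then show ?thesis
    by (auto simp: multilinear_def fermi_mult_eq entry_upd mult_tens_right less_max_iff_disj)
qed

lemma multilinear_fermi_mult_left: "multilinear (\<lambda>c. c) (\<lambda>as. tensor_ext (\<lambda>c. c) (\<lambda>bs. fermi_mult as bs) y)"
proof -
  have "fermi_mult (as @ [1]) bs = fermi_mult as bs" for as bs :: "'a list"
    unfolding fermi_mult_eq entry_append_one by (rule mult_tens_mono) (auto simp: entry_ge)
  moreover have "(\<Sum>(c, as)\<leftarrow>s. c *\<^sub>C (F as + G as)) = (\<Sum>(c, as)\<leftarrow>s. c *\<^sub>C F as) + (\<Sum>(c, as)\<leftarrow>s. c *\<^sub>C G as)"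
    for s and F G :: "'a list \<Rightarrow> 'a fermi_alg"
    by (induction s) (auto simp: scaleC_add_right)
  moreover have "(\<Sum>(c, as)\<leftarrow>s. c *\<^sub>C (z *\<^sub>C F as)) = z *\<^sub>C (\<Sum>(c, as)\<leftarrow>s. c *\<^sub>C F as)"
    for s z and F :: "'a list \<Rightarrow> 'a fermi_alg"
    by (induction s) (auto simp: scaleC_add_right mult.commute)
  ultimately show ?thesis
    by (auto simp: multilinear_def fermi_mult_eq entry_upd mult_tens_left less_max_iff_disj tensor_ext_def
        simp del: scaleC_scaleC)
qed

lemma multilinear_fermi_star: "multilinear cnj fermi_star"
  by (auto simp: multilinear_def fermi_star_eq entry_upd entry_append_one star_tens_lin star_tens_Suc entry_ge)

lemma elem_tensor_mult: "elem_tensor as * elem_tensor bs = fermi_mult as bs"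
  unfolding times_fermi_alg_def tensor_ext_elem[OF multilinear_fermi_mult_left]
  by (rule tensor_ext_elem[OF multilinear_fermi_mult_right])

lemma elem_tensor_star: "star (elem_tensor as) = fermi_star as"
  by (simp add: star_fermi_alg_def tensor_ext_elem multilinear_fermi_star)

lemma fermi_distrib:
  fixes x y z :: "'a::graded_cstar_algebra fermi_alg"
  shows "(x + y) * z = x * z + y * z" "x * (y + z) = x * y + x * z"
    "(c *\<^sub>C x) * y = c *\<^sub>C (x * y)" "x * (c *\<^sub>C y) = c *\<^sub>C (x * y)"
proof -
  show a: "(x + y) * z = x * z + y * z" for x y z :: "'a fermi_alg"
    by (simp add: times_fermi_alg_def tensor_ext_add multilinear_fermi_mult_left)
  show b: "(c *\<^sub>C x) * y = c *\<^sub>C (x * y)" for c and x y :: "'a fermi_alg"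
    by (simp add: times_fermi_alg_def tensor_ext_scaleC multilinear_fermi_mult_left)
  have z: "0 * y = 0" for y :: "'a fermi_alg" using b[of 0 0 y] by simp
  have e: "elem_tensor as * y = tensor_ext (\<lambda>c. c) (\<lambda>bs. fermi_mult as bs) y" for as and y :: "'a fermi_alg"
    by (simp add: times_fermi_alg_def tensor_ext_elem multilinear_fermi_mult_left)
  obtain s where x: "x = abs_fermi_alg s" by (metis fermi_alg_cases)
  show "x * (y + z) = x * y + x * z" unfolding x abs_fermi_alg_sum
    by (induction s)
      (auto simp: z a b e tensor_ext_add[OF multilinear_fermi_mult_right] scaleC_add_right add_ac)
  show "x * (c *\<^sub>C y) = c *\<^sub>C (x * y)" unfolding x abs_fermi_alg_sum
    by (induction s)
      (auto simp: z a b e tensor_ext_scaleC[OF multilinear_fermi_mult_right] scaleC_add_right mult.commute)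
qed

lemma fermi_star_lin:
  fixes x y :: "'a::graded_cstar_algebra fermi_alg"
  shows "star (x + y) = star x + star y" "star (c *\<^sub>C x) = cnj c *\<^sub>C star x"
  by (simp_all add: star_fermi_alg_def tensor_ext_add tensor_ext_scaleC multilinear_fermi_star)

lemma entry_map: "i < n \<Longrightarrow> entry (map f [0..<n]) i = f i"
  by (simp add: entry_def)

lemma tens_mult: "tens n a * tens n b = mult_tens n a b"
proof -
  have "tens n (\<lambda>i. graded_part (i \<in> P) (entry (map a [0..<n]) i) * graded_part (i \<in> Q) (entry (map b [0..<n]) i)) =
     tens n (\<lambda>i. graded_part (i \<in> P) (a i) * graded_part (i \<in> Q) (b i))" for P Q
    by (rule tens_cong) (simp add: entry_map)
  then show ?thesis
    unfolding tens_def[of n a] tens_def[of n b] elem_tensor_mult fermi_mult_eq mult_tens_def by simp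
qed

lemma tens_star: "star (tens n a) = star_tens n a"
proof -
  have "tens n (\<lambda>i. star (graded_part (i \<in> P) (entry (map a [0..<n]) i))) =
     tens n (\<lambda>i. star (graded_part (i \<in> P) (a i)))" for P
    by (rule tens_cong) (simp add: entry_map)
  then show ?thesis
    unfolding tens_def[of n a] elem_tensor_star fermi_star_eq star_tens_def by simp
qed

lemma homog_part:
  assumes "homog n P a" "P' \<subseteq> {..<n}"
  shows "P' = P \<Longrightarrow> i < n \<Longrightarrow> graded_part (i \<in> P') (a i) = a i"
    and "P' \<noteq> P \<Longrightarrow> \<exists>i<n. graded_part (i \<in> P') (a i) = 0"
proof -
  show "P' = P \<Longrightarrow> i < n \<Longrightarrow> graded_part (i \<in> P') (a i) = a i"
    using assms(1) by (simp add: homog_def graded_part_eq_iff)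
  assume "P' \<noteq> P"
  then obtain i where i: "i < n" "(i \<in> P') \<noteq> (i \<in> P)" using assms by (auto simp: homog_def)
  then have "graded_part (i \<in> P') (a i) = 0"
    using assms(1) graded_part_other by (metis homog_def)
  then show "\<exists>i<n. graded_part (i \<in> P') (a i) = 0" using i by blast
qed

lemma tens_mult_homog:
  assumes a: "homog n P a" and b: "homog n Q b"
  shows "tens n a * tens n b = koszul_sign n P Q *\<^sub>C tens n (\<lambda>i. a i * b i)"
proof -
  let ?T = "\<lambda>P' Q'. koszul_sign n P' Q' *\<^sub>C
      tens n (\<lambda>i. graded_part (i \<in> P') (a i) * graded_part (i \<in> Q') (b i))"
  have z: "?T P' Q' = (if P' = P then if Q' = Q then koszul_sign n P Q *\<^sub>C tens n (\<lambda>i. a i * b i) else 0 else 0)"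
    if PQ: "P' \<in> Pow {..<n}" "Q' \<in> Pow {..<n}" for P' Q'
  proof (cases "P' = P \<and> Q' = Q")
    case True
    have "tens n (\<lambda>i. graded_part (i \<in> P') (a i) * graded_part (i \<in> Q') (b i)) = tens n (\<lambda>i. a i * b i)"
      by (rule tens_cong) (use True PQ homog_part(1)[OF a] homog_part(1)[OF b] in auto)
    then show ?thesis using True by simp
  next
    case False
    then obtain i where "i < n" "graded_part (i \<in> P') (a i) = 0 \<or> graded_part (i \<in> Q') (b i) = 0"
      using PQ homog_part(2)[OF a, of P'] homog_part(2)[OF b, of Q'] by auto
    then have "tens n (\<lambda>i. graded_part (i \<in> P') (a i) * graded_part (i \<in> Q') (b i)) = 0"
      by (auto intro: tens_zero)
    then show ?thesis using False by simp
  qed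
  have "P \<in> Pow {..<n}" "Q \<in> Pow {..<n}" using a b by (auto simp: homog_def)
  moreover have "mult_tens n a b = (\<Sum>P'\<in>Pow {..<n}. \<Sum>Q'\<in>Pow {..<n}.
      if P' = P then if Q' = Q then koszul_sign n P Q *\<^sub>C tens n (\<lambda>i. a i * b i) else 0 else 0)"
    unfolding mult_tens_def by (intro sum.cong z HOL.refl)
  moreover have "\<dots> = (\<Sum>P'\<in>Pow {..<n}.
      if P' = P then \<Sum>Q'\<in>Pow {..<n}. if Q' = Q then koszul_sign n P Q *\<^sub>C tens n (\<lambda>i. a i * b i) else 0 else 0)"
    by (intro sum.cong) auto
  ultimately show ?thesis by (simp add: tens_mult)
qed

lemma tens_star_homog:
  assumes a: "homog n P a"
  shows "star (tens n a) = koszul_sign n P P *\<^sub>C tens n (\<lambda>i. star (a i))"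
proof -
  let ?T = "\<lambda>P'. koszul_sign n P' P' *\<^sub>C tens n (\<lambda>i. star (graded_part (i \<in> P') (a i)))"
  have z: "?T P' = (if P' = P then koszul_sign n P P *\<^sub>C tens n (\<lambda>i. star (a i)) else 0)"
    if PQ: "P' \<in> Pow {..<n}" for P'
  proof (cases "P' = P")
    case True
    have "tens n (\<lambda>i. star (graded_part (i \<in> P') (a i))) = tens n (\<lambda>i. star (a i))"
      by (rule tens_cong) (use True PQ homog_part(1)[OF a] in auto)
    then show ?thesis using True by simp
  next
    case False
    then obtain i where "i < n" "graded_part (i \<in> P') (a i) = 0"
      using PQ homog_part(2)[OF a, of P'] by auto
    then have "tens n (\<lambda>i. star (graded_part (i \<in> P') (a i))) = 0"
      by (auto intro: tens_zero)
    then show ?thesis using False by simp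
  qed
  have "P \<in> Pow {..<n}" using a by (auto simp: homog_def)
  moreover have "star_tens n a =
      (\<Sum>P'\<in>Pow {..<n}. if P' = P then koszul_sign n P P *\<^sub>C tens n (\<lambda>i. star (a i)) else 0)"
    unfolding star_tens_def by (intro sum.cong z HOL.refl)
  ultimately show ?thesis by (simp add: tens_star)
qed

definition fermi_level :: "nat \<Rightarrow> 'a::graded_cstar_algebra fermi_alg set" where
  "fermi_level n = {\<Sum>(c, as)\<leftarrow>s. c *\<^sub>C elem_tensor as | s. \<forall>(c, as)\<in>set s. length as = n}"

lemma fermi_level_zero: "0 \<in> fermi_level n"
  unfolding fermi_level_def by (rule CollectI, rule exI[of _ "[]"]) simp

lemma fermi_level_add: "x \<in> fermi_level n \<Longrightarrow> y \<in> fermi_level n \<Longrightarrow> x + y \<in> fermi_level n"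
  unfolding fermi_level_def
proof clarify
  fix s t :: "(complex \<times> 'a list) list"
  assume "\<forall>(c, as)\<in>set s. length as = n" "\<forall>(c, as)\<in>set t. length as = n"
  then show "\<exists>u. (\<Sum>(c, as)\<leftarrow>s. c *\<^sub>C elem_tensor as) + (\<Sum>(c, as)\<leftarrow>t. c *\<^sub>C elem_tensor as) =
      (\<Sum>(c, as)\<leftarrow>u. c *\<^sub>C elem_tensor as) \<and> (\<forall>(c, as)\<in>set u. length as = n)"
    by (intro exI[of _ "s @ t"]) auto
qed

lemma fermi_level_scaleC: "x \<in> fermi_level n \<Longrightarrow> z *\<^sub>C x \<in> fermi_level n"
  unfolding fermi_level_def
proof clarify
  fix s :: "(complex \<times> 'a list) list"
  assume "\<forall>(c, as)\<in>set s. length as = n"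
  moreover have "z *\<^sub>C (\<Sum>(c, as)\<leftarrow>s. c *\<^sub>C elem_tensor as) =
     (\<Sum>(c, as)\<leftarrow>map (\<lambda>(c, as). (z * c, as)) s. c *\<^sub>C elem_tensor as)"
    by (induction s) (auto simp: scaleC_add_right)
  ultimately show "\<exists>u. z *\<^sub>C (\<Sum>(c, as)\<leftarrow>s. c *\<^sub>C elem_tensor as) =
      (\<Sum>(c, as)\<leftarrow>u. c *\<^sub>C elem_tensor as) \<and> (\<forall>(c, as)\<in>set u. length as = n)"
    by (intro exI[of _ "map (\<lambda>(c, as). (z * c, as)) s"]) auto
qed

lemma fermi_level_tens: "tens n f \<in> fermi_level n"
  unfolding fermi_level_def tens_def
  by (rule CollectI, rule exI[of _ "[(1, map f [0..<n])]"]) simp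

lemma fermi_level_sum: "(\<And>i. i \<in> I \<Longrightarrow> f i \<in> fermi_level n) \<Longrightarrow> (\<Sum>i\<in>I. f i) \<in> fermi_level n"
  by (induction I rule: infinite_finite_induct) (auto intro: fermi_level_zero fermi_level_add)

lemma fermi_level_homog_induct [consumes 1, case_names zero add scale tens]:
  assumes "x \<in> fermi_level n"
    and zero: "Q 0"
    and add: "\<And>x y. x \<in> fermi_level n \<Longrightarrow> y \<in> fermi_level n \<Longrightarrow> Q x \<Longrightarrow> Q y \<Longrightarrow> Q (x + y)"
    and scale: "\<And>c x. x \<in> fermi_level n \<Longrightarrow> Q x \<Longrightarrow> Q (c *\<^sub>C x)"
    and tens: "\<And>P a. homog n P a \<Longrightarrow> Q (tens n a)"
  shows "Q x"
proof -
  obtain s where x: "x = (\<Sum>(c, as)\<leftarrow>s. c *\<^sub>C elem_tensor as)" and s: "\<forall>(c, as)\<in>set s. length as = n"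
    using assms(1) by (auto simp: fermi_level_def)
  have t: "tens n f \<in> fermi_level n \<and> Q (tens n f)" for f
  proof -
    have "(\<Sum>P\<in>A. tens n (\<lambda>i. graded_part (i \<in> P) (f i))) \<in> fermi_level n \<and>
        Q (\<Sum>P\<in>A. tens n (\<lambda>i. graded_part (i \<in> P) (f i)))" if "A \<subseteq> Pow {..<n}" for A
    proof -
      have "finite A" using that by (rule finite_subset) simp
      then show ?thesis using that
      proof (induction A)
        case (insert P A)
        then show ?case
          using tens[OF homog_graded_part[of P n f]]
          by (auto intro!: add fermi_level_add fermi_level_tens)
      qed (simp add: zero fermi_level_zero)
    qed
    from this[OF order_refl] show ?thesis by (simp flip: tens_expand)
  qed
  have "x \<in> fermi_level n \<and> Q x" using s unfolding x
  proof (induction s)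
    case (Cons p s)
    obtain c as where p: "p = (c, as)" by force
    have "length as = n" using Cons p by simp
    then have "elem_tensor as \<in> fermi_level n \<and> Q (elem_tensor as)"
      unfolding elem_tensor_tens using t by simp
    then show ?case using Cons by (auto simp: p intro!: add scale fermi_level_add fermi_level_scaleC)
  qed (simp add: zero fermi_level_zero)
  then show ?thesis by simp
qed

lemma fermi_level_Suc: "x \<in> fermi_level n \<Longrightarrow> x \<in> fermi_level (Suc n)"
proof (induction rule: fermi_level_homog_induct)
  case (tens P a)
  have "tens n a = tens (Suc n) (\<lambda>i. if i < n then a i else 1)" by (rule tens_extend) simp
  then show ?case by (simp add: fermi_level_tens)
qed (auto intro: fermi_level_zero fermi_level_add fermi_level_scaleC)

lemma fermi_level_mono: "m \<le> n \<Longrightarrow> x \<in> fermi_level m \<Longrightarrow> x \<in> fermi_level n"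
  by (induction n rule: dec_induct) (auto intro: fermi_level_Suc)

lemma fermi_level_ex: "\<exists>n. x \<in> fermi_level n"
proof -
  obtain s where x: "x = (\<Sum>(c, as)\<leftarrow>s. c *\<^sub>C elem_tensor as)" by (metis fermi_alg_cases abs_fermi_alg_sum)
  show ?thesis unfolding x
  proof (induction s)
    case (Cons p s)
    then obtain n where n: "(\<Sum>(c, as)\<leftarrow>s. c *\<^sub>C elem_tensor as) \<in> fermi_level n" by blast
    obtain c as where p: "p = (c, as)" by force
    have "elem_tensor as \<in> fermi_level (length as)" unfolding elem_tensor_tens by (rule fermi_level_tens)
    then have "elem_tensor as \<in> fermi_level (max n (length as))" by (rule fermi_level_mono[OF max.cobounded2])
    then have "(\<Sum>(c, as)\<leftarrow>(p # s). c *\<^sub>C elem_tensor as) \<in> fermi_level (max n (length as))"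
      using fermi_level_mono[OF _ n, of "max n (length as)"]
      by (simp add: p fermi_level_add fermi_level_scaleC)
    then show ?case by blast
  qed (auto intro: fermi_level_zero)
qed

lemma fermi_level_common:
  obtains n where "x \<in> fermi_level n" "y \<in> fermi_level n" "z \<in> fermi_level n"
proof -
  obtain a b c where "x \<in> fermi_level a" "y \<in> fermi_level b" "z \<in> fermi_level c"
    using fermi_level_ex[of x] fermi_level_ex[of y] fermi_level_ex[of z] by blast
  then have "x \<in> fermi_level (max a (max b c))" "y \<in> fermi_level (max a (max b c))" "z \<in> fermi_level (max a (max b c))"
    by (auto elim!: fermi_level_mono[rotated])
  then show ?thesis by (rule that)
qed

definition parity_diff :: "nat set \<Rightarrow> nat set \<Rightarrow> nat set" where
  "parity_diff P Q = {i. (i \<in> P) \<noteq> (i \<in> Q)}"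

lemma homog_mult: "homog n P a \<Longrightarrow> homog n Q b \<Longrightarrow> homog n (parity_diff P Q) (\<lambda>i. a i * b i)"
  by (auto simp: homog_def parity_diff_def grading_mult)

lemma homog_star: "homog n P a \<Longrightarrow> homog n P (\<lambda>i. star (a i))"
  by (auto simp: homog_def grading_star)

lemma koszul_sign_diff_left: "koszul_sign n (parity_diff P Q) R = koszul_sign n P R * koszul_sign n Q R"
  unfolding koszul_sign_def prod.distrib[symmetric] by (auto simp: parity_diff_def intro!: prod.cong)

lemma koszul_sign_diff_right: "koszul_sign n P (parity_diff Q R) = koszul_sign n P Q * koszul_sign n P R"
  unfolding koszul_sign_def prod.distrib[symmetric] by (auto simp: parity_diff_def intro!: prod.cong)

lemma koszul_sign_self: "koszul_sign n P Q * koszul_sign n P Q = 1"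
  unfolding koszul_sign_def prod.distrib[symmetric] by (auto intro!: prod.neutral)

lemma cnj_koszul_sign [simp]: "cnj (koszul_sign n P Q) = koszul_sign n P Q"
  unfolding koszul_sign_def cnj_prod by (auto intro!: prod.cong)

lemma fermi_zero_mult [simp]: "0 * (x::'a::graded_cstar_algebra fermi_alg) = 0" "x * 0 = 0"
  using fermi_distrib(3)[of 0 0 x] fermi_distrib(4)[of x 0 0] by simp_all

lemma fermi_star_zero [simp]: "star (0::'a::graded_cstar_algebra fermi_alg) = 0"
  using fermi_star_lin(2)[of 0 0] by simp

lemma fermi_one_tens: "(1::'a::graded_cstar_algebra fermi_alg) = tens n (\<lambda>_. 1)"
  using tens_extend[of 0 n "\<lambda>_. 1 :: 'a"] by (simp add: one_fermi_alg_def tens_def)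

lemma homog_one: "homog n {} (\<lambda>_. 1)"
  by (simp add: homog_def)

lemma koszul_sign_empty [simp]: "koszul_sign n {} Q = 1" "koszul_sign n P {} = 1"
  by (simp_all add: koszul_sign_def)

lemma fermi_assoc: "(x * y) * z = x * (y * (z::'a::graded_cstar_algebra fermi_alg))"
proof -
  obtain n where x: "x \<in> fermi_level n" and y: "y \<in> fermi_level n" and z: "z \<in> fermi_level n"
    by (rule fermi_level_common)
  from x show ?thesis
  proof (induction x rule: fermi_level_homog_induct)
    case x: (tens P a)
    from y show ?case
    proof (induction y rule: fermi_level_homog_induct)
      case y: (tens Q b)
      from z show ?case
      proof (induction z rule: fermi_level_homog_induct)
        case z: (tens R c)
        show ?case
          by (simp add: tens_mult_homog[OF x y] tens_mult_homog[OF y z] fermi_distrib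
              tens_mult_homog[OF homog_mult[OF x y] z] tens_mult_homog[OF x homog_mult[OF y z]]
              koszul_sign_diff_left koszul_sign_diff_right mult_ac)
      qed (simp_all add: fermi_distrib)
    qed (simp_all add: fermi_distrib)
  qed (simp_all add: fermi_distrib)
qed

lemma fermi_star_mult: "star (x * y) = star y * star (x::'a::graded_cstar_algebra fermi_alg)"
proof -
  obtain n where x: "x \<in> fermi_level n" and y: "y \<in> fermi_level n"
    by (rule fermi_level_common)
  from x show ?thesis
  proof (induction x rule: fermi_level_homog_induct)
    case x: (tens P a)
    from y show ?case
    proof (induction y rule: fermi_level_homog_induct)
      case y: (tens Q b)
      have s: "koszul_sign n P Q * (koszul_sign n P Q * w) = w" for w
        using koszul_sign_self[of n P Q] by (simp flip: mult.assoc)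
      show ?case
        by (simp add: tens_mult_homog[OF x y] fermi_distrib fermi_star_lin
            tens_star_homog[OF x] tens_star_homog[OF y]
            tens_star_homog[OF homog_mult[OF x y]] tens_mult_homog[OF homog_star[OF y] homog_star[OF x]]
            koszul_sign_diff_left koszul_sign_diff_right mult_ac star_mult s)
    qed (simp_all add: fermi_distrib fermi_star_lin)
  qed (simp_all add: fermi_distrib fermi_star_lin)
qed

instance fermi_alg :: (graded_cstar_algebra) complex_star_algebra
proof
  fix x y z :: "'a fermi_alg" and c :: complex
  show "(x * y) * z = x * (y * z)" by (rule fermi_assoc)
  show "(x + y) * z = x * z + y * z" "x * (y + z) = x * y + x * z"
    "(c *\<^sub>C x) * y = c *\<^sub>C (x * y)" "x * (c *\<^sub>C y) = c *\<^sub>C (x * y)"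
    by (rule fermi_distrib)+
  show "star (x + y) = star x + star y" "star (c *\<^sub>C x) = cnj c *\<^sub>C star x"
    by (rule fermi_star_lin)+
  show "star (x * y) = star y * star x" by (rule fermi_star_mult)
  obtain n where x: "x \<in> fermi_level n" using fermi_level_ex by blast
  then show "1 * x = x"
    by (induction x rule: fermi_level_homog_induct)
      (simp_all add: fermi_distrib fermi_one_tens[of n] tens_mult_homog[OF homog_one])
  from x show "x * 1 = x"
    by (induction x rule: fermi_level_homog_induct)
      (simp_all add: fermi_distrib fermi_one_tens[of n] tens_mult_homog[OF _ homog_one])
  from x show "star (star x) = x"
    by (induction x rule: fermi_level_homog_induct)
      (simp_all add: fermi_star_lin tens_star_homog tens_star_homog[OF homog_star] koszul_sign_self)
qed

lemma fermi_level_mult: "x \<in> fermi_level n \<Longrightarrow> y \<in> fermi_level n \<Longrightarrow> x * y \<in> fermi_level n"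
proof (induction x rule: fermi_level_homog_induct)
  case x: (tens P a)
  from x(2) show ?case
  proof (induction y rule: fermi_level_homog_induct)
    case y: (tens Q b)
    then show ?case by (simp add: tens_mult_homog[OF x(1) y] fermi_level_scaleC fermi_level_tens)
  qed (simp_all add: distrib_left fermi_level_zero fermi_level_add fermi_level_scaleC)
qed (simp_all add: distrib_right fermi_level_zero fermi_level_add fermi_level_scaleC)

lemma fermi_level_star: "x \<in> fermi_level n \<Longrightarrow> star x \<in> fermi_level n"
  by (induction x rule: fermi_level_homog_induct)
    (simp_all add: star_add tens_star_homog fermi_level_zero fermi_level_add fermi_level_scaleC fermi_level_tens)

lemma fermi_level_one: "1 \<in> fermi_level n"
  by (simp add: fermi_one_tens[of n] fermi_level_tens)

section \<open>Product states and the minimal norm\<close>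

definition product_functional ::
  "(nat \<Rightarrow> 'a::graded_cstar_algebra \<Rightarrow> complex) \<Rightarrow> 'a fermi_alg \<Rightarrow> complex" where
  "product_functional \<omega> = tensor_ext (\<lambda>c. c) (\<lambda>as. \<Prod>i<length as. \<omega> i (as ! i))"

lemma prod_upd:
  fixes k n :: nat and f :: "nat \<Rightarrow> complex"
  assumes "k < n"
  shows "(\<Prod>i<n. f i) = f k * (\<Prod>i\<in>{..<n} - {k}. f i)"
  using assms by (simp add: prod.remove[of "{..<n}" k])

lemma multilinear_product:
  assumes "\<And>i. is_state (\<omega> i)"
  shows "multilinear (\<lambda>c. c) (\<lambda>as. \<Prod>i<length as. \<omega> i (as ! i))"
proof -
  have lin: "clinear (\<omega> i)" and one: "\<omega> i 1 = 1" for i using assms by (auto simp: is_state_def)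
  have upd: "(\<Prod>i<length as. \<omega> i (as[k := x] ! i)) = \<omega> k x * (\<Prod>i\<in>{..<length as} - {k}. \<omega> i (as ! i))"
    if "k < length as" for k as x
    using that by (subst prod_upd[OF that]) (auto intro!: prod.cong)
  have app: "(\<Prod>i<length as. \<omega> i ((as @ [1]) ! i)) = (\<Prod>i<length as. \<omega> i (as ! i))" for as
    by (rule prod.cong) (auto simp: nth_append)
  show ?thesis
    by (auto simp: multilinear_def upd app clinearD[OF lin] one distrib_right)
qed

lemma product_functional_clinear: "(\<And>i. is_state (\<omega> i)) \<Longrightarrow> clinear (product_functional \<omega>)"
  by (simp add: clinear_def product_functional_def tensor_ext_add[OF multilinear_product]
      tensor_ext_scaleC[OF multilinear_product])

lemma product_functional_tens:
  "(\<And>i. is_state (\<omega> i)) \<Longrightarrow> product_functional \<omega> (tens n f) = (\<Prod>i<n. \<omega> i (f i))"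
  by (simp add: product_functional_def tens_def tensor_ext_elem[OF multilinear_product])

lemma even_state_odd:
  assumes "even_state \<rho>" "grading a = - a"
  shows "\<rho> a = 0"
proof -
  have "clinear \<rho>" "\<rho> (grading a) = \<rho> a" using assms(1) by (simp_all add: even_state_def is_state_def)
  then show ?thesis using assms(2) clinearD(4)[of \<rho> a] by simp
qed

lemma even_state_is_state: "even_state \<rho> \<Longrightarrow> is_state \<rho>"
  by (simp add: even_state_def)

lemma product_functional_star_mult:
  assumes \<omega>: "\<And>i. even_state (\<omega> i)" and a: "homog n P a" and b: "homog n Q b"
  shows "product_functional \<omega> (star (tens n a) * tens n b) = (\<Prod>i<n. \<omega> i (star (a i) * b i))"
proof -
  have st: "\<And>i. is_state (\<omega> i)" using \<omega> by (simp add: even_state_is_state)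
  have "product_functional \<omega> (star (tens n a) * tens n b) =
      koszul_sign n P P * koszul_sign n P Q * (\<Prod>i<n. \<omega> i (star (a i) * b i))"
    by (simp add: tens_star_homog[OF a] tens_mult_homog[OF homog_star[OF a] b]
        clinearD[OF product_functional_clinear[OF st]] product_functional_tens[OF st])
  also have "\<dots> = (\<Prod>i<n. \<omega> i (star (a i) * b i))"
  proof (cases "P = Q")
    case True
    then show ?thesis by (simp add: koszul_sign_self)
  next
    case False
    then obtain i where i: "i < n" "(i \<in> P) \<noteq> (i \<in> Q)" using a b by (auto simp: homog_def)
    have "grading (star (a i) * b i) = - (star (a i) * b i)"
      using i a b by (auto simp: homog_def grading_mult grading_star)
    then have "(\<Prod>i<n. \<omega> i (star (a i) * b i)) = 0"
      using even_state_odd[OF \<omega>] i(1) by (intro prod_zero) auto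
    then show ?thesis by simp
  qed
  finally show ?thesis .
qed

definition psd :: "nat \<Rightarrow> (nat \<Rightarrow> nat \<Rightarrow> complex) \<Rightarrow> bool" where
  "psd m L \<longleftrightarrow> (\<forall>c. (\<Sum>s<m. \<Sum>t<m. cnj (c s) * c t * L s t) \<in> \<real>\<^sub>\<ge>\<^sub>0)"

lemma psd_Suc:
  assumes "psd (Suc m) L"
  shows "psd m L"
  unfolding psd_def
proof
  fix c :: "nat \<Rightarrow> complex"
  have "(\<Sum>s<Suc m. \<Sum>t<Suc m. cnj ((c(m := 0)) s) * (c(m := 0)) t * L s t) =
     (\<Sum>s<m. \<Sum>t<m. cnj (c s) * c t * L s t)"
    by simp
  moreover have "(\<Sum>s<Suc m. \<Sum>t<Suc m. cnj ((c(m := 0)) s) * (c(m := 0)) t * L s t) \<in> \<real>\<^sub>\<ge>\<^sub>0"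
    using assms unfolding psd_def by blast
  ultimately show "(\<Sum>s<m. \<Sum>t<m. cnj (c s) * c t * L s t) \<in> \<real>\<^sub>\<ge>\<^sub>0" by simp
qed

text \<open>A form of the Schur product theorem.\<close>

lemma psd_schur:
  fixes a :: "nat \<Rightarrow> 'a::complex_star_algebra"
  assumes \<omega>: "pos_fun \<omega>"
  shows "psd m L \<Longrightarrow> psd m (\<lambda>s t. \<omega> (star (a s) * a t) * L s t)"
proof (induction m arbitrary: a)
  case 0
  then show ?case by (simp add: psd_def)
next
  case (Suc m)
  have lin: "clinear \<omega>" using \<omega> by (simp add: pos_fun_def)
  define K where "K s t = \<omega> (star (a s) * a t)" for s t
  define d where "d = Re (K m m)"
  have d: "0 \<le> d" "K m m = of_real d"
    unfolding d_def K_def using pos_fun_nonneg[OF \<omega>] by blast+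
  have herm: "cnj (K s t) = K t s" for s t
    unfolding K_def using pos_fun_hermitian[OF \<omega>] by metis
  have K0: "K m t = 0" if "d = 0" for t
  proof -
    have "gns_seminorm \<omega> (a m) = 0" using that by (simp add: gns_seminorm_def d_def K_def)
    then show ?thesis using pos_fun_CS[OF \<omega>, of "a m" "a t"] by (simp add: K_def)
  qed
  define a' where "a' t = a t - (K m t / of_real d) *\<^sub>C a m" for t
  define w where "w t = K m t / of_real (sqrt d)" for t
  have K': "K s t = \<omega> (star (a' s) * a' t) + cnj (w s) * w t" for s t
  proof -
    have "star (a' s) * a' t = star (a s) * a t - (K m t / of_real d) *\<^sub>C (star (a s) * a m)
      - (cnj (K m s) / of_real d) *\<^sub>C (star (a m) * a t)
      + (cnj (K m s) / of_real d * (K m t / of_real d)) *\<^sub>C (star (a m) * a m)"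
      by (simp add: a'_def star_diff left_diff_distrib right_diff_distrib scaleC_diff_right mult.commute)
    then have "\<omega> (star (a' s) * a' t) = K s t - K m t / of_real d * K s m
       - K s m / of_real d * K m t + K s m / of_real d * (K m t / of_real d) * of_real d"
      by (simp add: clinearD[OF lin] herm flip: K_def d(2))
    also have "\<dots> = K s t - K s m * K m t / of_real d"
      by (cases "d = 0") (simp_all add: field_simps)
    also have "K s m * K m t / of_real d = cnj (w s) * w t"
    proof -
      have "complex_of_real (sqrt d) * of_real (sqrt d) = of_real d"
        using d(1) by (metis of_real_mult real_sqrt_mult_self abs_of_nonneg)
      then show ?thesis by (simp add: w_def herm)
    qed
    finally show ?thesis by simp
  qed
  have z: "\<omega> (star (a' s) * a' t) = 0" if "s = m \<or> t = m" for s t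
  proof (cases "d = 0")
    case True
    have "K s t = 0" using that K0[OF True] herm by (metis complex_cnj_zero)
    moreover have "w = (\<lambda>_. 0)" using True by (simp add: w_def fun_eq_iff)
    ultimately show ?thesis using K'[of s t] by simp
  next
    case False
    have "a' m = 0" using False by (simp add: a'_def d(2))
    then show ?thesis using that by (auto simp: clinearD[OF lin])
  qed
  have IH: "psd m (\<lambda>s t. \<omega> (star (a' s) * a' t) * L s t)"
    using Suc.IH psd_Suc[OF Suc.prems] by blast
  show ?case unfolding psd_def
  proof
    fix c :: "nat \<Rightarrow> complex"
    have "(\<Sum>s<Suc m. \<Sum>t<Suc m. cnj (c s) * c t * (\<omega> (star (a s) * a t) * L s t)) =
      (\<Sum>s<Suc m. \<Sum>t<Suc m. cnj (c s) * c t * (\<omega> (star (a' s) * a' t) * L s t)) +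
      (\<Sum>s<Suc m. \<Sum>t<Suc m. cnj (c s * w s) * (c t * w t) * L s t)"
      unfolding K'[unfolded K_def] sum.distrib[symmetric]
      by (intro sum.cong HOL.refl) (simp add: algebra_simps)
    also have "(\<Sum>s<Suc m. \<Sum>t<Suc m. cnj (c s) * c t * (\<omega> (star (a' s) * a' t) * L s t)) =
      (\<Sum>s<m. \<Sum>t<m. cnj (c s) * c t * (\<omega> (star (a' s) * a' t) * L s t))"
      by (simp add: z)
    finally have eq: "(\<Sum>s<Suc m. \<Sum>t<Suc m. cnj (c s) * c t * (\<omega> (star (a s) * a t) * L s t)) =
      (\<Sum>s<m. \<Sum>t<m. cnj (c s) * c t * (\<omega> (star (a' s) * a' t) * L s t)) +
      (\<Sum>s<Suc m. \<Sum>t<Suc m. cnj (c s * w s) * (c t * w t) * L s t)" .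
    have "(\<Sum>s<m. \<Sum>t<m. cnj (c s) * c t * (\<omega> (star (a' s) * a' t) * L s t)) \<in> \<real>\<^sub>\<ge>\<^sub>0"
      using IH unfolding psd_def by blast
    moreover have "(\<Sum>s<Suc m. \<Sum>t<Suc m. cnj (c s * w s) * (c t * w t) * L s t) \<in> \<real>\<^sub>\<ge>\<^sub>0"
      using Suc.prems unfolding psd_def by (rule allE[of _ "\<lambda>s. c s * w s"])
    ultimately show "(\<Sum>s<Suc m. \<Sum>t<Suc m. cnj (c s) * c t * (\<omega> (star (a s) * a t) * L s t)) \<in> \<real>\<^sub>\<ge>\<^sub>0"
      unfolding eq by (rule nonneg_Reals_add_I)
  qed
qed

lemma psd_product:
  fixes a :: "nat \<Rightarrow> nat \<Rightarrow> 'a::complex_star_algebra"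
  assumes "\<And>i. pos_fun (\<omega> i)"
  shows "psd m (\<lambda>s t. \<Prod>i<n. \<omega> i (star (a s i) * a t i))"
proof (induction n)
  case 0
  have "(\<Sum>s<m. \<Sum>t<m. cnj (c s) * c t) = complex_of_real ((cmod (\<Sum>t<m. c t))\<^sup>2)" for c :: "nat \<Rightarrow> complex"
    unfolding complex_norm_square cnj_sum sum_product by (subst sum.swap) (simp add: mult.commute)
  then show ?case by (auto simp: psd_def simp del: of_real_power)
next
  case (Suc n)
  from psd_schur[OF assms[of n] Suc, of "\<lambda>s. a s n"] show ?case by (simp add: mult.commute)
qed

lemma fermi_level_homog_list:
  "x \<in> fermi_level n \<Longrightarrow>
    \<exists>s. x = (\<Sum>(c, a)\<leftarrow>s. c *\<^sub>C tens n a) \<and> (\<forall>(c, a)\<in>set s. \<exists>P. homog n P a)"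
proof (induction rule: fermi_level_homog_induct)
  case zero
  show ?case by (rule exI[of _ "[]"]) simp
next
  case (add x y)
  then obtain s t where "x = (\<Sum>(c, a)\<leftarrow>s. c *\<^sub>C tens n a)" "\<forall>(c, a)\<in>set s. \<exists>P. homog n P a"
    "y = (\<Sum>(c, a)\<leftarrow>t. c *\<^sub>C tens n a)" "\<forall>(c, a)\<in>set t. \<exists>P. homog n P a" by blast
  then show ?case by (intro exI[of _ "s @ t"]) auto
next
  case (scale z x)
  then obtain s where s: "x = (\<Sum>(c, a)\<leftarrow>s. c *\<^sub>C tens n a)" "\<forall>(c, a)\<in>set s. \<exists>P. homog n P a" by blast
  have "z *\<^sub>C (\<Sum>(c, a)\<leftarrow>s. c *\<^sub>C tens n a) = (\<Sum>(c, a)\<leftarrow>map (\<lambda>(c, a). (z * c, a)) s. c *\<^sub>C tens n a)"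
    by (induction s) (auto simp: scaleC_add_right)
  then show ?case using s by (intro exI[of _ "map (\<lambda>(c, a). (z * c, a)) s"]) auto
next
  case (tens P a)
  then show ?case by (intro exI[of _ "[(1, a)]"]) auto
qed

lemma star_sum: "star (\<Sum>i\<in>I. f i :: 'a::complex_star_algebra) = (\<Sum>i\<in>I. star (f i))"
  by (induction I rule: infinite_finite_induct) (simp_all add: star_add)

lemma product_functional_pos:
  assumes \<omega>: "\<And>i. even_state (\<omega> i)"
  shows "product_functional \<omega> (star x * x) \<in> \<real>\<^sub>\<ge>\<^sub>0"
proof -
  have st: "\<And>i. is_state (\<omega> i)" using \<omega> by (simp add: even_state_is_state)
  have lin: "clinear (product_functional \<omega>)" using product_functional_clinear[OF st] .
  obtain n where "x \<in> fermi_level n" using fermi_level_ex by blast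
  then obtain l where x: "x = (\<Sum>(c, a)\<leftarrow>l. c *\<^sub>C tens n a)" and l: "\<forall>(c, a)\<in>set l. \<exists>P. homog n P a"
    using fermi_level_homog_list by blast
  define m where "m = length l"
  define c where "c t = fst (l ! t)" for t
  define a where "a t = snd (l ! t)" for t
  have x': "x = (\<Sum>t<m. c t *\<^sub>C tens n (a t))"
    unfolding x m_def c_def a_def by (simp add: sum_list_sum_nth split_def atLeast0LessThan)
  have h: "\<exists>P. homog n P (a t)" if "t < m" for t
  proof -
    have "l ! t \<in> set l" using that by (simp add: m_def)
    moreover have "\<forall>p\<in>set l. \<exists>P. homog n P (snd p)" using l by (simp add: split_def)
    ultimately show ?thesis unfolding a_def by blast
  qed
  have "product_functional \<omega> (star x * x) =
    (\<Sum>s<m. \<Sum>t<m. cnj (c s) * c t * product_functional \<omega> (star (tens n (a s)) * tens n (a t)))"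
    unfolding x' by (simp add: star_sum sum_product clinear_sum[OF lin] clinearD[OF lin] mult_ac)
  also have "\<dots> = (\<Sum>s<m. \<Sum>t<m. cnj (c s) * c t * (\<Prod>i<n. \<omega> i (star (a s i) * a t i)))"
  proof (intro sum.cong HOL.refl)
    fix s t assume "s \<in> {..<m}" "t \<in> {..<m}"
    then obtain P Q where PQ: "homog n P (a s)" "homog n Q (a t)" using h by blast
    show "cnj (c s) * c t * product_functional \<omega> (star (tens n (a s)) * tens n (a t)) =
        cnj (c s) * c t * (\<Prod>i<n. \<omega> i (star (a s i) * a t i))"
      by (simp only: product_functional_star_mult[OF \<omega> PQ])
  qed
  also have "\<dots> \<in> \<real>\<^sub>\<ge>\<^sub>0"
    using psd_product[where \<omega> = \<omega> and m = m and n = n and a = a] is_state_pos_fun[OF st] unfolding psd_def by blast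
  finally show ?thesis .
qed

lemma product_functional_state:
  assumes \<omega>: "\<And>i. even_state (\<omega> i)"
  shows "is_state (product_functional \<omega>)"
proof -
  have st: "\<And>i. is_state (\<omega> i)" using \<omega> by (simp add: even_state_is_state)
  have "product_functional \<omega> 1 = 1"
    using product_functional_tens[OF st, where n = 0 and f = "\<lambda>_. 1"] by (simp add: fermi_one_tens[of 0])
  then show ?thesis
    by (simp add: is_state_def product_functional_clinear[OF st] product_functional_pos[OF \<omega>])
qed

lemma product_functional_pos_fun: "(\<And>i. even_state (\<omega> i)) \<Longrightarrow> pos_fun (product_functional \<omega>)"
  by (simp add: is_state_pos_fun product_functional_state)

text \<open>The norm of \<open>\<pi>\<^sub>\<phi>(x)\<close> for the GNS representation of a state \<open>\<phi>\<close> of the subalgebra \<open>A\<close>: the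
  classes of the elements of \<open>A\<close>, with inner product \<open>\<langle>y, z\<rangle> = \<phi>(y\<^sup>* z)\<close>, are dense in the GNS
  space, and \<open>\<pi>\<^sub>\<phi>(x)\<close> acts on them by left multiplication.\<close>

definition gns_opnorm :: "'a::complex_star_algebra set \<Rightarrow> ('a \<Rightarrow> complex) \<Rightarrow> 'a \<Rightarrow> real" where
  "gns_opnorm A \<phi> x = (SUP y\<in>{y \<in> A. gns_seminorm \<phi> y \<le> 1}. gns_seminorm \<phi> (x * y))"

text \<open>The minimal norm on the \<open>n\<close>-fold product; only \<open>\<omega> 0, \<dots>, \<omega> (n - 1)\<close> matter. The inserted 0 is
  relevant only for the zero algebra, which has no states.\<close>

definition fermi_min_norm :: "nat \<Rightarrow> 'a::graded_cstar_algebra fermi_alg \<Rightarrow> real" where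
  "fermi_min_norm n x = Sup (insert 0
     {gns_opnorm (fermi_level n) (product_functional \<omega>) x | \<omega>. \<forall>i. even_state (\<omega> i)})"

text \<open>The norm of the inductive limit.\<close>

definition fermi_norm :: "'a::graded_cstar_algebra fermi_alg \<Rightarrow> real" where
  "fermi_norm x = lim (\<lambda>n. fermi_min_norm n x)"

subsection \<open>The minimal norm is a C*-seminorm\<close>

definition gns_bound :: "real \<Rightarrow> 'a::graded_cstar_algebra fermi_alg \<Rightarrow> bool" where
  "gns_bound C x \<longleftrightarrow> 0 \<le> C \<and> (\<forall>\<omega> y. (\<forall>i. even_state (\<omega> i)) \<longrightarrow>
     gns_seminorm (product_functional \<omega>) (x * y) \<le> C * gns_seminorm (product_functional \<omega>) y)"

lemma gns_bound_add: "gns_bound C x \<Longrightarrow> gns_bound D y \<Longrightarrow> gns_bound (C + D) (x + y)"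
  unfolding gns_bound_def distrib_right
  by (meson add_mono add_nonneg_nonneg gns_seminorm_triangle order_trans product_functional_pos_fun)

lemma gns_bound_scaleC: "gns_bound C x \<Longrightarrow> gns_bound (cmod c * C) (c *\<^sub>C x)"
  unfolding gns_bound_def
  by (simp add: gns_seminorm_scaleC[OF product_functional_pos_fun] mult.assoc mult_left_mono)

lemma gns_bound_mult:
  assumes "gns_bound C x" "gns_bound D y"
  shows "gns_bound (C * D) (x * y)"
  unfolding gns_bound_def
proof (intro conjI allI impI)
  show "0 \<le> C * D" using assms by (simp add: gns_bound_def)
  fix \<omega> :: "nat \<Rightarrow> 'a \<Rightarrow> complex" and z :: "'a fermi_alg" assume \<omega>: "\<forall>i. even_state (\<omega> i)"
  let ?q = "gns_seminorm (product_functional \<omega>)"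
  have "?q (x * (y * z)) \<le> C * ?q (y * z)" using assms(1) \<omega> by (simp add: gns_bound_def)
  also have "\<dots> \<le> C * (D * ?q z)"
    using assms \<omega> by (intro mult_left_mono) (auto simp: gns_bound_def)
  finally show "?q (x * y * z) \<le> C * D * ?q z" by (simp add: mult.assoc)
qed

definition site :: "nat \<Rightarrow> 'a::graded_cstar_algebra \<Rightarrow> 'a fermi_alg" where
  "site j a = elem_tensor (replicate j 1 @ [a])"

lemma site_tens: "site j a = tens (Suc j) (\<lambda>i. if i = j then a else 1)"
proof -
  have "replicate j 1 @ [a] = map (\<lambda>i. if i = j then a else 1) [0..<Suc j]"
    by (rule nth_equalityI) (auto simp: nth_append nth_Cons' simp del: upt_Suc)
  then show ?thesis by (simp only: site_def tens_def)
qed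

lemma site_clinear: "clinear (site j)"
proof -
  have "site j (x + y) = site j x + site j y" for x y :: 'a
    unfolding site_tens by (rule tens_add[of j]) auto
  moreover have "site j (c *\<^sub>C x) = c *\<^sub>C site j x" for c and x :: 'a
    unfolding site_tens by (rule tens_scale[of j]) auto
  ultimately show ?thesis by (simp add: clinear_def)
qed

lemma site_one [simp]: "site j 1 = 1"
  by (simp add: site_tens fermi_one_tens[of "Suc j"])

lemma homog_site:
  "homog (Suc j) (if p then {j} else {}) (\<lambda>i. if i = j then graded_part p a else 1)"
  by (simp add: homog_def grading_graded_part)

lemma koszul_sign_single: "koszul_sign (Suc j) (if p then {j} else {}) (if q then {j} else {}) = 1"
  by (auto simp: koszul_sign_def intro!: prod.neutral)

lemma site_star: "star (site j a) = site j (star a)"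
proof -
  have "star (site j (graded_part p a)) = site j (star (graded_part p a))" for p
    unfolding site_tens tens_star_homog[OF homog_site] koszul_sign_single scaleC_one
    by (rule tens_cong) simp
  from this[of False] this[of True]
  have "star (site j (graded_part False a + graded_part True a)) =
     site j (star (graded_part False a + graded_part True a))"
    by (simp add: clinearD[OF site_clinear] star_add)
  then show ?thesis by (simp add: graded_part_sum)
qed

lemma site_mult: "site j (a * b) = site j a * site j b"
proof -
  have "site j (graded_part p a * graded_part q b) = site j (graded_part p a) * site j (graded_part q b)" for p q
    unfolding site_tens tens_mult_homog[OF homog_site homog_site] koszul_sign_single scaleC_one
    by (rule tens_cong) simp
  then have "site j ((graded_part False a + graded_part True a) * (graded_part False b + graded_part True b)) =
     site j (graded_part False a + graded_part True a) * site j (graded_part False b + graded_part True b)"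
    by (simp add: clinearD[OF site_clinear] distrib_left distrib_right)
  then show ?thesis by (simp add: graded_part_sum)
qed

lemma gns_bound_site: "gns_bound (norm a) (site j a)"
  unfolding gns_bound_def
proof (intro conjI allI impI)
  fix \<omega> :: "nat \<Rightarrow> 'a \<Rightarrow> complex" and y :: "'a fermi_alg" assume \<omega>: "\<forall>i. even_state (\<omega> i)"
  let ?\<phi> = "product_functional \<omega>"
  have pos: "pos_fun ?\<phi>" using \<omega> by (simp add: product_functional_pos_fun)
  then have lin: "clinear ?\<phi>" by (simp add: pos_fun_def)
  define \<psi> where "\<psi> b = ?\<phi> (star y * (site j b * y))" for b
  have sq: "\<psi> (star b * b) = ?\<phi> (star (site j b * y) * (site j b * y))" for b
    by (simp add: \<psi>_def site_mult star_mult mult.assoc flip: site_star)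
  have "clinear \<psi>"
    by (simp add: clinear_def \<psi>_def clinearD[OF site_clinear] clinearD[OF lin] distrib_left distrib_right)
  then have "pos_fun \<psi>" using pos by (simp add: pos_fun_def sq)
  from pos_fun_bound[OF this, of a]
  have "(gns_seminorm ?\<phi> (site j a * y))\<^sup>2 \<le> (norm a * gns_seminorm ?\<phi> y)\<^sup>2"
    by (simp add: sq power_mult_distrib gns_seminorm_sq[OF pos]) (simp add: \<psi>_def)
  then show "gns_seminorm ?\<phi> (site j a * y) \<le> norm a * gns_seminorm ?\<phi> y"
    by (rule power2_le_imp_le) (simp add: gns_seminorm_nonneg[OF pos])
qed simp

lemma homog_restrict:
  assumes "homog (Suc n) P a"
  shows "homog (Suc n) (P - {n}) (\<lambda>i. if i < n then a i else 1)"
    and "homog (Suc n) (P \<inter> {n}) (\<lambda>i. if i = n then a n else 1)"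
  using assms by (auto simp: homog_def)

lemma tens_Suc_homog:
  assumes "homog (Suc n) P a"
  shows "tens (Suc n) a = tens n a * site n (a n)"
proof -
  have k: "koszul_sign (Suc n) (P - {n}) (P \<inter> {n}) = 1"
    by (auto simp: koszul_sign_def intro!: prod.neutral)
  have "tens n a * site n (a n) =
    tens (Suc n) (\<lambda>i. if i < n then a i else 1) * tens (Suc n) (\<lambda>i. if i = n then a n else 1)"
    unfolding site_tens using tens_extend[of n "Suc n" a] by simp
  also have "\<dots> = tens (Suc n) (\<lambda>i. (if i < n then a i else 1) * (if i = n then a n else 1))"
    unfolding tens_mult_homog[OF homog_restrict[OF assms]] k by simp
  also have "\<dots> = tens (Suc n) a" by (rule tens_cong) auto
  finally show ?thesis by simp
qed

lemma gns_bound_one: "gns_bound 1 1"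
  by (simp add: gns_bound_def)

lemma gns_bound_tens: "homog n P a \<Longrightarrow> \<exists>C. gns_bound C (tens n a)"
proof (induction n arbitrary: P)
  case 0
  then show ?case using gns_bound_one by (auto simp: tens_def one_fermi_alg_def)
next
  case (Suc n)
  have "homog n (P - {n}) a" using Suc.prems by (auto simp: homog_def)
  then obtain C where "gns_bound C (tens n a)" using Suc.IH by blast
  then show ?case unfolding tens_Suc_homog[OF Suc.prems]
    using gns_bound_mult gns_bound_site by blast
qed

lemma gns_bound_ex: "\<exists>C. gns_bound C x"
proof -
  obtain n where "x \<in> fermi_level n" using fermi_level_ex by blast
  then show ?thesis
  proof (induction x rule: fermi_level_homog_induct)
    case zero
    show ?case
      using gns_bound_scaleC[OF gns_bound_one, of 0] by auto
  qed (blast intro: gns_bound_add gns_bound_scaleC gns_bound_tens)+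
qed

lemma gns_opnorm:
  assumes \<omega>: "\<forall>i. even_state (\<omega> i)"
  defines "\<phi> \<equiv> product_functional \<omega>"
  shows gns_opnorm_nonneg: "0 \<le> gns_opnorm (fermi_level n) \<phi> x"
    and gns_opnorm_bound: "y \<in> fermi_level n \<Longrightarrow>
      gns_seminorm \<phi> (x * y) \<le> gns_opnorm (fermi_level n) \<phi> x * gns_seminorm \<phi> y"
    and gns_opnorm_least: "0 \<le> C \<Longrightarrow> (\<And>y. y \<in> fermi_level n \<Longrightarrow> gns_seminorm \<phi> (x * y) \<le> C * gns_seminorm \<phi> y) \<Longrightarrow>
      gns_opnorm (fermi_level n) \<phi> x \<le> C"
proof -
  have pos: "pos_fun \<phi>" using \<omega> unfolding \<phi>_def by (simp add: product_functional_pos_fun)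
  let ?Y = "{y \<in> fermi_level n. gns_seminorm \<phi> y \<le> 1}"
  have "\<phi> 0 = 0" using pos clinearD(3) by (auto simp: pos_fun_def)
  then have g0: "gns_seminorm \<phi> 0 = 0" by (simp add: gns_seminorm_def)
  then have z: "0 \<in> ?Y" by (simp add: fermi_level_zero)
  obtain B where B: "0 \<le> B" "gns_seminorm \<phi> (x * y) \<le> B * gns_seminorm \<phi> y" for y
    using gns_bound_ex[of x] \<omega> unfolding gns_bound_def \<phi>_def by blast
  have bdd: "bdd_above ((\<lambda>y. gns_seminorm \<phi> (x * y)) ` ?Y)"
  proof (rule bdd_aboveI2)
    fix y assume "y \<in> ?Y"
    then show "gns_seminorm \<phi> (x * y) \<le> B"
      using B(2)[of y] mult_left_mono[of "gns_seminorm \<phi> y" 1 B] B(1) by simp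
  qed
  show nn: "0 \<le> gns_opnorm (fermi_level n) \<phi> x"
    unfolding gns_opnorm_def using cSUP_upper[OF z bdd] g0 by simp
  show "gns_seminorm \<phi> (x * y) \<le> gns_opnorm (fermi_level n) \<phi> x * gns_seminorm \<phi> y"
    if y: "y \<in> fermi_level n" for y
  proof (cases "gns_seminorm \<phi> y = 0")
    case True
    then show ?thesis using B(2)[of y] by simp
  next
    case False
    then have p: "0 < gns_seminorm \<phi> y" using gns_seminorm_nonneg[OF pos, of y] by simp
    let ?c = "complex_of_real (1 / gns_seminorm \<phi> y)"
    have "?c *\<^sub>C y \<in> ?Y"
      using y p by (simp add: fermi_level_scaleC gns_seminorm_scaleC[OF pos] norm_divide)
    from cSUP_upper[OF this bdd]
    have "gns_seminorm \<phi> (?c *\<^sub>C (x * y)) \<le> gns_opnorm (fermi_level n) \<phi> x"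
      by (simp add: gns_opnorm_def)
    then show ?thesis using p
      by (simp add: gns_seminorm_scaleC[OF pos] norm_divide divide_le_eq)
  qed
  show "gns_opnorm (fermi_level n) \<phi> x \<le> C"
    if C: "0 \<le> C" "\<And>y. y \<in> fermi_level n \<Longrightarrow> gns_seminorm \<phi> (x * y) \<le> C * gns_seminorm \<phi> y"
    unfolding gns_opnorm_def
  proof (rule cSUP_least)
    show "?Y \<noteq> {}" using z by blast
    fix y assume "y \<in> ?Y"
    then show "gns_seminorm \<phi> (x * y) \<le> C"
      using C(2)[of y] mult_left_mono[of "gns_seminorm \<phi> y" 1 C] C(1) by simp
  qed
qed

lemma fermi_min_norm:
  shows fermi_min_norm_nonneg: "0 \<le> fermi_min_norm n x"
    and fermi_min_norm_bound: "\<forall>i. even_state (\<omega> i) \<Longrightarrow> y \<in> fermi_level n \<Longrightarrow>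
      gns_seminorm (product_functional \<omega>) (x * y) \<le> fermi_min_norm n x * gns_seminorm (product_functional \<omega>) y"
    and fermi_min_norm_least: "0 \<le> C \<Longrightarrow>
      (\<And>\<omega> y. \<forall>i. even_state (\<omega> i) \<Longrightarrow> y \<in> fermi_level n \<Longrightarrow>
        gns_seminorm (product_functional \<omega>) (x * y) \<le> C * gns_seminorm (product_functional \<omega>) y) \<Longrightarrow>
      fermi_min_norm n x \<le> C"
proof -
  let ?S = "insert 0 {gns_opnorm (fermi_level n) (product_functional \<omega>) x | \<omega>. \<forall>i. even_state (\<omega> i)}"
  have least: "s \<le> C" if "s \<in> ?S" "0 \<le> C" "\<And>\<omega> y. \<forall>i. even_state (\<omega> i) \<Longrightarrow> y \<in> fermi_level n \<Longrightarrow>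
        gns_seminorm (product_functional \<omega>) (x * y) \<le> C * gns_seminorm (product_functional \<omega>) y" for s C
    using that by (auto intro!: gns_opnorm_least)
  obtain B where B: "gns_bound B x" using gns_bound_ex by blast
  have bdd: "bdd_above ?S"
    by (rule bdd_aboveI[of _ B], rule least) (use B in \<open>auto simp: gns_bound_def\<close>)
  show "0 \<le> fermi_min_norm n x"
    unfolding fermi_min_norm_def by (rule cSup_upper[OF _ bdd]) simp
  show "gns_seminorm (product_functional \<omega>) (x * y) \<le> fermi_min_norm n x * gns_seminorm (product_functional \<omega>) y"
    if \<omega>: "\<forall>i. even_state (\<omega> i)" and y: "y \<in> fermi_level n" for \<omega> y
  proof -
    have "gns_opnorm (fermi_level n) (product_functional \<omega>) x \<le> fermi_min_norm n x"
      unfolding fermi_min_norm_def by (rule cSup_upper[OF _ bdd]) (use \<omega> in blast)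
    then show ?thesis using gns_opnorm_bound[OF \<omega> y, of x]
      by (meson \<omega> gns_seminorm_nonneg mult_right_mono order_trans product_functional_pos_fun)
  qed
  show "fermi_min_norm n x \<le> C"
    if "0 \<le> C" "\<And>\<omega> y. \<forall>i. even_state (\<omega> i) \<Longrightarrow> y \<in> fermi_level n \<Longrightarrow>
        gns_seminorm (product_functional \<omega>) (x * y) \<le> C * gns_seminorm (product_functional \<omega>) y"
    unfolding fermi_min_norm_def by (rule cSup_least) (use least that in auto)
qed

lemma fermi_min_norm_mono: "incseq (\<lambda>n. fermi_min_norm n x)"
  by (rule incseq_SucI, rule fermi_min_norm_least)
    (simp_all add: fermi_min_norm_nonneg fermi_min_norm_bound fermi_level_Suc)

lemma fermi_min_norm_le_gns_bound: "gns_bound C x \<Longrightarrow> fermi_min_norm n x \<le> C"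
  by (rule fermi_min_norm_least) (auto simp: gns_bound_def)

lemma fermi_norm_LIMSEQ: "(\<lambda>n. fermi_min_norm n x) \<longlonglongrightarrow> fermi_norm x"
proof -
  obtain C where "gns_bound C x" using gns_bound_ex by blast
  then have "\<forall>n. fermi_min_norm n x \<le> C" using fermi_min_norm_le_gns_bound by blast
  then obtain L where "(\<lambda>n. fermi_min_norm n x) \<longlonglongrightarrow> L"
    using incseq_convergent[OF fermi_min_norm_mono] by metis
  then show ?thesis by (simp add: fermi_norm_def limI)
qed

lemma fermi_norm_least: "gns_bound C x \<Longrightarrow> fermi_norm x \<le> C"
  by (rule LIMSEQ_le_const2[OF fermi_norm_LIMSEQ]) (simp add: fermi_min_norm_le_gns_bound)

lemma fermi_norm_bound: "gns_bound (fermi_norm x) x"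
  unfolding gns_bound_def
proof (intro conjI allI impI)
  have le: "fermi_min_norm n x \<le> fermi_norm x" for n
    by (rule incseq_le[OF fermi_min_norm_mono fermi_norm_LIMSEQ])
  then show "0 \<le> fermi_norm x" using fermi_min_norm_nonneg order_trans by blast
  fix \<omega> :: "nat \<Rightarrow> 'a \<Rightarrow> complex" and y :: "'a fermi_alg" assume \<omega>: "\<forall>i. even_state (\<omega> i)"
  obtain n where n: "y \<in> fermi_level n" using fermi_level_ex by blast
  show "gns_seminorm (product_functional \<omega>) (x * y) \<le> fermi_norm x * gns_seminorm (product_functional \<omega>) y"
    using fermi_min_norm_bound[OF \<omega> n, of x] le[of n]
    by (meson \<omega> gns_seminorm_nonneg mult_right_mono order_trans product_functional_pos_fun)
qed

lemma fermi_norm_nonneg: "0 \<le> fermi_norm x"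
  using fermi_norm_bound by (auto simp: gns_bound_def)

lemma fermi_norm_add: "fermi_norm (x + y) \<le> fermi_norm x + fermi_norm y"
  by (rule fermi_norm_least[OF gns_bound_add[OF fermi_norm_bound fermi_norm_bound]])

lemma fermi_norm_mult: "fermi_norm (x * y) \<le> fermi_norm x * fermi_norm y"
  by (rule fermi_norm_least[OF gns_bound_mult[OF fermi_norm_bound fermi_norm_bound]])

lemma fermi_norm_scaleC: "fermi_norm (c *\<^sub>C x) = cmod c * fermi_norm x"
proof -
  have le: "fermi_norm (d *\<^sub>C z) \<le> cmod d * fermi_norm z" for d and z :: "'a fermi_alg"
    by (rule fermi_norm_least[OF gns_bound_scaleC[OF fermi_norm_bound]])
  show ?thesis
  proof (cases "c = 0")
    case True
    then show ?thesis using le[of 0 x] fermi_norm_nonneg[of "0 *\<^sub>C x"] by simp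
  next
    case False
    then have "cmod c * fermi_norm x \<le> cmod c * (cmod (1 / c) * fermi_norm (c *\<^sub>C x))"
      using le[of "1 / c" "c *\<^sub>C x"] by (intro mult_left_mono) auto
    also have "\<dots> = fermi_norm (c *\<^sub>C x)" using False by (simp add: norm_divide)
    finally show ?thesis using le[of c x] by simp
  qed
qed

lemma gns_bound_cstar: "gns_bound (sqrt (fermi_norm (star x * x))) x"
  unfolding gns_bound_def
proof (intro conjI allI impI)
  show "0 \<le> sqrt (fermi_norm (star x * x))" by (simp add: fermi_norm_nonneg)
  fix \<omega> :: "nat \<Rightarrow> 'a \<Rightarrow> complex" and y :: "'a fermi_alg" assume \<omega>: "\<forall>i. even_state (\<omega> i)"
  let ?\<phi> = "product_functional \<omega>" and ?N = "fermi_norm (star x * x)"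
  have pos: "pos_fun ?\<phi>" using \<omega> by (simp add: product_functional_pos_fun)
  have "(gns_seminorm ?\<phi> (x * y))\<^sup>2 = Re (?\<phi> (star y * ((star x * x) * y)))"
    by (simp add: gns_seminorm_sq[OF pos] star_mult mult.assoc)
  also have "\<dots> \<le> gns_seminorm ?\<phi> y * gns_seminorm ?\<phi> ((star x * x) * y)"
    using pos_fun_CS[OF pos] complex_Re_le_cmod order_trans by blast
  also have "\<dots> \<le> gns_seminorm ?\<phi> y * (?N * gns_seminorm ?\<phi> y)"
    using fermi_norm_bound[of "star x * x"] \<omega>
    by (intro mult_left_mono gns_seminorm_nonneg[OF pos]) (auto simp: gns_bound_def)
  also have "\<dots> = (sqrt ?N * gns_seminorm ?\<phi> y)\<^sup>2"
    by (simp add: power_mult_distrib fermi_norm_nonneg power2_eq_square[of "gns_seminorm _ _"])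
  finally show "gns_seminorm ?\<phi> (x * y) \<le> sqrt ?N * gns_seminorm ?\<phi> y"
    by (rule power2_le_imp_le) (simp add: gns_seminorm_nonneg[OF pos] fermi_norm_nonneg)
qed

lemma fermi_norm_cstar: "fermi_norm (star x * x) = (fermi_norm x)\<^sup>2"
proof -
  have sq: "(fermi_norm z)\<^sup>2 \<le> fermi_norm (star z * z)" for z :: "'a fermi_alg"
    using power_mono[OF fermi_norm_least[OF gns_bound_cstar[of z]] fermi_norm_nonneg, of 2]
    by (simp add: fermi_norm_nonneg)
  have le: "fermi_norm z \<le> fermi_norm (star z)" for z :: "'a fermi_alg"
  proof (cases "fermi_norm z = 0")
    case False
    have "fermi_norm z * fermi_norm z \<le> fermi_norm (star z) * fermi_norm z"
      using sq[of z] fermi_norm_mult[of "star z" z] by (simp add: power2_eq_square)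
    then show ?thesis using False fermi_norm_nonneg[of z] by (simp add: mult_le_cancel_right)
  qed (simp add: fermi_norm_nonneg)
  have "fermi_norm (star x) = fermi_norm x" using le[of x] le[of "star x"] by simp
  then show ?thesis using sq[of x] fermi_norm_mult[of "star x" x] by (simp add: power2_eq_square)
qed

section \<open>Completion\<close>

text \<open>The Hausdorff completion with respect to a C*-seminorm, by Cauchy sequences modulo null
  sequences. Applied to the algebraic inductive limit it gives the C*-inductive limit of the
  (completed) \<open>n\<close>-fold minimal products.\<close>

class pre_cstar_algebra = complex_star_algebra +
  fixes cstar_seminorm :: "'a \<Rightarrow> real"
  assumes cstar_seminorm_triangle: "cstar_seminorm (x + y) \<le> cstar_seminorm x + cstar_seminorm y"
    and cstar_seminorm_scaleC: "cstar_seminorm (c *\<^sub>C x) = cmod c * cstar_seminorm x"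
    and cstar_seminorm_mult: "cstar_seminorm (x * y) \<le> cstar_seminorm x * cstar_seminorm y"
    and cstar_seminorm_star_mult: "cstar_seminorm (star x * x) = (cstar_seminorm x)\<^sup>2"

instantiation fermi_alg :: (graded_cstar_algebra) pre_cstar_algebra
begin

definition cstar_seminorm_fermi_alg :: "'a fermi_alg \<Rightarrow> real" where
  "cstar_seminorm_fermi_alg = fermi_norm"

instance
  by standard (simp_all add: cstar_seminorm_fermi_alg_def fermi_norm_add fermi_norm_scaleC
      fermi_norm_mult fermi_norm_cstar)

end

lemma cstar_seminorm_zero [simp]: "cstar_seminorm (0::'a::pre_cstar_algebra) = 0"
  using cstar_seminorm_scaleC[of 0 "0::'a"] by simp

lemma cstar_seminorm_minus: "cstar_seminorm (- x) = cstar_seminorm (x::'a::pre_cstar_algebra)"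
  using cstar_seminorm_scaleC[of "- 1" x] by simp

lemma cstar_seminorm_nonneg [simp]: "0 \<le> cstar_seminorm (x::'a::pre_cstar_algebra)"
  using cstar_seminorm_triangle[of x "- x"] by (simp add: cstar_seminorm_minus)

lemma cstar_seminorm_diff_commute: "cstar_seminorm (x - y) = cstar_seminorm (y - x :: 'a::pre_cstar_algebra)"
  using cstar_seminorm_minus[of "x - y"] by simp

lemma cstar_seminorm_diff_triangle:
  "cstar_seminorm (x - z) \<le> cstar_seminorm (x - y) + cstar_seminorm (y - z :: 'a::pre_cstar_algebra)"
  using cstar_seminorm_triangle[of "x - y" "y - z"] by simp

lemma cstar_seminorm_abs_diff:
  "\<bar>cstar_seminorm x - cstar_seminorm y\<bar> \<le> cstar_seminorm (x - y :: 'a::pre_cstar_algebra)"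
  using cstar_seminorm_triangle[of "x - y" y] cstar_seminorm_triangle[of "y - x" x]
  by (simp add: abs_le_iff cstar_seminorm_diff_commute[of y x])

lemma cstar_seminorm_star [simp]: "cstar_seminorm (star x) = cstar_seminorm (x::'a::pre_cstar_algebra)"
proof -
  have le: "cstar_seminorm z \<le> cstar_seminorm (star z)" for z :: 'a
  proof (cases "cstar_seminorm z = 0")
    case False
    then have p: "0 < cstar_seminorm z" using cstar_seminorm_nonneg[of z] by linarith
    have "cstar_seminorm z * cstar_seminorm z \<le> cstar_seminorm (star z) * cstar_seminorm z"
      using cstar_seminorm_mult[of "star z" z] by (simp add: cstar_seminorm_star_mult power2_eq_square)
    then show ?thesis using p by (simp add: mult_le_cancel_right)
  qed simp
  show ?thesis using le[of x] le[of "star x"] by simp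
qed

definition seminorm_cauchy :: "(nat \<Rightarrow> 'a::pre_cstar_algebra) \<Rightarrow> bool" where
  "seminorm_cauchy X \<longleftrightarrow> (\<forall>e>0. \<exists>N. \<forall>m\<ge>N. \<forall>n\<ge>N. cstar_seminorm (X m - X n) < e)"

definition cauchy_rel :: "(nat \<Rightarrow> 'a::pre_cstar_algebra) \<Rightarrow> (nat \<Rightarrow> 'a) \<Rightarrow> bool" where
  "cauchy_rel X Y \<longleftrightarrow> seminorm_cauchy X \<and> seminorm_cauchy Y \<and> (\<lambda>n. cstar_seminorm (X n - Y n)) \<longlonglongrightarrow> 0"

lemma cauchy_rel_alt:
  "cauchy_rel X Y \<longleftrightarrow> cauchy_rel X X \<and> cauchy_rel Y Y \<and> (\<lambda>n. cstar_seminorm (X n - Y n)) \<longlonglongrightarrow> 0"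
  by (auto simp: cauchy_rel_def)

lemma cauchy_rel_sym: "cauchy_rel X Y \<Longrightarrow> cauchy_rel Y X"
  unfolding cauchy_rel_def by (simp add: cstar_seminorm_diff_commute[of "X _" "Y _"])

lemma null_squeeze:
  fixes f g :: "nat \<Rightarrow> real"
  assumes "\<And>n. 0 \<le> f n" "\<And>n. f n \<le> g n" "g \<longlonglongrightarrow> 0"
  shows "f \<longlonglongrightarrow> 0"
  by (rule tendsto_sandwich[OF _ _ tendsto_const assms(3)]) (auto simp: assms)

lemma cauchy_rel_trans:
  assumes "cauchy_rel X Y" "cauchy_rel Y Z"
  shows "cauchy_rel X Z"
proof -
  have "(\<lambda>n. cstar_seminorm (X n - Y n) + cstar_seminorm (Y n - Z n)) \<longlonglongrightarrow> 0 + 0"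
    using assms unfolding cauchy_rel_def by (intro tendsto_add) auto
  then have g: "(\<lambda>n. cstar_seminorm (X n - Y n) + cstar_seminorm (Y n - Z n)) \<longlonglongrightarrow> 0" by simp
  have "(\<lambda>n. cstar_seminorm (X n - Z n)) \<longlonglongrightarrow> 0"
    by (rule null_squeeze[OF _ _ g]) (auto intro: cstar_seminorm_diff_triangle)
  then show ?thesis using assms by (simp add: cauchy_rel_def)
qed

lemma cauchy_rel_const: "cauchy_rel (\<lambda>_. a) (\<lambda>_. a)"
  by (simp add: cauchy_rel_def seminorm_cauchy_def)

quotient_type (overloaded) 'a cstar_completion = "nat \<Rightarrow> 'a::pre_cstar_algebra" / partial: cauchy_rel
proof (rule part_equivpI)
  show "\<exists>X. cauchy_rel X (X::nat \<Rightarrow> 'a)" using cauchy_rel_const by blast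
qed (auto intro!: sympI transpI intro: cauchy_rel_sym cauchy_rel_trans)

lemma cauchy_rel_add:
  assumes "cauchy_rel X X'" "cauchy_rel Y Y'"
  shows "cauchy_rel (\<lambda>n. X n + Y n) (\<lambda>n. X' n + Y' n)"
proof -
  have le: "cstar_seminorm (a + b - (c + d)) \<le> cstar_seminorm (a - c) + cstar_seminorm (b - d)"
    for a b c d :: 'a
    using cstar_seminorm_triangle[of "a - c" "b - d"] by (simp add: algebra_simps)
  have c: "seminorm_cauchy (\<lambda>n. U n + V n)"
    if U: "seminorm_cauchy U" and V: "seminorm_cauchy V" for U V :: "nat \<Rightarrow> 'a"
    unfolding seminorm_cauchy_def
  proof (intro allI impI)
    fix e :: real assume "0 < e"
    obtain M where M: "\<forall>m\<ge>M. \<forall>n\<ge>M. cstar_seminorm (U m - U n) < e / 2"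
      using U \<open>0 < e\<close> half_gt_zero unfolding seminorm_cauchy_def by meson
    obtain N where N: "\<forall>m\<ge>N. \<forall>n\<ge>N. cstar_seminorm (V m - V n) < e / 2"
      using V \<open>0 < e\<close> half_gt_zero unfolding seminorm_cauchy_def by meson
    show "\<exists>N. \<forall>m\<ge>N. \<forall>n\<ge>N. cstar_seminorm (U m + V m - (U n + V n)) < e"
    proof (intro exI[of _ "max M N"] allI impI)
      fix m n assume "max M N \<le> m" "max M N \<le> n"
      then have "cstar_seminorm (U m - U n) < e / 2" "cstar_seminorm (V m - V n) < e / 2"
        using M N by auto
      then show "cstar_seminorm (U m + V m - (U n + V n)) < e"
        using le[of "U m" "V m" "U n" "V n"] by linarith
    qed
  qed
  have "(\<lambda>n. cstar_seminorm (X n - X' n) + cstar_seminorm (Y n - Y' n)) \<longlonglongrightarrow> 0 + 0"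
    using assms unfolding cauchy_rel_def by (intro tendsto_add) auto
  then have g: "(\<lambda>n. cstar_seminorm (X n - X' n) + cstar_seminorm (Y n - Y' n)) \<longlonglongrightarrow> 0" by simp
  have "(\<lambda>n. cstar_seminorm (X n + Y n - (X' n + Y' n))) \<longlonglongrightarrow> 0"
    by (rule null_squeeze[OF _ _ g]) (auto intro: le)
  then show ?thesis using assms c unfolding cauchy_rel_def by simp
qed

lemma cauchy_rel_scaleC:
  assumes "cauchy_rel X X'"
  shows "cauchy_rel (\<lambda>n. c *\<^sub>C X n) (\<lambda>n. c *\<^sub>C X' n)"
proof -
  have eq: "cstar_seminorm (c *\<^sub>C x - c *\<^sub>C y) = cmod c * cstar_seminorm (x - y)" for x y :: 'a
    by (simp add: cstar_seminorm_scaleC flip: scaleC_diff_right)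
  have c: "seminorm_cauchy (\<lambda>n. c *\<^sub>C U n)" if U: "seminorm_cauchy U" for U :: "nat \<Rightarrow> 'a"
    unfolding seminorm_cauchy_def eq
  proof (intro allI impI)
    fix e :: real assume e: "0 < e"
    have "0 < e / (cmod c + 1)" using e by (simp add: add_nonneg_pos)
    then obtain M where M: "\<forall>m\<ge>M. \<forall>n\<ge>M. cstar_seminorm (U m - U n) < e / (cmod c + 1)"
      using U unfolding seminorm_cauchy_def by meson
    have "cmod c * s < e" if "0 \<le> s" "s < e / (cmod c + 1)" for s
    proof -
      have "cmod c * s \<le> (cmod c + 1) * s" using that by (intro mult_right_mono) auto
      also have "\<dots> < e" using that(2) by (simp add: pos_less_divide_eq add_nonneg_pos mult.commute)
      finally show ?thesis .
    qed
    then show "\<exists>N. \<forall>m\<ge>N. \<forall>n\<ge>N. cmod c * cstar_seminorm (U m - U n) < e"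
      using M by (intro exI[of _ M]) simp
  qed
  have "(\<lambda>n. cmod c * cstar_seminorm (X n - X' n)) \<longlonglongrightarrow> cmod c * 0"
    using assms unfolding cauchy_rel_def by (intro tendsto_mult tendsto_const) auto
  then show ?thesis using assms c by (simp add: cauchy_rel_def eq)
qed

lemma cauchy_rel_star:
  "cauchy_rel X X' \<Longrightarrow> cauchy_rel (\<lambda>n. star (X n)) (\<lambda>n. star (X' n))"
  by (simp add: cauchy_rel_def seminorm_cauchy_def flip: star_diff)

lemma cauchy_rel_bounded:
  assumes "cauchy_rel X X'"
  obtains B where "0 \<le> B" "\<And>n. cstar_seminorm (X n) \<le> B"
proof -
  obtain N where N: "\<forall>m\<ge>N. \<forall>n\<ge>N. cstar_seminorm (X m - X n) < 1"
    using assms unfolding cauchy_rel_def seminorm_cauchy_def by (meson zero_less_one)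
  define B where "B = (\<Sum>n\<le>N. cstar_seminorm (X n)) + 1"
  have "cstar_seminorm (X n) \<le> B" for n
  proof (cases "n \<le> N")
    case True
    have "cstar_seminorm (X n) \<le> (\<Sum>n\<le>N. cstar_seminorm (X n))"
      by (rule member_le_sum) (use True in auto)
    then show ?thesis by (simp add: B_def)
  next
    case False
    have "cstar_seminorm (X N) \<le> (\<Sum>n\<le>N. cstar_seminorm (X n))"
      by (rule member_le_sum) auto
    moreover have "cstar_seminorm (X n - X N) < 1" using N False by simp
    ultimately show ?thesis
      using cstar_seminorm_triangle[of "X n - X N" "X N"] by (simp add: B_def)
  qed
  moreover have "0 \<le> B" by (simp add: B_def sum_nonneg add_nonneg_nonneg)
  ultimately show ?thesis using that by blast
qed

lemma cauchy_rel_mult: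
  assumes X: "cauchy_rel X X'" and Y: "cauchy_rel Y Y'"
  shows "cauchy_rel (\<lambda>n. X n * Y n) (\<lambda>n. X' n * Y' n)"
proof -
  have le: "cstar_seminorm (a * b - c * d) \<le> B * (cstar_seminorm (a - c) + cstar_seminorm (b - d))"
    if "cstar_seminorm b \<le> B" "cstar_seminorm c \<le> B" for a b c d :: 'a and B
  proof -
    have "a * b - c * d = (a - c) * b + c * (b - d)" by (simp add: algebra_simps)
    then have "cstar_seminorm (a * b - c * d) \<le> cstar_seminorm ((a - c) * b) + cstar_seminorm (c * (b - d))"
      using cstar_seminorm_triangle by metis
    also have "\<dots> \<le> cstar_seminorm (a - c) * cstar_seminorm b + cstar_seminorm c * cstar_seminorm (b - d)"
      by (intro add_mono cstar_seminorm_mult)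
    also have "\<dots> \<le> cstar_seminorm (a - c) * B + B * cstar_seminorm (b - d)"
      by (intro add_mono mult_left_mono mult_right_mono that cstar_seminorm_nonneg)
    finally show ?thesis by (simp add: algebra_simps)
  qed
  have c: "seminorm_cauchy (\<lambda>n. U n * V n)"
    if U: "cauchy_rel U U" and V: "cauchy_rel V V" for U V :: "nat \<Rightarrow> 'a"
    unfolding seminorm_cauchy_def
  proof (intro allI impI)
    fix e :: real assume "0 < e"
    obtain B where B: "0 \<le> B" "\<And>n. cstar_seminorm (U n) \<le> B" using cauchy_rel_bounded[OF U] by blast
    obtain C where C: "0 \<le> C" "\<And>n. cstar_seminorm (V n) \<le> C" using cauchy_rel_bounded[OF V] by blast
    define D where "D = B + C + 1"
    have D: "0 < D" "\<And>n. cstar_seminorm (U n) \<le> D" "\<And>n. cstar_seminorm (V n) \<le> D"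
      using B(1) C(1) order_trans[OF B(2), of D] order_trans[OF C(2), of D] by (auto simp: D_def)
    have e: "0 < e / (2 * D)" using \<open>0 < e\<close> D(1) by simp
    obtain M where M: "\<forall>m\<ge>M. \<forall>n\<ge>M. cstar_seminorm (U m - U n) < e / (2 * D)"
      using U e unfolding cauchy_rel_def seminorm_cauchy_def by meson
    obtain N where N: "\<forall>m\<ge>N. \<forall>n\<ge>N. cstar_seminorm (V m - V n) < e / (2 * D)"
      using V e unfolding cauchy_rel_def seminorm_cauchy_def by meson
    show "\<exists>N. \<forall>m\<ge>N. \<forall>n\<ge>N. cstar_seminorm (U m * V m - U n * V n) < e"
    proof (intro exI[of _ "max M N"] allI impI)
      fix m n assume "max M N \<le> m" "max M N \<le> n"
      then have "cstar_seminorm (U m - U n) + cstar_seminorm (V m - V n) < e / (2 * D) + e / (2 * D)"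
        using M N by (intro add_strict_mono) auto
      also have "\<dots> = e / D" by (simp add: field_simps)
      finally have "D * (cstar_seminorm (U m - U n) + cstar_seminorm (V m - V n)) < D * (e / D)"
        using D(1) by (intro mult_strict_left_mono)
      also have "D * (e / D) = e" using D(1) by simp
      finally show "cstar_seminorm (U m * V m - U n * V n) < e"
        using le[OF D(3) D(2), of "U m" m n "V n"] by linarith
    qed
  qed
  obtain B where B: "0 \<le> B" "\<And>n. cstar_seminorm (X' n) \<le> B"
    using cauchy_rel_bounded[OF cauchy_rel_sym[OF X]] by blast
  obtain C where C: "0 \<le> C" "\<And>n. cstar_seminorm (Y n) \<le> C" using cauchy_rel_bounded[OF Y] by blast
  have BC: "cstar_seminorm (X' n) \<le> B + C" "cstar_seminorm (Y n) \<le> B + C" for n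
    using B C order_trans[OF B(2), of "B + C"] order_trans[OF C(2), of "B + C"] by auto
  have "(\<lambda>n. (B + C) * (cstar_seminorm (X n - X' n) + cstar_seminorm (Y n - Y' n))) \<longlonglongrightarrow> (B + C) * (0 + 0)"
    using X Y unfolding cauchy_rel_def by (intro tendsto_mult tendsto_add tendsto_const) auto
  then have g: "(\<lambda>n. (B + C) * (cstar_seminorm (X n - X' n) + cstar_seminorm (Y n - Y' n))) \<longlonglongrightarrow> 0" by simp
  have "(\<lambda>n. cstar_seminorm (X n * Y n - X' n * Y' n)) \<longlonglongrightarrow> 0"
    by (rule null_squeeze[OF _ _ g]) (auto intro: le[OF BC(2) BC(1)])
  moreover have "cauchy_rel X X" "cauchy_rel X' X'" "cauchy_rel Y Y" "cauchy_rel Y' Y'"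
    using X Y cauchy_rel_alt by blast+
  ultimately show ?thesis using c unfolding cauchy_rel_def[of "\<lambda>n. X n * Y n"] by blast
qed

lemma cauchy_rel_norm:
  assumes "cauchy_rel X Y"
  shows "convergent (\<lambda>n. cstar_seminorm (X n))"
    and "lim (\<lambda>n. cstar_seminorm (X n)) = lim (\<lambda>n. cstar_seminorm (Y n))"
proof -
  have conv: "convergent (\<lambda>n. cstar_seminorm (U n))" if U: "cauchy_rel U U" for U :: "nat \<Rightarrow> 'a"
  proof (rule Cauchy_convergent, rule metric_CauchyI)
    fix e :: real assume "0 < e"
    then obtain N where "\<forall>m\<ge>N. \<forall>n\<ge>N. cstar_seminorm (U m - U n) < e"
      using U unfolding cauchy_rel_def seminorm_cauchy_def by meson
    then show "\<exists>N. \<forall>m\<ge>N. \<forall>n\<ge>N. dist (cstar_seminorm (U m)) (cstar_seminorm (U n)) < e"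
      unfolding dist_real_def by (meson cstar_seminorm_abs_diff le_less_trans)
  qed
  have XY: "cauchy_rel X X" "cauchy_rel Y Y" using assms cauchy_rel_alt by blast+
  show "convergent (\<lambda>n. cstar_seminorm (X n))" using conv[OF XY(1)] .
  then have X: "(\<lambda>n. cstar_seminorm (X n)) \<longlonglongrightarrow> lim (\<lambda>n. cstar_seminorm (X n))"
    by (simp add: convergent_LIMSEQ_iff)
  have Y: "(\<lambda>n. cstar_seminorm (Y n)) \<longlonglongrightarrow> lim (\<lambda>n. cstar_seminorm (Y n))"
    using conv[OF XY(2)] by (simp add: convergent_LIMSEQ_iff)
  have "(\<lambda>n. \<bar>cstar_seminorm (X n) - cstar_seminorm (Y n)\<bar>) \<longlonglongrightarrow> 0"
    by (rule null_squeeze[where g = "\<lambda>n. cstar_seminorm (X n - Y n)"])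
      (use assms in \<open>auto simp: cauchy_rel_def cstar_seminorm_abs_diff\<close>)
  then have "(\<lambda>n. cstar_seminorm (X n) - cstar_seminorm (Y n)) \<longlonglongrightarrow> 0"
    by (simp add: tendsto_rabs_zero_iff)
  with tendsto_diff[OF X Y] show "lim (\<lambda>n. cstar_seminorm (X n)) = lim (\<lambda>n. cstar_seminorm (Y n))"
    using LIMSEQ_unique by fastforce
qed

instantiation cstar_completion :: (pre_cstar_algebra) "{complex_star_algebra, real_normed_algebra}"
begin

lift_definition zero_cstar_completion :: "'a cstar_completion" is "\<lambda>_. 0"
  by (rule cauchy_rel_const)

lift_definition one_cstar_completion :: "'a cstar_completion" is "\<lambda>_. 1"
  by (rule cauchy_rel_const)

lift_definition plus_cstar_completion :: "'a cstar_completion \<Rightarrow> 'a cstar_completion \<Rightarrow> 'a cstar_completion"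
  is "\<lambda>X Y n. X n + Y n" by (rule cauchy_rel_add)

lift_definition times_cstar_completion :: "'a cstar_completion \<Rightarrow> 'a cstar_completion \<Rightarrow> 'a cstar_completion"
  is "\<lambda>X Y n. X n * Y n" by (rule cauchy_rel_mult)

lift_definition scaleC_cstar_completion :: "complex \<Rightarrow> 'a cstar_completion \<Rightarrow> 'a cstar_completion"
  is "\<lambda>c X n. c *\<^sub>C X n" by (rule cauchy_rel_scaleC)

lift_definition star_cstar_completion :: "'a cstar_completion \<Rightarrow> 'a cstar_completion"
  is "\<lambda>X n. star (X n)" by (rule cauchy_rel_star)

lift_definition norm_cstar_completion :: "'a cstar_completion \<Rightarrow> real"
  is "\<lambda>X. lim (\<lambda>n. cstar_seminorm (X n))" by (rule cauchy_rel_norm)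

definition uminus_cstar_completion :: "'a cstar_completion \<Rightarrow> 'a cstar_completion" where
  "uminus_cstar_completion x = (- 1) *\<^sub>C x"

definition minus_cstar_completion :: "'a cstar_completion \<Rightarrow> 'a cstar_completion \<Rightarrow> 'a cstar_completion" where
  "minus_cstar_completion x y = x + - y"

definition scaleR_cstar_completion :: "real \<Rightarrow> 'a cstar_completion \<Rightarrow> 'a cstar_completion" where
  "scaleR_cstar_completion r x = complex_of_real r *\<^sub>C x"

definition sgn_cstar_completion :: "'a cstar_completion \<Rightarrow> 'a cstar_completion" where
  "sgn_cstar_completion x = inverse (norm x) *\<^sub>R x"

definition dist_cstar_completion :: "'a cstar_completion \<Rightarrow> 'a cstar_completion \<Rightarrow> real" where
  "dist_cstar_completion x y = norm (x - y)"

definition uniformity_cstar_completion :: "('a cstar_completion \<times> 'a cstar_completion) filter" where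
  "uniformity_cstar_completion = (INF e\<in>{0<..}. principal {(x, y). dist x y < e})"

definition open_cstar_completion :: "'a cstar_completion set \<Rightarrow> bool" where
  "open_cstar_completion U \<longleftrightarrow> (\<forall>x\<in>U. eventually (\<lambda>(x', y). x' = x \<longrightarrow> y \<in> U) uniformity)"

instance
proof
  fix x y z :: "'a cstar_completion" and c d :: complex and r s :: real
  note intros = cauchy_rel_add cauchy_rel_mult cauchy_rel_scaleC cauchy_rel_star cauchy_rel_const
  show add_assoc: "x + y + z = x + (y + z)" for x y z :: "'a cstar_completion"
    by transfer (simp add: add.assoc intros)
  show add_comm: "x + y = y + x" for x y :: "'a cstar_completion"
    by transfer (simp add: add.commute intros)
  show zero: "0 + x = x" for x :: "'a cstar_completion"
    by transfer simp
  show sadd: "(c + d) *\<^sub>C x = c *\<^sub>C x + d *\<^sub>C x" for c d and x :: "'a cstar_completion"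
    by transfer (simp add: scaleC_add_left intros)
  show sone: "1 *\<^sub>C x = x" for x :: "'a cstar_completion"
    by transfer simp
  have szero: "0 *\<^sub>C x = 0" for x :: "'a cstar_completion"
    by transfer (simp add: intros)
  show minus: "- x + x = 0" for x :: "'a cstar_completion"
    using sadd[of "- 1" 1 x] szero by (simp add: uminus_cstar_completion_def sone)
  show mdef: "x - y = x + - y" for x y :: "'a cstar_completion"
    by (simp add: minus_cstar_completion_def)
  show sadd': "c *\<^sub>C (x + y) = c *\<^sub>C x + c *\<^sub>C y" for c and x y :: "'a cstar_completion"
    by transfer (simp add: scaleC_add_right intros)
  show sass: "c *\<^sub>C d *\<^sub>C x = (c * d) *\<^sub>C x" for c d and x :: "'a cstar_completion"
    by transfer (simp add: intros)
  show "x * y * z = x * (y * z)" by transfer (simp add: mult.assoc intros)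
  show "(x + y) * z = x * z + y * z" by transfer (simp add: distrib_right intros)
  show "x * (y + z) = x * y + x * z" by transfer (simp add: distrib_left intros)
  show "1 * x = x" "x * 1 = x" by (transfer, simp)+
  show sml: "(c *\<^sub>C x) * y = c *\<^sub>C (x * y)" for c and x y :: "'a cstar_completion"
    by transfer (simp add: intros)
  show smr: "x * (c *\<^sub>C y) = c *\<^sub>C (x * y)" for c and x y :: "'a cstar_completion"
    by transfer (simp add: intros)
  show "star (x + y) = star x + star y" by transfer (simp add: star_add intros)
  show "star (c *\<^sub>C x) = cnj c *\<^sub>C star x" by transfer (simp add: intros)
  show "star (x * y) = star y * star x" by transfer (simp add: star_mult intros)
  show "star (star x) = x" by transfer simp
  show "r *\<^sub>R (x + y) = r *\<^sub>R x + r *\<^sub>R y" "(r + s) *\<^sub>R x = r *\<^sub>R x + s *\<^sub>R x"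
    "r *\<^sub>R s *\<^sub>R x = (r * s) *\<^sub>R x" "1 *\<^sub>R x = x"
    "(r *\<^sub>R x) * y = r *\<^sub>R (x * y)" "x * (r *\<^sub>R y) = r *\<^sub>R (x * y)"
    by (simp_all add: scaleR_cstar_completion_def sadd sadd' sass sone sml smr)
  show "sgn x = inverse (norm x) *\<^sub>R x" "dist x y = norm (x - y)"
    by (simp_all add: sgn_cstar_completion_def dist_cstar_completion_def)
  show "uniformity = (INF e\<in>{0<..}. principal {(x, y). dist (x :: 'a cstar_completion) y < e})"
    by (rule uniformity_cstar_completion_def)
  show "open U = (\<forall>x\<in>U. eventually (\<lambda>(x', y). x' = x \<longrightarrow> y \<in> U) uniformity)" for U :: "'a cstar_completion set"
    by (rule open_cstar_completion_def)
  have lim: "(\<lambda>n. cstar_seminorm (X n)) \<longlonglongrightarrow> lim (\<lambda>n. cstar_seminorm (X n))"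
    if "cauchy_rel X X" for X :: "nat \<Rightarrow> 'a"
    using cauchy_rel_norm(1)[OF that] by (simp add: convergent_LIMSEQ_iff)
  have nn: "0 \<le> norm x" for x :: "'a cstar_completion"
  proof transfer
    fix X :: "nat \<Rightarrow> 'a" assume "cauchy_rel X X"
    from lim[OF this] show "0 \<le> lim (\<lambda>n. cstar_seminorm (X n))" by (rule LIMSEQ_le_const) simp
  qed
  show norm_zero: "norm x = 0 \<longleftrightarrow> x = 0"
  proof transfer
    fix X :: "nat \<Rightarrow> 'a" assume X: "cauchy_rel X X"
    have "lim (\<lambda>n. cstar_seminorm (X n)) = 0 \<longleftrightarrow> (\<lambda>n. cstar_seminorm (X n)) \<longlonglongrightarrow> 0"
      using lim[OF X] LIMSEQ_unique by metis
    then show "lim (\<lambda>n. cstar_seminorm (X n)) = 0 \<longleftrightarrow> cauchy_rel X (\<lambda>_. 0)"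
      using X cauchy_rel_const[of "0::'a"] by (simp add: cauchy_rel_def)
  qed
  show norm_tri: "norm (x + y) \<le> norm x + norm y" for x y :: "'a cstar_completion"
  proof transfer
    fix X Y :: "nat \<Rightarrow> 'a" assume X: "cauchy_rel X X" and Y: "cauchy_rel Y Y"
    show "lim (\<lambda>n. cstar_seminorm (X n + Y n)) \<le> lim (\<lambda>n. cstar_seminorm (X n)) + lim (\<lambda>n. cstar_seminorm (Y n))"
      by (rule LIMSEQ_le[OF lim[OF cauchy_rel_add[OF X Y]] tendsto_add[OF lim[OF X] lim[OF Y]]])
        (auto intro: cstar_seminorm_triangle)
  qed
  have norm_scale: "norm (c *\<^sub>C x) = cmod c * norm x" for c and x :: "'a cstar_completion"
  proof transfer
    fix c and X :: "nat \<Rightarrow> 'a" assume X: "cauchy_rel X X"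
    from tendsto_mult_left[OF lim[OF X], of "cmod c"]
    show "lim (\<lambda>n. cstar_seminorm (c *\<^sub>C X n)) = cmod c * lim (\<lambda>n. cstar_seminorm (X n))"
      by (simp add: cstar_seminorm_scaleC limI)
  qed
  show "norm (r *\<^sub>R x) = \<bar>r\<bar> * norm x"
    by (simp add: scaleR_cstar_completion_def norm_scale)
  show "norm (x * y) \<le> norm x * norm y"
  proof transfer
    fix X Y :: "nat \<Rightarrow> 'a" assume X: "cauchy_rel X X" and Y: "cauchy_rel Y Y"
    show "lim (\<lambda>n. cstar_seminorm (X n * Y n)) \<le> lim (\<lambda>n. cstar_seminorm (X n)) * lim (\<lambda>n. cstar_seminorm (Y n))"
      by (rule LIMSEQ_le[OF lim[OF cauchy_rel_mult[OF X Y]] tendsto_mult[OF lim[OF X] lim[OF Y]]])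
        (auto intro: cstar_seminorm_mult)
  qed
qed

end

lemma completion_norm_LIMSEQ:
  "cauchy_rel X X \<Longrightarrow> (\<lambda>n. cstar_seminorm (X n)) \<longlonglongrightarrow> norm (abs_cstar_completion X)"
  using cauchy_rel_norm(1)[of X X]
  by (simp add: convergent_LIMSEQ_iff norm_cstar_completion.abs_eq)

lemma completion_cases:
  obtains X where "cauchy_rel X X" "x = abs_cstar_completion X"
  by (metis Quotient3_cstar_completion Quotient3_abs_rep Quotient3_rep_reflp)

lift_definition embed :: "'a::pre_cstar_algebra \<Rightarrow> 'a cstar_completion" is "\<lambda>a n. a"
  by (rule cauchy_rel_const)

lemma completion_minus_abs:
  assumes "cauchy_rel X X" "cauchy_rel Y Y"
  shows "abs_cstar_completion X - abs_cstar_completion Y = abs_cstar_completion (\<lambda>n. X n - Y n)"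
    and "cauchy_rel (\<lambda>n. X n - Y n) (\<lambda>n. X n - Y n)"
proof -
  have m: "cauchy_rel (\<lambda>n. (- 1) *\<^sub>C Y n) (\<lambda>n. (- 1) *\<^sub>C Y n)"
    using cauchy_rel_scaleC[OF assms(2)] .
  show "cauchy_rel (\<lambda>n. X n - Y n) (\<lambda>n. X n - Y n)"
    using cauchy_rel_add[OF assms(1) m] by simp
  have "abs_cstar_completion X - abs_cstar_completion Y =
      abs_cstar_completion X + (- 1) *\<^sub>C abs_cstar_completion Y"
    by (simp only: minus_cstar_completion_def uminus_cstar_completion_def)
  also have "\<dots> = abs_cstar_completion (\<lambda>n. X n + (- 1) *\<^sub>C Y n)"
    by (simp only: scaleC_cstar_completion.abs_eq[OF assms(2)] plus_cstar_completion.abs_eq[OF assms(1) m])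
  finally show "abs_cstar_completion X - abs_cstar_completion Y = abs_cstar_completion (\<lambda>n. X n - Y n)"
    by simp
qed

lemma embed_diff: "embed (a - b) = embed a - embed b"
  unfolding embed.abs_eq by (simp add: completion_minus_abs cauchy_rel_const)

lemma norm_embed: "norm (embed a) = cstar_seminorm a"
  by transfer (simp add: limI)

lemma norm_diff_embed_LIMSEQ:
  assumes "cauchy_rel X X"
  shows "(\<lambda>n. cstar_seminorm (X n - a)) \<longlonglongrightarrow> norm (abs_cstar_completion X - embed a)"
  unfolding embed.abs_eq completion_minus_abs(1)[OF assms cauchy_rel_const]
  by (rule completion_norm_LIMSEQ[OF completion_minus_abs(2)[OF assms cauchy_rel_const]])

lemma embed_LIMSEQ:
  assumes X: "cauchy_rel X X"
  shows "(\<lambda>n. embed (X n)) \<longlonglongrightarrow> abs_cstar_completion X"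
proof (rule metric_LIMSEQ_I)
  fix e :: real assume "0 < e"
  then obtain N where N: "\<forall>m\<ge>N. \<forall>n\<ge>N. cstar_seminorm (X m - X n) < e / 2"
    using X half_gt_zero unfolding cauchy_rel_def seminorm_cauchy_def by meson
  show "\<exists>N. \<forall>n\<ge>N. dist (embed (X n)) (abs_cstar_completion X) < e"
  proof (intro exI[of _ N] allI impI)
    fix n assume "N \<le> n"
    then have "norm (abs_cstar_completion X - embed (X n)) \<le> e / 2"
      using N by (intro LIMSEQ_le_const2[OF norm_diff_embed_LIMSEQ[OF X]] exI[of _ N]) (auto intro: less_imp_le)
    then show "dist (embed (X n)) (abs_cstar_completion X) < e"
      using \<open>0 < e\<close> by (simp add: dist_norm norm_minus_commute)
  qed
qed

lemma embed_dense: "0 < e \<Longrightarrow> \<exists>a. dist x (embed a) < e"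
  by (metis completion_cases dist_commute embed_LIMSEQ metric_LIMSEQ_D order_refl)

instance cstar_completion :: (pre_cstar_algebra) cstar_algebra
proof
  fix x :: "'a cstar_completion" and c :: complex and r :: real
  show "r *\<^sub>R x = complex_of_real r *\<^sub>C x" by (simp add: scaleR_cstar_completion_def)
  obtain X where X: "cauchy_rel X X" "x = abs_cstar_completion X" by (rule completion_cases)
  have "(\<lambda>n. cmod c * cstar_seminorm (X n)) \<longlonglongrightarrow> norm (c *\<^sub>C x)"
    using completion_norm_LIMSEQ[OF cauchy_rel_scaleC[OF X(1), of c]]
    by (simp add: X(2) scaleC_cstar_completion.abs_eq[OF X(1)] cstar_seminorm_scaleC)
  moreover have "(\<lambda>n. cmod c * cstar_seminorm (X n)) \<longlonglongrightarrow> cmod c * norm x"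
    unfolding X(2) by (intro tendsto_mult_left completion_norm_LIMSEQ X(1))
  ultimately show "norm (c *\<^sub>C x) = cmod c * norm x" by (rule LIMSEQ_unique)
  have "(\<lambda>n. (cstar_seminorm (X n))\<^sup>2) \<longlonglongrightarrow> norm (star x * x)"
    using completion_norm_LIMSEQ[OF cauchy_rel_mult[OF cauchy_rel_star[OF X(1)] X(1)]]
    by (simp add: X(2) star_cstar_completion.abs_eq[OF X(1)]
        times_cstar_completion.abs_eq[OF cauchy_rel_star[OF X(1)] X(1)] cstar_seminorm_star_mult)
  moreover have "(\<lambda>n. (cstar_seminorm (X n))\<^sup>2) \<longlonglongrightarrow> (norm x)\<^sup>2"
    unfolding X(2) by (intro tendsto_power completion_norm_LIMSEQ X(1))
  ultimately show "norm (star x * x) = (norm x)\<^sup>2" by (rule LIMSEQ_unique)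
next
  fix S :: "nat \<Rightarrow> 'a cstar_completion"
  assume S: "Cauchy S"
  have "\<exists>a. dist (S k) (embed a) < 1 / real (Suc k)" for k
    by (rule embed_dense) simp
  then obtain A where A: "\<And>k. dist (S k) (embed (A k)) < 1 / real (Suc k)" by metis
  have null: "(\<lambda>k. dist (S k) (embed (A k))) \<longlonglongrightarrow> 0"
    by (rule null_squeeze[OF _ _ LIMSEQ_inverse_real_of_nat])
      (use A in \<open>auto simp: inverse_eq_divide intro: less_imp_le\<close>)
  have "seminorm_cauchy A"
    unfolding seminorm_cauchy_def
  proof (intro allI impI)
    fix e :: real assume e: "0 < e"
    obtain M where M: "\<forall>m\<ge>M. \<forall>n\<ge>M. dist (S m) (S n) < e / 3"
      using S e by (meson Cauchy_def zero_less_divide_iff zero_less_numeral)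
    obtain N where N: "\<forall>k\<ge>N. dist (S k) (embed (A k)) < e / 3"
      using null e by (auto simp: lim_sequentially dest!: spec[of _ "e / 3"])
    have "cstar_seminorm (A m - A n) < e" if "max M N \<le> m" "max M N \<le> n" for m n
    proof -
      have "cstar_seminorm (A m - A n) = dist (embed (A m)) (embed (A n))"
        by (simp add: dist_norm norm_embed flip: embed_diff)
      also have "\<dots> \<le> dist (S m) (embed (A m)) + dist (S m) (S n) + dist (S n) (embed (A n))"
        using dist_triangle[of "embed (A m)" "embed (A n)" "S m"] dist_triangle[of "S m" "embed (A n)" "S n"]
        by (simp add: dist_commute)
      also have "\<dots> < e / 3 + e / 3 + e / 3"
        using M N that by (intro add_strict_mono) auto
      finally show ?thesis by simp
    qed
    then show "\<exists>N. \<forall>m\<ge>N. \<forall>n\<ge>N. cstar_seminorm (A m - A n) < e" by blast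
  qed
  then have "cauchy_rel A A" by (simp add: cauchy_rel_def)
  from embed_LIMSEQ[OF this] have lim: "(\<lambda>k. embed (A k)) \<longlonglongrightarrow> abs_cstar_completion A" .
  have "(\<lambda>k. S k - embed (A k)) \<longlonglongrightarrow> 0"
    using null unfolding dist_norm by (rule tendsto_norm_zero_cancel)
  with lim have "S \<longlonglongrightarrow> abs_cstar_completion A" by (rule Lim_transform)
  then show "convergent S" by (rule convergentI)
qed

section \<open>Symmetric states on the infinite minimal Fermi tensor product\<close>

text \<open>Tensor positions are counted from 0, so a permutation of the positions is a permutation
  of \<^typ>\<open>nat\<close>.\<close>

type_synonym 'a fermi_inf = "'a fermi_alg cstar_completion"

definition fermi_site :: "nat \<Rightarrow> 'a::graded_cstar_algebra \<Rightarrow> 'a fermi_inf" where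
  "fermi_site j a = embed (site j a)"

definition star_automorphism :: "('b::complex_star_algebra \<Rightarrow> 'b) \<Rightarrow> bool" where
  "star_automorphism f \<longleftrightarrow> bij f \<and> clinear f \<and>
    (\<forall>x y. f (x * y) = f x * f y) \<and> (\<forall>x. f (star x) = star (f x))"

definition finite_perm :: "(nat \<Rightarrow> nat) \<Rightarrow> bool" where
  "finite_perm \<sigma> \<longleftrightarrow> bij \<sigma> \<and> finite {k. \<sigma> k \<noteq> k}"

text \<open>*-automorphisms of a C*-algebra are automatically continuous; requiring continuity here only
  makes it immediate that the values on the sites determine the automorphism.\<close>

definition perm_action :: "(nat \<Rightarrow> nat) \<Rightarrow> 'a::graded_cstar_algebra fermi_inf \<Rightarrow> 'a fermi_inf" where
  "perm_action \<sigma> = (THE f. star_automorphism f \<and> continuous_on UNIV f \<and>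
    (\<forall>j a. f (fermi_site j a) = fermi_site (\<sigma> j) a))"

definition symmetric_state :: "('a::graded_cstar_algebra fermi_inf \<Rightarrow> complex) \<Rightarrow> bool" where
  "symmetric_state \<omega> \<longleftrightarrow> is_state \<omega> \<and> (\<forall>\<sigma> x. finite_perm \<sigma> \<longrightarrow> \<omega> (perm_action \<sigma> x) = \<omega> x)"

text \<open>Extreme points, for a convex set of complex functions. (The library notion
  \<open>extreme_point_of\<close> needs a real vector space type, which function types are not.)\<close>

definition is_extreme_in :: "('b \<Rightarrow> complex) \<Rightarrow> ('b \<Rightarrow> complex) set \<Rightarrow> bool" where
  "is_extreme_in \<omega> S \<longleftrightarrow> \<omega> \<in> S \<and>
    (\<forall>\<phi>\<in>S. \<forall>\<psi>\<in>S. \<forall>t::real. 0 < t \<and> t < 1 \<and>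
      (\<forall>x. \<omega> x = of_real t * \<phi> x + of_real (1 - t) * \<psi> x) \<longrightarrow> \<phi> = \<omega> \<and> \<psi> = \<omega>)"

text \<open>For \<open>n \<ge> 1\<close>, exchanges the first \<open>2 ^ (n - 1)\<close> positions with the next \<open>2 ^ (n - 1)\<close> ones.\<close>

definition block_swap :: "nat \<Rightarrow> nat \<Rightarrow> nat" where
  "block_swap n k =
    (if k < 2 ^ (n - 1) then k + 2 ^ (n - 1) else if k < 2 ^ n then k - 2 ^ (n - 1) else k)"

definition strongly_clustering :: "('a::graded_cstar_algebra fermi_inf \<Rightarrow> complex) \<Rightarrow> bool" where
  "strongly_clustering \<omega> \<longleftrightarrow>
    (\<forall>x y. (\<lambda>n. \<omega> (perm_action (block_swap n) x * y)) \<longlonglongrightarrow> \<omega> x * \<omega> y)"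

definition inf_product_state ::
  "('a::graded_cstar_algebra \<Rightarrow> complex) \<Rightarrow> 'a fermi_inf \<Rightarrow> complex" where
  "inf_product_state \<rho> = (THE \<phi>. is_state \<phi> \<and>
    (\<forall>as. \<phi> (embed (elem_tensor as)) = prod_list (map \<rho> as)))"

end

theory Submission
  imports Defs
begin

text \<open>Write \<open>i\<^sub>n(a)\<close> for \<open>site n a\<close>. All three conditions are equivalent to the factorization
  \<open>\<omega>(x i\<^sub>n(a)) = \<omega>(x) \<omega>(i\<^sub>0(a))\<close> for \<open>x\<close> in the first \<open>n\<close> tensor factors. By symmetry the left side
  does not depend on the position of \<open>a\<close> beyond \<open>n\<close>. For odd \<open>a\<close> it vanishes in every symmetric
  state, because copies of \<open>a\<close> at different sites anticommute. For even \<open>a\<close> it is the constant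
  value of a sequence with limit \<open>\<omega>(x) \<omega>(i\<^sub>0(a))\<close> if \<open>\<omega>\<close> is strongly clustering; if \<open>\<omega>\<close> is extreme
  and \<open>0 \<le> a \<le> 1\<close>, then \<open>x \<mapsto> \<omega>(x i\<^sub>n(a))\<close> extends to a positive symmetric functional dominated by
  \<open>\<omega>\<close>, which is therefore proportional to \<open>\<omega>\<close>. Conversely, in a factorizing state translates of
  an element to disjoint blocks are uncorrelated. This gives strong clustering, and extremality
  follows since averages over many blocks have small variance in \<open>\<omega>\<close>, hence in every symmetric
  state that a multiple of \<open>\<omega>\<close> dominates.\<close>

section \<open>Sites and relocations\<close>

primrec site_prod :: "(nat \<Rightarrow> nat) \<Rightarrow> nat \<Rightarrow> (nat \<Rightarrow> 'a::graded_cstar_algebra) \<Rightarrow> 'a fermi_alg" where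
  "site_prod \<sigma> 0 f = 1"
| "site_prod \<sigma> (Suc n) f = site_prod \<sigma> n f * site (\<sigma> n) (f n)"

lemma site_prod_cong:
  "(\<And>i. i < n \<Longrightarrow> \<sigma> i = \<tau> i) \<Longrightarrow> (\<And>i. i < n \<Longrightarrow> f i = g i) \<Longrightarrow> site_prod \<sigma> n f = site_prod \<tau> n g"
  by (induction n) auto

lemma site_prod_upd_ge: "n \<le> k \<Longrightarrow> site_prod \<sigma> n (f(k := x)) = site_prod \<sigma> n f"
  by (rule site_prod_cong) auto

lemma site_prod_add:
  "k < n \<Longrightarrow> site_prod \<sigma> n (f(k := x + y)) = site_prod \<sigma> n (f(k := x)) + site_prod \<sigma> n (f(k := y))"
proof (induction n)
  case (Suc n)
  show ?case
  proof (cases "k = n")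
    case True
    show ?thesis unfolding True
      by (simp only: site_prod.simps site_prod_upd_ge[OF order_refl] fun_upd_same
          clinearD(1)[OF site_clinear] distrib_left)
  qed (use Suc in \<open>simp add: distrib_right\<close>)
qed simp

lemma site_prod_scaleC:
  "k < n \<Longrightarrow> site_prod \<sigma> n (f(k := z *\<^sub>C x)) = z *\<^sub>C site_prod \<sigma> n (f(k := x))"
proof (induction n)
  case (Suc n)
  show ?case
  proof (cases "k = n")
    case True
    show ?thesis unfolding True
      by (simp only: site_prod.simps site_prod_upd_ge[OF order_refl] fun_upd_same
          clinearD(2)[OF site_clinear] mult_scaleC_right)
  qed (use Suc in simp)
qed simp

text \<open>Extends \<open>tens_Suc_homog\<close> to arbitrary entries by expanding into homogeneous
  tensors: the terms for \<open>P\<close> and \<open>insert n P\<close> differ only in carrying the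
  even or the odd part of the last entry, and these two parts add up to it.\<close>

lemma tens_Suc_mult: "tens (Suc n) f = tens n f * site n (f n)"
proof -
  let ?g = "\<lambda>P i. graded_part (i \<in> P) (f i)"
  have step: "tens (Suc n) (?g Q) = tens n (?g P) * site n (graded_part (n \<in> Q) (f n))"
    if "Q \<subseteq> {..<Suc n}" "\<And>i. i < n \<Longrightarrow> i \<in> Q \<longleftrightarrow> i \<in> P" for P Q
    unfolding tens_Suc_homog[OF homog_graded_part[OF that(1), of f]]
    using tens_cong[of n "?g Q" "?g P"] that(2) by simp
  have "tens (Suc n) (?g P) + tens (Suc n) (?g (insert n P)) = tens n (?g P) * site n (f n)"
    if "P \<in> Pow {..<n}" for P
  proof -
    have "n \<notin> P" using that by auto
    have "tens (Suc n) (?g P) + tens (Suc n) (?g (insert n P)) =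
       tens n (?g P) * site n (graded_part False (f n)) + tens n (?g P) * site n (graded_part True (f n))"
      by (subst (1 2) step[of _ P]) (use that \<open>n \<notin> P\<close> in auto)
    also have "\<dots> = tens n (?g P) * site n (graded_part False (f n) + graded_part True (f n))"
      by (simp add: clinearD[OF site_clinear] distrib_left)
    finally show ?thesis by (simp add: graded_part_sum)
  qed
  then have "tens (Suc n) f = (\<Sum>P\<in>Pow {..<n}. tens n (?g P) * site n (f n))"
    by (subst tens_expand) (simp add: sum_Pow_Suc)
  also have "\<dots> = tens n f * site n (f n)"
    by (simp add: tens_expand[of n f] sum_distrib_right)
  finally show ?thesis .
qed

lemma site_prod_id: "site_prod (\<lambda>i. i) n f = tens n f"
  by (induction n) (simp_all add: fermi_one_tens[of 0] tens_def[of 0] tens_Suc_mult)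

text \<open>Keeping the order of the factors in \<open>site_prod\<close> makes all signs implicit.\<close>

definition relocate :: "(nat \<Rightarrow> nat) \<Rightarrow> 'a::graded_cstar_algebra fermi_alg \<Rightarrow> 'a fermi_alg" where
  "relocate \<sigma> = tensor_ext (\<lambda>c. c) (\<lambda>as. site_prod \<sigma> (length as) (entry as))"

lemma multilinear_site_prod: "multilinear (\<lambda>c. c) (\<lambda>as. site_prod \<sigma> (length as) (entry as))"
  unfolding multilinear_def
proof (intro conjI allI impI)
  fix as :: "'a list" and k x y z
  assume k: "k < length as"
  show "site_prod \<sigma> (length (as[k := x + y])) (entry (as[k := x + y])) =
      site_prod \<sigma> (length (as[k := x])) (entry (as[k := x])) + site_prod \<sigma> (length (as[k := y])) (entry (as[k := y]))"
    unfolding length_list_update entry_upd[OF k] by (rule site_prod_add[OF k])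
  show "site_prod \<sigma> (length (as[k := z *\<^sub>C x])) (entry (as[k := z *\<^sub>C x])) =
      z *\<^sub>C site_prod \<sigma> (length (as[k := x])) (entry (as[k := x]))"
    unfolding length_list_update entry_upd[OF k] by (rule site_prod_scaleC[OF k])
next
  fix as :: "'a list"
  show "site_prod \<sigma> (length (as @ [1])) (entry (as @ [1])) = site_prod \<sigma> (length as) (entry as)"
    by (simp add: entry_append_one entry_ge)
qed simp

lemma relocate_clinear: "clinear (relocate \<sigma>)"
  by (simp add: clinear_def relocate_def tensor_ext_add[OF multilinear_site_prod]
      tensor_ext_scaleC[OF multilinear_site_prod])

lemmas relocate_simps = clinearD[OF relocate_clinear]

lemma relocate_tens: "relocate \<sigma> (tens n f) = site_prod \<sigma> n f"
  unfolding relocate_def tens_def tensor_ext_elem[OF multilinear_site_prod]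
  by (simp, rule site_prod_cong) (simp_all add: entry_map)

lemma relocate_one [simp]: "relocate \<sigma> 1 = 1"
  using relocate_tens[of \<sigma> 0 "\<lambda>_. 1"] by (simp add: fermi_one_tens[of 0])

text \<open>Builds elementary tensors by appending one site on the right, so the step involves
  neither homogeneity nor signs. The level varies along the induction, which is why \<open>Q\<close>
  takes it as an argument.\<close>

lemma fermi_level_induct [consumes 1, case_names zero add scale one step]:
  assumes "x \<in> fermi_level n"
    and zero: "\<And>n. Q n 0"
    and add: "\<And>n x y. x \<in> fermi_level n \<Longrightarrow> y \<in> fermi_level n \<Longrightarrow> Q n x \<Longrightarrow> Q n y \<Longrightarrow> Q n (x + y)"
    and scale: "\<And>n c x. x \<in> fermi_level n \<Longrightarrow> Q n x \<Longrightarrow> Q n (c *\<^sub>C x)"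
    and one: "Q 0 1"
    and step: "\<And>n x c. x \<in> fermi_level n \<Longrightarrow> Q n x \<Longrightarrow> Q (Suc n) (x * site n c)"
  shows "Q n x"
proof -
  have t: "Q n (tens n f)" for n f
  proof (induction n)
    case 0
    then show ?case using one by (simp add: fermi_one_tens[of 0] tens_def)
  next
    case (Suc n)
    then show ?case unfolding tens_Suc_mult by (intro step fermi_level_tens)
  qed
  show ?thesis using assms(1)
    by (induction x rule: fermi_level_homog_induct) (auto intro: zero add scale t)
qed

lemma fermi_level_site: "j < n \<Longrightarrow> site j a \<in> fermi_level n"
  by (rule fermi_level_mono[of "Suc j"]) (simp_all add: site_tens fermi_level_tens)

text \<open>For a tensor \<open>x\<close> in the first \<open>n\<close> factors,
  \<open>x * site n c\<close> is the elementary tensor with \<open>c\<close> appended as last entry,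
  and the ordered product defining its relocation ends with \<open>c\<close> at site
  \<open>\<sigma> n\<close>.\<close>

lemma relocate_snoc: "x \<in> fermi_level n \<Longrightarrow> relocate \<sigma> (x * site n c) = relocate \<sigma> x * site (\<sigma> n) c"
proof (induction x rule: fermi_level_homog_induct)
  case (tens P a)
  have "relocate \<sigma> (tens n a * site n c) = relocate \<sigma> (tens (Suc n) (a(n := c)))"
    unfolding tens_Suc_mult using tens_cong[of n a "a(n := c)"] by simp
  also have "\<dots> = site_prod \<sigma> n (a(n := c)) * site (\<sigma> n) c"
    by (simp add: relocate_tens)
  also have "site_prod \<sigma> n (a(n := c)) = site_prod \<sigma> n a"
    by (rule site_prod_cong) auto
  finally show ?case by (simp add: relocate_tens)
qed (simp_all add: relocate_simps distrib_right)

lemma relocate_site [simp]: "relocate \<sigma> (site j a) = site (\<sigma> j) a"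
  using relocate_snoc[OF fermi_level_one[of j], of \<sigma> a] by simp

lemma relocate_cong:
  assumes "x \<in> fermi_level n" "\<And>i. i < n \<Longrightarrow> \<sigma> i = \<tau> i"
  shows "relocate \<sigma> x = relocate \<tau> x"
  using assms(1)
proof (induction x rule: fermi_level_homog_induct)
  case (tens P a)
  show ?case unfolding relocate_tens by (rule site_prod_cong) (simp_all add: assms(2))
qed (simp_all add: relocate_simps)

lemma relocate_id: "relocate (\<lambda>i. i) x = x"
proof -
  obtain n where "x \<in> fermi_level n" using fermi_level_ex by blast
  then show ?thesis
    by (induction x rule: fermi_level_homog_induct) (simp_all add: relocate_simps relocate_tens site_prod_id)
qed

lemma relocate_level:
  assumes "x \<in> fermi_level n" "\<And>i. i < n \<Longrightarrow> \<sigma> i < m"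
  shows "relocate \<sigma> x \<in> fermi_level m"
  using assms by (induction n x rule: fermi_level_induct)
    (simp_all add: relocate_simps relocate_snoc fermi_level_zero fermi_level_add fermi_level_scaleC
      fermi_level_one fermi_level_mult fermi_level_site)

section \<open>Signs from commuting homogeneous elements at different sites\<close>

definition parity :: "bool \<Rightarrow> 'a::graded_cstar_algebra \<Rightarrow> bool" where
  "parity p a \<longleftrightarrow> grading a = (if p then - a else a)"

lemma parity_graded_part: "parity p (graded_part p a)"
  by (simp add: parity_def grading_graded_part)

lemma koszul_sign_singleton:
  assumes "i < n"
  shows "koszul_sign n {i} {j} = (if j < i then - 1 else 1)"
proof -
  have "(\<Prod>l<k. if k \<in> {i} \<and> l \<in> {j} then - 1 else 1 :: complex) = (if k = i then if j < i then - 1 else 1 else 1)" for k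
    by (cases "k = i") (simp_all add: prod.delta)
  then show ?thesis using assms unfolding koszul_sign_def by (simp add: prod.delta)
qed

lemma homog_site_at:
  assumes "i < n" "parity p a"
  shows "homog n (if p then {i} else {}) (\<lambda>k. if k = i then a else 1)"
  using assms by (auto simp: homog_def parity_def)

lemma site_tens_at:
  assumes "i < n"
  shows "site i a = tens n (\<lambda>k. if k = i then a else 1)"
  unfolding site_tens using assms by (subst tens_extend[of "Suc i" n]) (auto intro!: tens_cong)

text \<open>Both products are multiples of the same elementary tensor. If \<open>a\<close> and
  \<open>b\<close> are both odd, the Koszul sign is \<open>- 1\<close> for exactly one of the two
  orders, the one with the larger index on the left.\<close>

lemma site_commute:
  assumes "i \<noteq> j" "parity p a" "parity q b"
  shows "site i a * site j b = (if p \<and> q then - 1 else 1) *\<^sub>C (site j b * site i a)"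
proof -
  define n where "n = Suc (max i j)"
  have n: "i < n" "j < n" by (auto simp: n_def)
  have "tens n (\<lambda>k. (if k = i then a else 1) * (if k = j then b else 1)) =
      tens n (\<lambda>k. (if k = j then b else 1) * (if k = i then a else 1))"
    by (rule tens_cong) (use assms(1) in auto)
  then show ?thesis
    unfolding site_tens_at[OF n(1)] site_tens_at[OF n(2)]
      tens_mult_homog[OF homog_site_at[OF n(1) assms(2)] homog_site_at[OF n(2) assms(3)]]
      tens_mult_homog[OF homog_site_at[OF n(2) assms(3)] homog_site_at[OF n(1) assms(2)]]
    using assms(1) n by (cases p; cases q) (auto simp: koszul_sign_singleton)
qed

text \<open>The sign picked up when an odd element (\<open>p\<close> true) crosses a tensor with odd
  entries at \<open>P\<close>: one factor \<open>- 1\<close> per odd entry among the first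
  \<open>n\<close>. An even element crosses with sign 1.\<close>

definition crossing_sign :: "nat \<Rightarrow> nat set \<Rightarrow> bool \<Rightarrow> complex" where
  "crossing_sign n P p = (\<Prod>i<n. if p \<and> i \<in> P then - 1 else 1)"

text \<open>The sign depends only on parities and not on where \<open>\<sigma>\<close> puts the
  factors, so it is the same before and after a relocation.\<close>

lemma site_site_prod_commute:
  assumes "homog n P f" "j \<notin> \<sigma> ` {..<n}" "parity p c"
  shows "site j c * site_prod \<sigma> n f = crossing_sign n P p *\<^sub>C (site_prod \<sigma> n f * site j c)"
proof -
  have "site j c * site_prod \<sigma> m f = crossing_sign m P p *\<^sub>C (site_prod \<sigma> m f * site j c)" if "m \<le> n" for m
    using that
  proof (induction m)
    case (Suc m)
    have "parity (m \<in> P) (f m)" using assms(1) Suc.prems by (simp add: homog_def parity_def)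
    moreover have "j \<noteq> \<sigma> m" using assms(2) Suc.prems by auto
    ultimately have s: "site j c * site (\<sigma> m) (f m) =
        (if p \<and> m \<in> P then - 1 else 1) *\<^sub>C (site (\<sigma> m) (f m) * site j c)"
      using site_commute assms(3) by blast
    have "site j c * site_prod \<sigma> (Suc m) f = (site j c * site_prod \<sigma> m f) * site (\<sigma> m) (f m)"
      by (simp add: mult.assoc)
    also have "\<dots> = crossing_sign m P p *\<^sub>C (site_prod \<sigma> m f * (site j c * site (\<sigma> m) (f m)))"
      using Suc by (simp add: mult.assoc)
    finally show ?case by (simp add: s mult.assoc crossing_sign_def del: scaleC_minus_left)
  qed (simp add: crossing_sign_def)
  then show ?thesis by blast
qed

section \<open>Injective relocations are star homomorphisms and permute the factors of product
  functionals\<close>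

lemma fermi_level_Suc_homog_induct [consumes 1, case_names zero add scale step]:
  assumes "x \<in> fermi_level (Suc n)"
    and "Q 0"
    and "\<And>x y. x \<in> fermi_level (Suc n) \<Longrightarrow> y \<in> fermi_level (Suc n) \<Longrightarrow> Q x \<Longrightarrow> Q y \<Longrightarrow> Q (x + y)"
    and "\<And>c x. x \<in> fermi_level (Suc n) \<Longrightarrow> Q x \<Longrightarrow> Q (c *\<^sub>C x)"
    and step: "\<And>P a p c. homog n P a \<Longrightarrow> parity p c \<Longrightarrow> Q (tens n a * site n c)"
  shows "Q x"
  using assms(1-4)
proof (induction x rule: fermi_level_homog_induct)
  case (tens P a)
  then have "homog n (P - {n}) a" "parity (n \<in> P) (a n)" by (auto simp: homog_def parity_def)
  then show ?case unfolding tens_Suc_mult by (rule step)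
qed auto

text \<open>Induction on a common level. To multiply tensors with last entries \<open>c\<close> and
  \<open>d\<close>, \<open>c\<close> has to cross the first \<open>n\<close> entries of the second
  tensor. The crossing sign is unchanged by relocation, so both sides acquire the same one.\<close>

lemma relocate_mult:
  fixes x y :: "'a::graded_cstar_algebra fermi_alg"
  assumes "inj \<sigma>"
  shows "relocate \<sigma> (x * y) = relocate \<sigma> x * relocate \<sigma> y"
proof -
  have "\<forall>x\<in>fermi_level n. \<forall>y\<in>fermi_level n. relocate \<sigma> (x * y) = relocate \<sigma> x * relocate \<sigma> (y::'a fermi_alg)" for n
  proof (induction n)
    case 0
    \<comment> \<open>Level 0 consists of the scalar multiples of 1.\<close>
    have s: "\<exists>c. x = c *\<^sub>C 1" if "x \<in> fermi_level 0" for x :: "'a fermi_alg"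
      using that
    proof (induction x rule: fermi_level_homog_induct)
      case zero
      show ?case by (rule exI[of _ 0]) simp
    next
      case (add x y)
      then show ?case by (metis scaleC_add_left)
    next
      case (scale c x)
      then show ?case by (metis scaleC_scaleC)
    next
      case (tens P a)
      show ?case by (rule exI[of _ 1]) (simp add: fermi_one_tens[of 0] tens_def)
    qed
    show ?case
    proof (intro ballI)
      fix x y :: "'a fermi_alg" assume "x \<in> fermi_level 0" "y \<in> fermi_level 0"
      then obtain c d where "x = c *\<^sub>C 1" "y = d *\<^sub>C 1" using s by blast
      then show "relocate \<sigma> (x * y) = relocate \<sigma> x * relocate \<sigma> y" by (simp add: relocate_simps)
    qed
  next
    case (Suc n)
    have step: "relocate \<sigma> ((tens n a * site n c) * (tens n b * site n d)) =
        relocate \<sigma> (tens n a * site n c) * relocate \<sigma> (tens n b * site n d)"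
      if b: "homog n Q b" and c: "parity p c" for a b Q p and c d :: 'a
    proof -
      \<comment> \<open>Injectivity keeps \<open>\<sigma> n\<close> off the sites of the first
        \<open>n\<close> entries, so the commutation rule applies after relocation as well.\<close>
      have n: "n \<notin> (\<lambda>i. i) ` {..<n}" "\<sigma> n \<notin> \<sigma> ` {..<n}" using injD[OF assms] by auto
      note s = site_site_prod_commute[OF b n(1) c, unfolded site_prod_id] site_site_prod_commute[OF b n(2) c]
      have "(tens n a * site n c) * (tens n b * site n d) = tens n a * (site n c * tens n b) * site n d"
        by (simp add: mult.assoc)
      also have "\<dots> = crossing_sign n Q p *\<^sub>C (tens n a * tens n b * site n (c * d))"
        by (simp add: s(1) site_mult mult.assoc)
      finally have "relocate \<sigma> ((tens n a * site n c) * (tens n b * site n d)) =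
          crossing_sign n Q p *\<^sub>C (relocate \<sigma> (tens n a) * relocate \<sigma> (tens n b) * site (\<sigma> n) (c * d))"
        using Suc.IH by (simp add: relocate_simps relocate_snoc fermi_level_mult fermi_level_tens)
      also have "\<dots> = relocate \<sigma> (tens n a) * (site (\<sigma> n) c * site_prod \<sigma> n b) * site (\<sigma> n) d"
        by (simp add: s(2) relocate_tens site_mult mult.assoc)
      finally show ?thesis by (simp add: relocate_snoc fermi_level_tens relocate_tens mult.assoc)
    qed
    show ?case
    proof (intro ballI)
      fix x y :: "'a fermi_alg" assume x: "x \<in> fermi_level (Suc n)" and y: "y \<in> fermi_level (Suc n)"
      from x show "relocate \<sigma> (x * y) = relocate \<sigma> x * relocate \<sigma> y"
      proof (induction x rule: fermi_level_Suc_homog_induct)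
        case x: (step P a p c)
        from y show ?case
        proof (induction y rule: fermi_level_Suc_homog_induct)
          case y: (step Q b q d)
          show ?case by (rule step[OF y(1) x(2)])
        qed (simp_all add: relocate_simps distrib_left)
      qed (simp_all add: relocate_simps distrib_right)
    qed
  qed
  then show ?thesis by (metis fermi_level_common)
qed

lemma relocate_star:
  assumes "inj \<sigma>"
  shows "relocate \<sigma> (star x) = star (relocate \<sigma> x)"
proof -
  obtain n where "x \<in> fermi_level n" using fermi_level_ex by blast
  then show ?thesis
    by (induction n x rule: fermi_level_induct)
      (simp_all add: relocate_simps star_add star_mult relocate_mult[OF assms] site_star)
qed

lemma relocate_relocate:
  assumes "inj \<sigma>"
  shows "relocate \<sigma> (relocate \<tau> x) = relocate (\<lambda>i. \<sigma> (\<tau> i)) x"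
proof -
  obtain n where "x \<in> fermi_level n" using fermi_level_ex by blast
  then show ?thesis
    by (induction n x rule: fermi_level_induct)
      (simp_all add: relocate_simps relocate_snoc relocate_mult[OF assms])
qed

text \<open>Sorting a relocated tensor by position costs only signs. A sign can arise only from
  inserting an odd entry, and then the even state at its site makes the value 0 anyway.\<close>

lemma product_functional_relocate:
  fixes \<omega> :: "nat \<Rightarrow> 'a::graded_cstar_algebra \<Rightarrow> complex"
  assumes \<omega>: "\<And>i. even_state (\<omega> i)" and "inj \<sigma>"
  shows "product_functional \<omega> (relocate \<sigma> x) = product_functional (\<lambda>i. \<omega> (\<sigma> i)) x"
proof -
  have st: "\<And>i. is_state (\<omega> i)" using \<omega> by (simp add: even_state_is_state)
  note lin = clinearD[OF product_functional_clinear[where \<omega> = \<omega>, OF st]]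
    clinearD[OF product_functional_clinear[where \<omega> = "\<lambda>i. \<omega> (\<sigma> i)", OF st]]
  obtain n where "x \<in> fermi_level n" using fermi_level_ex by blast
  then show ?thesis
  proof (induction x rule: fermi_level_homog_induct)
    case (tens P a)
    obtain M where M: "\<And>i. i < n \<Longrightarrow> \<sigma> i < M"
      by (metis finite_imageI finite_lessThan finite_nat_iff_bounded image_eqI lessThan_iff subset_eq)
    \<comment> \<open>The first \<open>m\<close> relocated entries form a multiple of a homogeneous
      tensor \<open>b\<close> that is 1 at all sites not yet used, so the next entry meets a 1 at
      \<open>\<sigma> m\<close>. The last clause tracks the value of the functional.\<close>
    have "\<exists>Q b \<epsilon>. homog M Q b \<and> site_prod \<sigma> m a = \<epsilon> *\<^sub>C tens M b \<and> (\<forall>j. j \<notin> \<sigma> ` {..<m} \<longrightarrow> b j = 1) \<and>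
        \<epsilon> * (\<Prod>j<M. \<omega> j (b j)) = (\<Prod>i<m. \<omega> (\<sigma> i) (a i))" if "m \<le> n" for m
      using that
    proof (induction m)
      case 0
      have "\<omega> j 1 = 1" for j using st by (simp add: is_state_def)
      then show ?case
        by (intro exI[of _ "{}"] exI[of _ "\<lambda>_. 1"] exI[of _ 1]) (simp add: homog_one fermi_one_tens[of M])
    next
      case (Suc m)
      then obtain Q b \<epsilon> where IH: "homog M Q b" "site_prod \<sigma> m a = \<epsilon> *\<^sub>C tens M b"
        "\<forall>j. j \<notin> \<sigma> ` {..<m} \<longrightarrow> b j = 1" "\<epsilon> * (\<Prod>j<M. \<omega> j (b j)) = (\<Prod>i<m. \<omega> (\<sigma> i) (a i))" by auto
      have s: "\<sigma> m < M" using M Suc.prems by simp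
      have b1: "b (\<sigma> m) = 1" using IH(3) injD[OF assms(2)] by fastforce
      define p where "p = (m \<in> P)"
      have p: "parity p (a m)" using tens Suc.prems by (simp add: homog_def parity_def p_def)
      let ?R = "if p then {\<sigma> m} else {}"
      let ?b = "b(\<sigma> m := a m)"
      have "site_prod \<sigma> (Suc m) a = (\<epsilon> * koszul_sign M Q ?R) *\<^sub>C tens M (\<lambda>k. b k * (if k = \<sigma> m then a m else 1))"
        by (simp add: IH(2) site_tens_at[OF s] tens_mult_homog[OF IH(1) homog_site_at[OF s p]])
      also have "tens M (\<lambda>k. b k * (if k = \<sigma> m then a m else 1)) = tens M ?b"
        by (rule tens_cong) (simp add: b1)
      finally have 1: "site_prod \<sigma> (Suc m) a = (\<epsilon> * koszul_sign M Q ?R) *\<^sub>C tens M ?b" .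
      have 2: "homog M (parity_diff Q ?R) ?b"
      proof -
        have "(\<lambda>k. b k * (if k = \<sigma> m then a m else 1)) = ?b" by (auto simp: b1)
        then show ?thesis using homog_mult[OF IH(1) homog_site_at[OF s p]] by simp
      qed
      have v: "(\<Prod>j<M. \<omega> j (?b j)) = \<omega> (\<sigma> m) (a m) * (\<Prod>j<M. \<omega> j (b j))"
      proof -
        have "\<omega> (\<sigma> m) 1 = 1" using st by (simp add: is_state_def)
        then show ?thesis
          by (simp add: prod_upd[OF s] b1)
      qed
      have k: "koszul_sign M Q ?R * \<omega> (\<sigma> m) (a m) = \<omega> (\<sigma> m) (a m)"
        using even_state_odd[OF \<omega>] p by (cases p) (simp_all add: parity_def)
      have "\<epsilon> * koszul_sign M Q ?R * (\<Prod>j<M. \<omega> j (?b j)) =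
          (koszul_sign M Q ?R * \<omega> (\<sigma> m) (a m)) * (\<epsilon> * (\<Prod>j<M. \<omega> j (b j)))"
        unfolding v by (simp only: ac_simps)
      also have "\<dots> = (\<Prod>i<Suc m. \<omega> (\<sigma> i) (a i))"
        unfolding k IH(4) by (simp add: mult.commute)
      finally have 3: "\<epsilon> * koszul_sign M Q ?R * (\<Prod>j<M. \<omega> j (?b j)) = (\<Prod>i<Suc m. \<omega> (\<sigma> i) (a i))" .
      have 4: "\<forall>j. j \<notin> \<sigma> ` {..<Suc m} \<longrightarrow> ?b j = 1"
        using IH(3) by (auto simp: lessThan_Suc)
      show ?case using 1 2 3 4 by blast
    qed
    from this[OF order_refl] obtain Q b \<epsilon> where "site_prod \<sigma> n a = \<epsilon> *\<^sub>C tens M b"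
      "\<epsilon> * (\<Prod>j<M. \<omega> j (b j)) = (\<Prod>i<n. \<omega> (\<sigma> i) (a i))" by blast
    then show ?case
      by (simp add: relocate_tens product_functional_tens[OF st] lin)
  qed (simp_all add: relocate_simps lin)
qed

section \<open>Extension to the completion\<close>

lemma embed_add: "embed (a + b) = embed a + embed b"
  by transfer (rule cauchy_rel_const)

lemma embed_mult: "embed (a * b) = embed a * embed b"
  by transfer (rule cauchy_rel_const)

lemma embed_scaleC: "embed (c *\<^sub>C a) = c *\<^sub>C embed a"
  by transfer (rule cauchy_rel_const)

lemma embed_star: "embed (star a) = star (embed a)"
  by transfer (rule cauchy_rel_const)

lemma embed_one [simp]: "embed 1 = 1"
  by transfer (rule cauchy_rel_const)

lemma embed_zero [simp]: "embed 0 = 0"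
  by transfer (rule cauchy_rel_const)

lemma completion_closed_induct:
  assumes "closed {x. P x}" "\<And>a. P (embed a)"
  shows "P x"
proof -
  obtain X where X: "cauchy_rel X X" "x = abs_cstar_completion X" by (rule completion_cases)
  have "x \<in> {x. P x}"
    by (rule closed_sequentially[OF assms(1), where f = "\<lambda>n. embed (X n)"])
      (use assms(2) embed_LIMSEQ[OF X(1)] X(2) in auto)
  then show ?thesis by simp
qed

lemma completion_continuous_eq:
  fixes f g :: "'a::pre_cstar_algebra cstar_completion \<Rightarrow> 'b::t2_space"
  assumes "continuous_on UNIV f" "continuous_on UNIV g" "\<And>a. f (embed a) = g (embed a)"
  shows "f = g"
  by (rule ext, rule completion_closed_induct) (auto intro: closed_Collect_eq assms)

text \<open>\<open>embed\<close> may have a kernel, but the bound makes \<open>T\<close> constant on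
  its fibres. The induced map on the dense range is Lipschitz, hence uniformly continuous, and
  extends to the closure.\<close>

lemma completion_extend:
  fixes T :: "'a::pre_cstar_algebra \<Rightarrow> 'b::banach"
  assumes T: "\<And>x y. T (x - y) = T x - T y" and K: "0 \<le> K" "\<And>x. norm (T x) \<le> K * cstar_seminorm x"
  obtains T' where "continuous_on UNIV T'" "\<And>a. T' (embed a) = T a"
proof -
  have eq: "T a = T b" if "embed a = embed b" for a b
  proof -
    have "cstar_seminorm (a - b) = 0" using that by (simp add: embed_diff flip: norm_embed)
    then show ?thesis using K(2)[of "a - b"] by (simp add: T)
  qed
  define f where "f x = T (SOME a. x = embed a)" for x
  have f: "f (embed a) = T a" for a
    unfolding f_def by (rule eq) (metis (mono_tags, lifting) someI)
  have "K-lipschitz_on (range embed) f"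
  proof (rule lipschitz_onI)
    fix x y :: "'a cstar_completion" assume "x \<in> range embed" "y \<in> range embed"
    then obtain a b where "x = embed a" "y = embed b" by blast
    then show "dist (f x) (f y) \<le> K * dist x y"
      using K(2)[of "a - b"] by (simp add: f dist_norm T embed_diff flip: norm_embed)
  qed (rule K(1))
  then have "uniformly_continuous_on (range embed) f"
    by (rule lipschitz_on_uniformly_continuous)
  then obtain g where g: "uniformly_continuous_on (closure (range embed)) g" "\<And>x. x \<in> range embed \<Longrightarrow> f x = g x"
    by (rule uniformly_continuous_on_extension_on_closure) blast
  have "x \<in> closure (range embed)" for x :: "'a cstar_completion"
    by (rule completion_closed_induct) (auto intro: closure_subset[THEN subsetD])
  then have "closure (range embed) = (UNIV :: 'a cstar_completion set)" by blast
  then have "continuous_on UNIV g" using g(1) uniformly_continuous_imp_continuous by metis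
  moreover have "g (embed a) = T a" for a using g(2)[of "embed a"] f by simp
  ultimately show ?thesis using that by blast
qed

lemma continuous_on_scaleC [continuous_intros]:
  fixes f :: "'b::topological_space \<Rightarrow> 'a::cstar_algebra"
  assumes "continuous_on S f"
  shows "continuous_on S (\<lambda>x. c *\<^sub>C f x)"
proof -
  have "bounded_linear (\<lambda>x. c *\<^sub>C x :: 'a)"
    by (rule bounded_linear_intro[where K = "cmod c"])
      (simp_all add: scaleC_add_right scaleR_scaleC norm_scaleC mult.commute)
  then show ?thesis using assms by (rule bounded_linear.continuous_on)
qed

lemma continuous_on_star [continuous_intros]:
  "continuous_on S f \<Longrightarrow> continuous_on S (\<lambda>x. star (f x) :: 'a::cstar_algebra)"
  by (rule bounded_linear.continuous_on[OF bounded_linear_star])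

text \<open>The target type covers both \<open>complex\<close> and C*-algebras, with continuity of
  scaling as a hypothesis. Additivity follows by density in one argument at a time.\<close>

lemma completion_clinear:
  fixes f :: "'a::pre_cstar_algebra cstar_completion \<Rightarrow> 'b::{complex_vector, real_normed_vector}"
  assumes f: "continuous_on UNIV f" and "clinear (\<lambda>a. f (embed a))"
    and "\<And>c. continuous_on UNIV (\<lambda>y::'b. c *\<^sub>C y)"
  shows "clinear f"
proof -
  note lin = clinearD(1,2)[OF assms(2)]
  note cont = continuous_on_compose2[OF f] continuous_on_compose2[OF assms(3)]
  have 1: "f (embed a + y) = f (embed a) + f y" for a y
    by (rule completion_closed_induct[where x = y], intro closed_Collect_eq continuous_intros cont)
      (auto simp: lin simp flip: embed_add)
  have "f (x + y) = f x + f y" for x y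
    by (rule completion_closed_induct[where x = x], intro closed_Collect_eq continuous_intros cont)
      (auto simp: 1)
  moreover have "f (c *\<^sub>C x) = c *\<^sub>C f x" for c x
    by (rule completion_closed_induct[where x = x], intro closed_Collect_eq continuous_intros cont)
      (auto simp: lin simp flip: embed_scaleC)
  ultimately show ?thesis by (simp add: clinear_def)
qed

text \<open>The nonnegative reals are closed, so positivity passes from the dense algebraic part to
  the completion.\<close>

lemma completion_pos_fun:
  fixes f :: "'a::pre_cstar_algebra cstar_completion \<Rightarrow> complex"
  assumes f: "continuous_on UNIV f" and pos: "pos_fun (\<lambda>a. f (embed a))"
  shows "pos_fun f"
proof -
  have "clinear f"
    by (rule completion_clinear[OF f]) (use pos in \<open>auto simp: pos_fun_def intro!: continuous_intros\<close>)
  moreover have "closed {x. f (star x * x) \<in> \<real>\<^sub>\<ge>\<^sub>0}"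
  proof -
    have "continuous_on UNIV (\<lambda>x. f (star x * x))"
      by (intro continuous_intros continuous_on_compose2[OF f]) auto
    from closed_vimage[OF closed_nonneg_Reals_complex this] show ?thesis by (simp add: vimage_def)
  qed
  then have "f (star x * x) \<in> \<real>\<^sub>\<ge>\<^sub>0" for x
    by (rule completion_closed_induct)
      (use pos in \<open>simp add: pos_fun_def flip: embed_star embed_mult\<close>)
  ultimately show ?thesis by (simp add: pos_fun_def)
qed

lemma completion_star_hom:
  fixes f :: "'a::pre_cstar_algebra cstar_completion \<Rightarrow> 'b::cstar_algebra"
  assumes f: "continuous_on UNIV f"
    and "\<And>a b. f (embed (a * b)) = f (embed a) * f (embed b)"
    and "\<And>a. f (embed (star a)) = star (f (embed a))"
  shows "f (x * y) = f x * f y" and "f (star x) = star (f x)"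
proof -
  note cont = continuous_on_compose2[OF f]
  have 1: "f (embed a * y) = f (embed a) * f y" for a y
    by (rule completion_closed_induct[where x = y], intro closed_Collect_eq continuous_intros cont)
      (auto simp: assms simp flip: embed_mult)
  show "f (x * y) = f x * f y"
    by (rule completion_closed_induct[where x = x], intro closed_Collect_eq continuous_intros cont)
      (auto simp: 1)
  show "f (star x) = star (f x)"
    by (rule completion_closed_induct[where x = x], intro closed_Collect_eq continuous_intros cont)
      (auto simp: assms simp flip: embed_star)
qed

section \<open>States\<close>

lemma gns_seminorm_le_norm:
  fixes \<phi> :: "'a::cstar_algebra \<Rightarrow> complex"
  assumes "is_state \<phi>"
  shows "gns_seminorm \<phi> x \<le> norm x"
  using pos_fun_bound[OF is_state_pos_fun[OF assms], of x] assms
  by (simp add: gns_seminorm_def is_state_def real_le_lsqrt)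

lemma state_norm_le_gns_seminorm:
  assumes "is_state \<phi>"
  shows "cmod (\<phi> x) \<le> gns_seminorm \<phi> x"
  using pos_fun_CS[OF is_state_pos_fun[OF assms], of 1 x] assms
  by (simp add: is_state_def gns_seminorm_def[of _ 1])

lemma state_norm_le:
  fixes \<phi> :: "'a::cstar_algebra \<Rightarrow> complex"
  assumes "is_state \<phi>"
  shows "cmod (\<phi> x) \<le> norm x"
  using state_norm_le_gns_seminorm[OF assms] gns_seminorm_le_norm[OF assms] order_trans by blast

lemma state_continuous:
  fixes \<phi> :: "'a::cstar_algebra \<Rightarrow> complex"
  assumes "is_state \<phi>"
  shows "continuous_on UNIV \<phi>"
proof -
  have "1-lipschitz_on UNIV \<phi>"
  proof (rule lipschitz_onI)
    fix x y
    have "\<phi> x - \<phi> y = \<phi> (x - y)" using assms clinearD(5) by (metis is_state_def)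
    then show "dist (\<phi> x) (\<phi> y) \<le> 1 * dist x y"
      using state_norm_le[OF assms, of "x - y"] by (simp add: dist_norm)
  qed simp
  then show ?thesis by (rule lipschitz_on_continuous_on)
qed

section \<open>The action of the permutations\<close>

text \<open>Relocation transfers the permutation to the indices of the product state. The bound
  ranges over all families of even states and all \<open>y\<close>, and both ranges are stable under
  permutations.\<close>

lemma gns_bound_relocate:
  fixes x :: "'a::graded_cstar_algebra fermi_alg"
  assumes \<sigma>: "bij \<sigma>" and "gns_bound C x"
  shows "gns_bound C (relocate \<sigma> x)"
  unfolding gns_bound_def
proof (intro conjI allI impI)
  show "0 \<le> C" using assms(2) by (simp add: gns_bound_def)
  fix \<omega> :: "nat \<Rightarrow> 'a \<Rightarrow> complex" and y :: "'a fermi_alg" assume \<omega>: "\<forall>i. even_state (\<omega> i)"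
  have inj: "inj \<sigma>" using \<sigma> by (rule bij_is_inj)
  have q: "gns_seminorm (product_functional \<omega>) (relocate \<sigma> z) =
      gns_seminorm (product_functional (\<lambda>i. \<omega> (\<sigma> i))) z" for z
    using \<omega> by (simp add: gns_seminorm_def product_functional_relocate inj
        flip: relocate_mult[OF inj] relocate_star[OF inj])
  define y' where "y' = relocate (inv \<sigma>) y"
  have "y = relocate \<sigma> y'"
    using relocate_id[of y] \<sigma> by (simp add: y'_def relocate_relocate inj bij_is_surj surj_f_inv_f)
  then show "gns_seminorm (product_functional \<omega>) (relocate \<sigma> x * y) \<le> C * gns_seminorm (product_functional \<omega>) y"
    using assms(2) \<omega> by (simp add: q gns_bound_def flip: relocate_mult[OF inj])
qed

lemma relocate_inv: "bij \<sigma> \<Longrightarrow> relocate \<sigma> (relocate (inv \<sigma>) x) = x" "bij \<sigma> \<Longrightarrow> relocate (inv \<sigma>) (relocate \<sigma> x) = x"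
  using relocate_id[of x]
  by (simp_all add: relocate_relocate bij_is_inj bij_is_surj surj_f_inv_f bij_imp_bij_inv)

lemma seminorm_relocate:
  assumes "bij \<sigma>"
  shows "cstar_seminorm (relocate \<sigma> x) = cstar_seminorm x"
proof -
  have le: "fermi_norm (relocate \<tau> y) \<le> fermi_norm y" if "bij \<tau>" for \<tau> y
    by (rule fermi_norm_least[OF gns_bound_relocate[OF that fermi_norm_bound]])
  show ?thesis
    using le[OF assms, of x] le[OF bij_imp_bij_inv[OF assms], of "relocate \<sigma> x"]
    by (simp add: cstar_seminorm_fermi_alg_def relocate_inv[OF assms])
qed

lemma relocate_extend:
  assumes "bij \<sigma>"
  obtains f :: "'a::graded_cstar_algebra fermi_inf \<Rightarrow> 'a fermi_inf"
  where "continuous_on UNIV f" "\<And>x. f (embed x) = embed (relocate \<sigma> x)"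
  by (rule completion_extend[of "\<lambda>x. embed (relocate \<sigma> x) :: 'a fermi_inf" 1])
    (auto simp: relocate_simps embed_diff norm_embed seminorm_relocate[OF assms])

lemma relocate_automorphism:
  fixes f :: "'a::graded_cstar_algebra fermi_inf \<Rightarrow> 'a fermi_inf"
  assumes \<sigma>: "bij \<sigma>" and f: "continuous_on UNIV f" "\<And>x. f (embed x) = embed (relocate \<sigma> x)"
  shows "star_automorphism f"
proof -
  have inj: "inj \<sigma>" using \<sigma> by (rule bij_is_inj)
  obtain g :: "'a fermi_inf \<Rightarrow> 'a fermi_inf"
    where g: "continuous_on UNIV g" "\<And>x. g (embed x) = embed (relocate (inv \<sigma>) x)"
    using relocate_extend[OF bij_imp_bij_inv[OF \<sigma>]] by blast
  \<comment> \<open>The extension for the inverse permutation is a two-sided inverse of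
    \<open>f\<close>, since it is one on the dense part.\<close>
  have "(\<lambda>x. f (g x)) = (\<lambda>x. x)" "(\<lambda>x. g (f x)) = (\<lambda>x. x)"
    by (rule completion_continuous_eq; auto intro!: continuous_intros
        continuous_on_compose2[OF f(1)] continuous_on_compose2[OF g(1)] f(1) g(1)
        simp: f(2) g(2) relocate_inv[OF \<sigma>])+
  then have "bij f" by (intro o_bij[of g]) (auto simp: fun_eq_iff)
  moreover have "clinear f"
    by (rule completion_clinear[OF f(1)])
      (auto simp: f(2) clinear_def embed_add embed_scaleC relocate_simps intro!: continuous_intros)
  moreover have "f (x * y) = f x * f y" "f (star x) = star (f x)" for x y
    using completion_star_hom[OF f(1)]
    by (simp_all add: f(2) relocate_mult[OF inj] relocate_star[OF inj] flip: embed_mult embed_star)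
  ultimately show ?thesis by (simp add: star_automorphism_def)
qed

lemma star_automorphism_one:
  assumes "star_automorphism f"
  shows "f 1 = 1"
proof -
  obtain x where "f x = 1" using assms by (metis bij_pointE star_automorphism_def)
  then show ?thesis using assms by (metis mult.right_neutral star_automorphism_def mult.left_neutral)
qed

text \<open>Resolves the \<open>THE\<close> in \<open>perm_action\<close>: a candidate preserves 1
  and products, so its values on the sites fix it on every level, and continuity fixes it on the
  completion.\<close>

lemma perm_action_eqI:
  fixes f :: "'a::graded_cstar_algebra fermi_inf \<Rightarrow> 'a fermi_inf"
  assumes \<sigma>: "bij \<sigma>" and f: "continuous_on UNIV f" "\<And>x. f (embed x) = embed (relocate \<sigma> x)"
  shows "perm_action \<sigma> = f"
  unfolding perm_action_def
proof (rule the_equality)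
  show "star_automorphism f \<and> continuous_on UNIV f \<and> (\<forall>j a. f (fermi_site j a) = fermi_site (\<sigma> j) a)"
    using relocate_automorphism[OF assms] f by (simp add: fermi_site_def)
  fix g :: "'a fermi_inf \<Rightarrow> 'a fermi_inf"
  assume g: "star_automorphism g \<and> continuous_on UNIV g \<and> (\<forall>j a. g (fermi_site j a) = fermi_site (\<sigma> j) a)"
  then have lin: "clinear g" and mult: "g (x * y) = g x * g y" for x y by (auto simp: star_automorphism_def)
  have one: "g 1 = 1" using g star_automorphism_one by blast
  have "g (embed x) = embed (relocate \<sigma> x)" for x
  proof -
    obtain n where "x \<in> fermi_level n" using fermi_level_ex by blast
    then show ?thesis
      by (induction n x rule: fermi_level_induct)
        (use g in \<open>simp_all add: embed_add embed_scaleC embed_mult clinearD[OF lin] relocate_simps mult one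
          relocate_snoc fermi_site_def\<close>)
  qed
  then show "g = f" by (intro completion_continuous_eq) (use f g in auto)
qed

lemma perm_action:
  fixes x :: "'a::graded_cstar_algebra fermi_alg"
  assumes "bij \<sigma>"
  shows perm_action_embed [simp]: "perm_action \<sigma> (embed x) = embed (relocate \<sigma> x)"
    and perm_action_continuous: "continuous_on UNIV (perm_action \<sigma> :: 'a fermi_inf \<Rightarrow> 'a fermi_inf)"
    and perm_action_automorphism: "star_automorphism (perm_action \<sigma> :: 'a fermi_inf \<Rightarrow> 'a fermi_inf)"
proof -
  obtain f :: "'a fermi_inf \<Rightarrow> 'a fermi_inf"
    where f: "continuous_on UNIV f" "\<And>x. f (embed x) = embed (relocate \<sigma> x)"
    using relocate_extend[OF assms] by blast
  show "continuous_on UNIV (perm_action \<sigma> :: 'a fermi_inf \<Rightarrow> 'a fermi_inf)"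
    "star_automorphism (perm_action \<sigma> :: 'a fermi_inf \<Rightarrow> 'a fermi_inf)"
    using perm_action_eqI[OF assms f] f(1) relocate_automorphism[OF assms f] by simp_all
  show "perm_action \<sigma> (embed x) = embed (relocate \<sigma> x)"
    using perm_action_eqI[OF assms f] f(2) by simp
qed

lemma norm_perm_action:
  assumes "bij \<sigma>"
  shows "norm (perm_action \<sigma> x) = norm x"
  by (rule completion_closed_induct,
      intro closed_Collect_eq continuous_intros perm_action_continuous[OF assms])
    (simp add: assms norm_embed seminorm_relocate)

section \<open>Infinite product states\<close>

lemma states_eqI:
  fixes \<phi> \<psi> :: "'a::graded_cstar_algebra fermi_inf \<Rightarrow> complex"
  assumes "is_state \<phi>" "is_state \<psi>" "\<And>x. \<phi> (embed x) = \<psi> (embed x)"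
  shows "\<phi> = \<psi>"
  by (rule completion_continuous_eq) (use assms state_continuous in auto)

lemma clinear_elem_tensor_eqI:
  fixes f g :: "'a::graded_cstar_algebra fermi_alg \<Rightarrow> 'b::complex_vector"
  assumes f: "clinear f" and g: "clinear g" and "\<And>as. f (elem_tensor as) = g (elem_tensor as)"
  shows "f x = g x"
proof -
  obtain s where x: "x = (\<Sum>(c, as)\<leftarrow>s. c *\<^sub>C elem_tensor as)" by (metis fermi_alg_cases abs_fermi_alg_sum)
  show ?thesis unfolding x by (induction s) (auto simp: clinearD[OF f] clinearD[OF g] assms(3))
qed

lemma clinear_embed: "clinear \<phi> \<Longrightarrow> clinear (\<lambda>x. \<phi> (embed x))"
  by (simp add: clinear_def embed_add embed_scaleC)

text \<open>States are continuous and elementary tensors span a dense subspace, so the values on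
  them leave only one state.\<close>

lemma inf_product_state_eqI:
  assumes "is_state \<phi>" "\<And>as. \<phi> (embed (elem_tensor as)) = prod_list (map \<rho> as)"
  shows "inf_product_state \<rho> = \<phi>"
  unfolding inf_product_state_def
proof (rule the_equality)
  show "is_state \<phi> \<and> (\<forall>as. \<phi> (embed (elem_tensor as)) = prod_list (map \<rho> as))" using assms by simp
  fix \<psi> assume \<psi>: "is_state \<psi> \<and> (\<forall>as. \<psi> (embed (elem_tensor as)) = prod_list (map \<rho> as))"
  show "\<psi> = \<phi>"
  proof (rule states_eqI)
    show "\<psi> (embed x) = \<phi> (embed x)" for x
      by (rule clinear_elem_tensor_eqI) (use \<psi> assms in \<open>auto simp: is_state_def intro: clinear_embed\<close>)
  qed (use \<psi> assms in auto)
qed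

text \<open>Apply the GNS bound to the class of 1, which has seminorm 1.\<close>

lemma product_functional_le:
  assumes "\<And>i. even_state (\<omega> i)"
  shows "cmod (product_functional \<omega> x) \<le> cstar_seminorm x"
proof -
  have st: "is_state (product_functional \<omega>)" by (rule product_functional_state[OF assms])
  have "gns_seminorm (product_functional \<omega>) (x * 1) \<le> fermi_norm x * gns_seminorm (product_functional \<omega>) 1"
    using fermi_norm_bound[of x] assms unfolding gns_bound_def by blast
  moreover have "gns_seminorm (product_functional \<omega>) 1 = 1"
    using st by (simp add: gns_seminorm_def is_state_def)
  ultimately show ?thesis
    using state_norm_le_gns_seminorm[OF st, of x] by (simp add: cstar_seminorm_fermi_alg_def)
qed

text \<open>Existence: the product functional is positive and dominated by the minimal norm, so it
  extends to a state on the completion.\<close>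

lemma inf_product_state:
  assumes \<rho>: "even_state (\<rho> :: 'a::graded_cstar_algebra \<Rightarrow> complex)"
  shows "is_state (inf_product_state \<rho>)"
    and "inf_product_state \<rho> (embed (elem_tensor as)) = prod_list (map \<rho> as)"
proof -
  let ?T = "product_functional (\<lambda>_. \<rho>)"
  have T: "is_state ?T" by (rule product_functional_state[OF \<rho>])
  then have lin: "clinear ?T" by (simp add: is_state_def)
  obtain f where f: "continuous_on UNIV f" "\<And>x. f (embed x) = ?T x"
    by (rule completion_extend[of ?T 1]) (auto simp: clinearD[OF lin] product_functional_le \<rho>)
  have "pos_fun f" by (rule completion_pos_fun[OF f(1)]) (simp add: f(2) is_state_pos_fun[OF T])
  moreover have "f 1 = 1" using f(2)[of 1] T by (simp add: is_state_def)
  ultimately have 1: "is_state f" by (simp add: pos_fun_def is_state_def)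
  have 2: "f (embed (elem_tensor as)) = prod_list (map \<rho> as)" for as
    unfolding f(2) elem_tensor_tens using even_state_is_state[OF \<rho>]
    by (subst product_functional_tens) (auto simp: entry_def prod.list_conv_set_nth atLeast0LessThan)
  have "inf_product_state \<rho> = f" using 1 2 by (rule inf_product_state_eqI)
  then show "is_state (inf_product_state \<rho>)" "inf_product_state \<rho> (embed (elem_tensor as)) = prod_list (map \<rho> as)"
    using 1 2 by auto
qed

section \<open>Symmetric states\<close>

lemma finite_perm_bij: "finite_perm \<sigma> \<Longrightarrow> bij \<sigma>"
  by (simp add: finite_perm_def)

lemma finite_perm_swap: "finite_perm (id(n := N, N := n))"
proof -
  have "bij (id(n := N, N := n))"
    by (rule o_bij[of "id(n := N, N := n)"]) (auto simp: fun_eq_iff)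
  moreover have "{k. (id(n := N, N := n)) k \<noteq> k} \<subseteq> {n, N}" by auto
  ultimately show ?thesis
    unfolding finite_perm_def by (meson finite.emptyI finite_insert finite_subset)
qed

text \<open>Stated for \<open>Suc m\<close>, where the blocks have length \<open>2 ^ m\<close>. The
  map \<open>block_swap 0\<close> is not even injective, because \<open>0 - 1 = 0\<close> in the
  naturals.\<close>

lemma block_swap_low: "k < 2 ^ m \<Longrightarrow> block_swap (Suc m) k = 2 ^ m + k"
  by (simp add: block_swap_def)

lemma block_swap_involution: "block_swap (Suc m) (block_swap (Suc m) k) = k"
  by (auto simp: block_swap_def)

lemma finite_perm_block_swap: "finite_perm (block_swap (Suc m))"
proof -
  have "bij (block_swap (Suc m))"
    by (rule o_bij[of "block_swap (Suc m)"]) (auto simp: fun_eq_iff block_swap_involution)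
  moreover have "{k. block_swap (Suc m) k \<noteq> k} \<subseteq> {..<2 ^ Suc m}"
    by (auto simp: block_swap_def split: if_splits)
  ultimately show ?thesis
    unfolding finite_perm_def by (meson finite_lessThan finite_subset)
qed

section \<open>Symmetric states on the algebraic part\<close>

lemma symmetric_state_is_state: "symmetric_state \<omega> \<Longrightarrow> is_state \<omega>"
  by (simp add: symmetric_state_def)

lemma symmetric_relocate:
  assumes "symmetric_state \<omega>" "finite_perm \<sigma>"
  shows "\<omega> (embed (relocate \<sigma> x)) = \<omega> (embed x)"
  using assms perm_action_embed[OF finite_perm_bij[OF assms(2)], of x]
  by (metis symmetric_state_def)

lemma state_embed:
  assumes "is_state (\<omega> :: 'a::pre_cstar_algebra cstar_completion \<Rightarrow> complex)"
  shows "is_state (\<lambda>x. \<omega> (embed x))"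
  using assms by (auto simp: is_state_def clinear_embed clinear_def embed_add embed_scaleC embed_mult embed_star)

text \<open>The transposition of \<open>n\<close> and \<open>N\<close> fixes \<open>x\<close>, which
  involves only sites below \<open>n\<close>, and carries \<open>site n a\<close> to
  \<open>site N a\<close>.\<close>

lemma symmetric_site_shift:
  assumes \<omega>: "symmetric_state \<omega>" and x: "x \<in> fermi_level n" and "n \<le> N"
  shows "\<omega> (embed (x * site N a)) = \<omega> (embed (x * site n a))"
proof -
  let ?\<sigma> = "id(n := N, N := n)"
  have "relocate ?\<sigma> x = x"
    using relocate_cong[OF x, of ?\<sigma> "\<lambda>i. i"] \<open>n \<le> N\<close> by (simp add: relocate_id)
  then have "relocate ?\<sigma> (x * site n a) = x * site N a"
    by (simp add: relocate_snoc[OF x])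
  then show ?thesis using symmetric_relocate[OF \<omega> finite_perm_swap, of n N "x * site n a"] by simp
qed

lemma symmetric_site:
  assumes "symmetric_state \<omega>"
  shows "\<omega> (embed (site j a)) = \<omega> (embed (site 0 a))"
  using symmetric_site_shift[OF assms fermi_level_one[of 0], of j a] by simp

text \<open>The end of both averaging arguments: on a sum of \<open>m\<close> translates a
  functional grows like \<open>m\<close>, while the GNS seminorm of the sum grows only like the
  square root of \<open>m\<close>.\<close>

lemma quadratic_le_linear_imp_zero:
  fixes c d :: real
  assumes "\<And>m::nat. (real m * c)\<^sup>2 \<le> real m * d"
  shows "c = 0"
proof (rule ccontr)
  assume "c \<noteq> 0"
  then have c: "0 < c\<^sup>2" by simp
  obtain m :: nat where m: "d / c\<^sup>2 < real m" using reals_Archimedean2 by blast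
  have "0 \<le> d" using assms[of 1] order_trans[OF zero_le_power2] by simp
  then have m0: "0 < real m" using m c by (meson divide_nonneg_pos le_less_trans)
  have "real m * (real m * c\<^sup>2) \<le> real m * d"
    using assms[of m] by (simp add: power2_eq_square mult_ac)
  then have "real m * c\<^sup>2 \<le> d" using m0 by simp
  then show False using m c by (simp add: divide_less_eq)
qed

text \<open>Odd elements at distinct sites anticommute, so of the \<open>m ^ 2\<close> terms only
  the \<open>m\<close> diagonal ones survive.\<close>

lemma anticommutator_sum:
  fixes a :: "'a::graded_cstar_algebra" and n :: nat
  assumes a: "parity True a"
  defines "A \<equiv> \<lambda>m. \<Sum>j<m. site (n + j) a"
  shows "star (A m) * A m + A m * star (A m) = (\<Sum>j<m. site (n + j) (star a * a + a * star a))"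
proof -
  have a': "parity True (star a)" using a by (simp add: parity_def grading_star)
  have c: "site (n + i) (star a) * site (n + j) a + site (n + j) a * site (n + i) (star a) =
      (if i = j then site (n + j) (star a * a + a * star a) else 0)" for i j
    using site_commute[of "n + i" "n + j" True "star a" True a] a a'
    by (auto simp: clinearD[OF site_clinear] site_mult)
  have "star (A m) * A m = (\<Sum>i<m. \<Sum>j<m. site (n + i) (star a) * site (n + j) a)"
    by (simp add: A_def star_sum site_star sum_product)
  moreover have "A m * star (A m) = (\<Sum>i<m. \<Sum>j<m. site (n + j) a * site (n + i) (star a))"
    unfolding A_def star_sum site_star sum_product by (rule sum.swap)
  ultimately show ?thesis
    by (simp add: c flip: sum.distrib)
qed

text \<open>The averages of an odd element over \<open>m\<close> sites have anticommutators of norm \<open>O(1/m)\<close>.\<close>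

lemma symmetric_odd_vanish:
  assumes \<omega>: "symmetric_state \<omega>" and x: "x \<in> fermi_level n" and a: "parity True a"
  shows "\<omega> (embed (x * site n a)) = 0"
proof -
  let ?\<tau> = "\<lambda>x. \<omega> (embed x)"
  have pos: "pos_fun ?\<tau>" using state_embed[OF symmetric_state_is_state[OF \<omega>]] by (rule is_state_pos_fun)
  then have lin: "clinear ?\<tau>" by (simp add: pos_fun_def)
  have shift: "?\<tau> (x * site (n + j) a) = ?\<tau> (x * site n a)"
    and shift0: "?\<tau> (site (n + j) b) = ?\<tau> (site 0 b)" for j b
    using symmetric_site_shift[OF \<omega> x, of "n + j" a] symmetric_site[OF \<omega>, of "n + j" b] by simp_all
  define A where "A m = (\<Sum>j<m. site (n + j) a)" for m
  define g where "g = gns_seminorm ?\<tau> (star x)"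
  define c where "c = Re (?\<tau> (site 0 (star a * a + a * star a)))"
  have "(real m * cmod (?\<tau> (x * site n a)))\<^sup>2 \<le> real m * (g\<^sup>2 * c)" for m
  proof -
    \<comment> \<open>By symmetry all \<open>m\<close> summands have the same value.\<close>
    have "?\<tau> (x * A m) = of_nat m * ?\<tau> (x * site n a)"
      by (simp add: A_def sum_distrib_left clinear_sum[OF lin] shift)
    then have "real m * cmod (?\<tau> (x * site n a)) = cmod (?\<tau> (star (star x) * A m))"
      by (simp add: norm_mult)
    also have "\<dots> \<le> g * gns_seminorm ?\<tau> (A m)"
      unfolding g_def by (rule pos_fun_CS[OF pos])
    finally have "(real m * cmod (?\<tau> (x * site n a)))\<^sup>2 \<le> (g * gns_seminorm ?\<tau> (A m))\<^sup>2"
      by (rule power_mono) simp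
    also have "\<dots> = g\<^sup>2 * Re (?\<tau> (star (A m) * A m))"
      by (simp only: power_mult_distrib gns_seminorm_sq[OF pos])
    also have "\<dots> \<le> g\<^sup>2 * (real m * c)"
    proof (rule mult_left_mono)
      \<comment> \<open>Adding the nonnegative value at \<open>A m * star (A m)\<close> completes
        the anticommutator, whose value is linear in \<open>m\<close>.\<close>
      have "Re (?\<tau> (star (A m) * A m)) \<le> Re (?\<tau> (star (A m) * A m + A m * star (A m)))"
        using pos_fun_nonneg(1)[OF pos, of "star (A m)"] by (simp add: clinearD[OF lin])
      also have "\<dots> = real m * c"
        unfolding A_def anticommutator_sum[OF a] clinear_sum[OF lin] by (simp add: shift0 c_def)
      finally show "Re (?\<tau> (star (A m) * A m)) \<le> real m * c" .
    qed simp
    finally show ?thesis by (simp add: mult_ac)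
  qed
  from quadratic_le_linear_imp_zero[OF this] show ?thesis by simp
qed

section \<open>Factorizing states\<close>

definition factorizing :: "('a::graded_cstar_algebra fermi_inf \<Rightarrow> complex) \<Rightarrow> bool" where
  "factorizing \<omega> \<longleftrightarrow> (\<forall>n. \<forall>x\<in>fermi_level n. \<forall>a.
    \<omega> (embed (x * site n a)) = \<omega> (embed x) * \<omega> (embed (site 0 a)))"

lemma elem_tensor_snoc: "elem_tensor (as @ [a]) = elem_tensor as * site (length as) a"
proof -
  have "tens (length as) (entry (as @ [a])) = tens (length as) (entry as)"
    by (rule tens_cong) (simp add: entry_def nth_append)
  then show ?thesis by (simp add: elem_tensor_tens tens_Suc_mult) (simp add: entry_def)
qed

lemma fermi_level_elem_tensor: "elem_tensor as \<in> fermi_level (length as)"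
  unfolding elem_tensor_tens by (rule fermi_level_tens)

text \<open>\<open>\<rho>\<close> is the restriction to the first site. The product formula comes
  from factorization, appending one entry at a time; evenness comes from symmetry, since odd
  elements have value 0.\<close>

lemma factorizing_product_state:
  assumes \<omega>: "symmetric_state \<omega>" and f: "factorizing \<omega>"
  defines "\<rho> \<equiv> \<lambda>a. \<omega> (embed (site 0 a))"
  shows "even_state \<rho>" and "\<omega> = inf_product_state \<rho>"
proof -
  have st: "is_state \<omega>" using \<omega> by (rule symmetric_state_is_state)
  have lin: "clinear \<rho>"
    using st by (simp add: is_state_def clinear_def \<rho>_def clinearD[OF site_clinear] embed_add embed_scaleC)
  have "\<rho> (star a * a) \<in> \<real>\<^sub>\<ge>\<^sub>0" for a
    using st by (simp add: \<rho>_def is_state_def site_mult embed_mult embed_star flip: site_star)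
  then have "is_state \<rho>" using lin st by (simp add: is_state_def \<rho>_def)
  moreover have "\<rho> (grading a) = \<rho> a" for a
  proof -
    have odd: "\<rho> (graded_part True a) = 0"
      using symmetric_odd_vanish[OF \<omega> fermi_level_one[of 0] parity_graded_part[of True a]]
      by (simp add: \<rho>_def)
    have "\<rho> a = \<rho> (graded_part False a + graded_part True a)" by (simp add: graded_part_sum)
    moreover have "\<rho> (grading a) = \<rho> (grading (graded_part False a + graded_part True a))"
      by (simp add: graded_part_sum)
    ultimately show ?thesis
      by (simp add: grading_add grading_graded_part clinearD[OF lin] odd)
  qed
  ultimately show "even_state \<rho>" by (simp add: even_state_def)
  have "\<omega> (embed (elem_tensor as)) = prod_list (map \<rho> as)" for as
  proof (induction as rule: rev_induct)
    case Nil
    show ?case using st by (simp add: is_state_def flip: one_fermi_alg_def)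
  next
    case (snoc a as)
    then show ?case
      using f fermi_level_elem_tensor[of as] by (simp add: elem_tensor_snoc factorizing_def \<rho>_def)
  qed
  from inf_product_state_eqI[OF st this] show "\<omega> = inf_product_state \<rho>" by simp
qed

lemma product_state_factorizing:
  assumes \<rho>: "even_state \<rho>"
  shows "factorizing (inf_product_state \<rho>)"
  unfolding factorizing_def
proof (intro allI ballI)
  fix n a and x :: "'a fermi_alg"
  let ?\<omega> = "inf_product_state \<rho>"
  have lin: "clinear ?\<omega>" using inf_product_state(1)[OF \<rho>] by (simp add: is_state_def)
  note elem = inf_product_state(2)[OF \<rho>]
  have \<rho>a: "?\<omega> (embed (site 0 a)) = \<rho> a"
    using elem[of "[a]"] by (simp add: site_def)
  assume "x \<in> fermi_level n"
  then show "?\<omega> (embed (x * site n a)) = ?\<omega> (embed x) * ?\<omega> (embed (site 0 a))"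
  proof (induction x rule: fermi_level_homog_induct)
    case (tens P f)
    have "tens n f * site n a = elem_tensor (map f [0..<n] @ [a])"
      by (simp add: elem_tensor_snoc tens_def)
    then show ?case using elem[of "map f [0..<n] @ [a]"] elem[of "map f [0..<n]"]
      by (simp add: \<rho>a tens_def[of n f])
  qed (simp_all add: distrib_right embed_add embed_scaleC clinearD[OF lin])
qed

text \<open>\<open>\<sigma>\<close> moves the \<open>k\<close> sites of \<open>y\<close> to directly
  behind the \<open>N\<close> sites of \<open>x\<close>. Building up \<open>y\<close> site by site,
  each new site follows everything before it, so the one-step rule applies both to
  \<open>x * relocate \<sigma> y\<close> and to \<open>y\<close>.\<close>

lemma factorizing_shift:
  assumes f: "factorizing \<omega>" and \<omega>: "is_state \<omega>" and x: "x \<in> fermi_level N"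
    and "y \<in> fermi_level k" "\<And>i. i < k \<Longrightarrow> \<sigma> i = N + i"
  shows "\<omega> (embed (x * relocate \<sigma> y)) = \<omega> (embed x) * \<omega> (embed y)"
proof -
  have lin: "clinear \<omega>" using \<omega> by (simp add: is_state_def)
  show ?thesis using assms(4,5)
  proof (induction k y rule: fermi_level_induct)
    case (step n y c)
    have "relocate \<sigma> y \<in> fermi_level (N + n)"
      by (rule relocate_level[OF step(1)]) (simp add: step.prems)
    then have "x * relocate \<sigma> y \<in> fermi_level (N + n)"
      using fermi_level_mono[OF _ x] by (intro fermi_level_mult) simp_all
    moreover have "x * relocate \<sigma> (y * site n c) = x * relocate \<sigma> y * site (N + n) c"
      by (simp add: relocate_snoc[OF step(1)] step.prems mult.assoc)
    ultimately have "\<omega> (embed (x * relocate \<sigma> (y * site n c))) =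
        \<omega> (embed (x * relocate \<sigma> y)) * \<omega> (embed (site 0 c))"
      using f by (simp add: factorizing_def)
    then show ?case using f step by (simp add: factorizing_def)
  next
    case one
    then show ?case using \<omega> by (simp add: is_state_def)
  qed (simp_all add: relocate_simps distrib_left distrib_right embed_add embed_scaleC clinearD[OF lin])
qed

subsection \<open>Strong clustering\<close>

lemma relocate_block_swap_twice:
  "relocate (block_swap (Suc m)) (relocate (block_swap (Suc m)) x) = x"
  using finite_perm_bij[OF finite_perm_block_swap[of m]]
  by (simp add: relocate_relocate bij_is_inj block_swap_involution relocate_id)

text \<open>Applying the swap, an involution preserving \<open>\<omega>\<close>, to the whole
  product moves it from the left to the right factor. The left factor then stays in the initial
  sites, as factorization requires.\<close>

lemma symmetric_block_swap:
  assumes "symmetric_state \<omega>"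
  shows "\<omega> (embed (relocate (block_swap (Suc m)) x * y)) = \<omega> (embed (x * relocate (block_swap (Suc m)) y))"
  using symmetric_relocate[OF assms finite_perm_block_swap, of m "relocate (block_swap (Suc m)) x * y"]
    finite_perm_bij[OF finite_perm_block_swap[of m]]
  by (simp add: relocate_mult bij_is_inj relocate_block_swap_twice)

text \<open>For the pair \<open>x\<close>, \<open>site 0 a\<close>, swapping blocks of length
  \<open>2 ^ m \<ge> n\<close> amounts to placing \<open>a\<close> at site \<open>2 ^ m\<close>,
  beyond \<open>x\<close>. By symmetry the value is the one at site \<open>n\<close>, so the
  sequence is eventually constant.\<close>

lemma clustering_factorizing:
  assumes \<omega>: "symmetric_state \<omega>" and "strongly_clustering \<omega>"
  shows "factorizing \<omega>"
  unfolding factorizing_def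
proof (intro allI ballI)
  fix n a and x :: "'a fermi_alg" assume x: "x \<in> fermi_level n"
  let ?f = "\<lambda>m. \<omega> (perm_action (block_swap m) (embed x) * embed (site 0 a))"
  have "?f \<longlonglongrightarrow> \<omega> (embed x) * \<omega> (embed (site 0 a))"
    using assms(2) by (simp add: strongly_clustering_def)
  then have lim: "(\<lambda>m. ?f (Suc m)) \<longlonglongrightarrow> \<omega> (embed x) * \<omega> (embed (site 0 a))"
    by (rule LIMSEQ_Suc)
  have "\<forall>\<^sub>F m in sequentially. ?f (Suc m) = \<omega> (embed (x * site n a))"
  proof (rule eventually_sequentiallyI)
    fix m assume "n \<le> m"
    then have "n \<le> 2 ^ m" using less_exp[of m] by linarith
    then show "?f (Suc m) = \<omega> (embed (x * site n a))"
      using symmetric_block_swap[OF \<omega>, of m x "site 0 a"] symmetric_site_shift[OF \<omega> x, of "2 ^ m" a]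
      by (simp add: finite_perm_bij[OF finite_perm_block_swap] block_swap_low flip: embed_mult)
  qed
  from LIMSEQ_unique[OF tendsto_eventually[OF this] lim]
  show "\<omega> (embed (x * site n a)) = \<omega> (embed x) * \<omega> (embed (site 0 a))" .
qed

text \<open>Equicontinuity: Lipschitz bounds uniform in \<open>n\<close> carry convergence from the
  dense range to every point, with the error split into three parts. The term
  \<open>\<bar>K\<bar> + 1\<close> keeps the radius \<open>d\<close> positive for every
  \<open>K\<close>.\<close>

lemma completion_tendsto:
  fixes f :: "nat \<Rightarrow> 'a::pre_cstar_algebra cstar_completion \<Rightarrow> complex"
  assumes f: "\<And>n z w. cmod (f n z - f n w) \<le> K * norm (z - w)"
    and L: "\<And>z w. cmod (L z - L w) \<le> K * norm (z - w)"
    and lim: "\<And>a. (\<lambda>n. f n (embed a)) \<longlonglongrightarrow> L (embed a)"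
  shows "(\<lambda>n. f n z) \<longlonglongrightarrow> L z"
proof (rule metric_LIMSEQ_I)
  fix e :: real assume e: "0 < e"
  define d where "d = e / (3 * (\<bar>K\<bar> + 1))"
  have d: "0 < d" using e by (simp add: d_def)
  obtain a where a: "dist z (embed a) < d" using embed_dense[OF d] by blast
  have "K * norm (z - embed a) \<le> (\<bar>K\<bar> + 1) * d"
    using a by (intro mult_mono) (auto simp: dist_norm)
  also have "\<dots> = e / 3" by (simp add: d_def field_simps)
  finally have K: "K * norm (z - embed a) \<le> e / 3" .
  obtain N where N: "\<forall>n\<ge>N. dist (f n (embed a)) (L (embed a)) < e / 3"
    using metric_LIMSEQ_D[OF lim, of "e / 3" a] e by auto
  show "\<exists>N. \<forall>n\<ge>N. dist (f n z) (L z) < e"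
  proof (intro exI[of _ N] allI impI)
    fix n assume "N \<le> n"
    have "dist (f n z) (f n (embed a)) \<le> e / 3" "dist (L z) (L (embed a)) \<le> e / 3"
      using f[of n z "embed a"] L[of z "embed a"] K unfolding dist_norm by linarith+
    moreover have "dist (f n (embed a)) (L (embed a)) < e / 3" using N \<open>N \<le> n\<close> by blast
    moreover have "dist (f n z) (L z) \<le>
        dist (f n z) (f n (embed a)) + dist (f n (embed a)) (L (embed a)) + dist (L z) (L (embed a))"
      using dist_triangle[of "f n z" "L z" "f n (embed a)"]
        dist_triangle[of "f n (embed a)" "L z" "L (embed a)"] by (simp add: dist_commute)
    ultimately show "dist (f n z) (L z) < e" by linarith
  qed
qed

text \<open>For algebraic elements the sequence reaches its limit once the swapped blocks contain
  the sites of both. Density then extends this first in the left and then in the right argument; the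
  permutations act isometrically, so the Lipschitz constants do not depend on
  \<open>m\<close>.\<close>

lemma factorizing_clustering:
  assumes \<omega>: "symmetric_state \<omega>" and f: "factorizing \<omega>"
  shows "strongly_clustering \<omega>"
  unfolding strongly_clustering_def
proof (intro allI)
  fix x y :: "'a fermi_inf"
  let ?\<alpha> = "\<lambda>m. perm_action (block_swap (Suc m)) :: 'a fermi_inf \<Rightarrow> 'a fermi_inf"
  have st: "is_state \<omega>" using \<omega> by (rule symmetric_state_is_state)
  then have lin: "clinear \<omega>" by (simp add: is_state_def)
  have bij: "bij (block_swap (Suc m))" for m by (rule finite_perm_bij[OF finite_perm_block_swap])
  have \<alpha>: "?\<alpha> m (u - v) = ?\<alpha> m u - ?\<alpha> m v" for m u v
    using perm_action_automorphism[OF bij] unfolding star_automorphism_def by (blast intro: clinearD(5))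
  note le = order_trans[OF state_norm_le[OF st] norm_mult_ineq]
  have "(\<lambda>m. \<omega> (?\<alpha> m (embed a) * embed b)) \<longlonglongrightarrow> \<omega> (embed a) * \<omega> (embed b)" for a b
  proof (rule tendsto_eventually)
    obtain k where k: "a \<in> fermi_level k" "b \<in> fermi_level k" by (rule fermi_level_common)
    show "\<forall>\<^sub>F m in sequentially. \<omega> (?\<alpha> m (embed a) * embed b) = \<omega> (embed a) * \<omega> (embed b)"
    proof (rule eventually_sequentiallyI)
      fix m assume "k \<le> m"
      then have "k \<le> 2 ^ m" using less_exp[of m] by linarith
      then have "\<omega> (embed (a * relocate (block_swap (Suc m)) b)) = \<omega> (embed a) * \<omega> (embed b)"
        using fermi_level_mono[OF _ k(1), of "2 ^ m"]
        by (intro factorizing_shift[OF f st _ k(2)]) (auto intro: block_swap_low)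
      then show "\<omega> (?\<alpha> m (embed a) * embed b) = \<omega> (embed a) * \<omega> (embed b)"
        using symmetric_block_swap[OF \<omega>, of m a b] by (simp add: bij flip: embed_mult)
    qed
  qed
  then have "(\<lambda>m. \<omega> (?\<alpha> m x * embed b)) \<longlonglongrightarrow> \<omega> x * \<omega> (embed b)" for b
  proof (rule completion_tendsto[where K = "norm (embed b)", rotated 2])
    fix m and z w :: "'a fermi_inf"
    have "\<omega> (?\<alpha> m z * embed b) - \<omega> (?\<alpha> m w * embed b) = \<omega> (?\<alpha> m (z - w) * embed b)"
      by (simp only: \<alpha> left_diff_distrib clinearD(5)[OF lin])
    then show "cmod (\<omega> (?\<alpha> m z * embed b) - \<omega> (?\<alpha> m w * embed b)) \<le> norm (embed b) * norm (z - w)"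
      using le[of "?\<alpha> m (z - w)" "embed b"] by (simp add: norm_perm_action[OF bij] mult.commute)
    have "cmod (\<omega> z * \<omega> (embed b) - \<omega> w * \<omega> (embed b)) = cmod (\<omega> (z - w)) * cmod (\<omega> (embed b))"
      by (simp add: clinearD(5)[OF lin] left_diff_distrib flip: norm_mult)
    also have "\<dots> \<le> norm (z - w) * norm (embed b)"
      by (intro mult_mono state_norm_le[OF st]) auto
    finally show "cmod (\<omega> z * \<omega> (embed b) - \<omega> w * \<omega> (embed b)) \<le> norm (embed b) * norm (z - w)"
      by (simp add: mult.commute)
  qed
  then have "(\<lambda>m. \<omega> (?\<alpha> m x * y)) \<longlonglongrightarrow> \<omega> x * \<omega> y"
  proof (rule completion_tendsto[where K = "norm x", rotated 2])
    fix m and z w :: "'a fermi_inf"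
    have "\<omega> (?\<alpha> m x * z) - \<omega> (?\<alpha> m x * w) = \<omega> (?\<alpha> m x * (z - w))"
      by (simp only: right_diff_distrib clinearD(5)[OF lin])
    then show "cmod (\<omega> (?\<alpha> m x * z) - \<omega> (?\<alpha> m x * w)) \<le> norm x * norm (z - w)"
      using le[of "?\<alpha> m x" "z - w"] by (simp add: norm_perm_action[OF bij])
    have "cmod (\<omega> x * \<omega> z - \<omega> x * \<omega> w) = cmod (\<omega> x) * cmod (\<omega> (z - w))"
      by (simp add: clinearD(5)[OF lin] right_diff_distrib flip: norm_mult)
    also have "\<dots> \<le> norm x * norm (z - w)"
      by (intro mult_mono state_norm_le[OF st]) auto
    finally show "cmod (\<omega> x * \<omega> z - \<omega> x * \<omega> w) \<le> norm x * norm (z - w)" .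
  qed
  then show "(\<lambda>n. \<omega> (perm_action (block_swap n) x * y)) \<longlonglongrightarrow> \<omega> x * \<omega> y"
    by (rule LIMSEQ_imp_Suc)
qed

section \<open>Extremality\<close>

text \<open>The average of \<open>x - \<omega>(x) 1\<close> over \<open>m\<close> disjoint blocks has \<open>\<omega>\<close>-variance \<open>O(1/m)\<close>, while \<open>\<phi>\<close>
  takes the same value on it as on \<open>x - \<omega>(x) 1\<close>.\<close>

lemma factorizing_dominates:
  fixes \<omega> :: "'a::graded_cstar_algebra fermi_inf \<Rightarrow> complex"
  assumes \<omega>: "symmetric_state \<omega>" and f: "factorizing \<omega>" and \<phi>: "symmetric_state \<phi>"
    and t: "0 < t" "\<And>x. t * Re (\<phi> (star x * x)) \<le> Re (\<omega> (star x * x))"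
  shows "\<phi> = \<omega>"
proof (rule states_eqI)
  show st\<phi>: "is_state \<phi>" and st: "is_state \<omega>"
    using \<omega> \<phi> by (simp_all add: symmetric_state_is_state)
  fix x :: "'a fermi_alg"
  let ?\<tau> = "\<lambda>x. \<omega> (embed x)" and ?\<eta> = "\<lambda>x. \<phi> (embed x)"
  have pos: "pos_fun ?\<tau>" using state_embed[OF st] by (rule is_state_pos_fun)
  then have lin: "clinear ?\<tau>" by (simp add: pos_fun_def)
  have st\<eta>: "is_state ?\<eta>" using state_embed[OF st\<phi>] .
  then have lin\<eta>: "clinear ?\<eta>" by (simp add: is_state_def)
  obtain k where x: "x \<in> fermi_level k" using fermi_level_ex by blast
  \<comment> \<open>The centred element: its value 0 under \<open>\<omega>\<close> makes disjoint
    copies uncorrelated.\<close>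
  define z where "z = x - ?\<tau> x *\<^sub>C 1"
  have "z = x + (- ?\<tau> x) *\<^sub>C 1" by (simp add: z_def)
  then have z: "z \<in> fermi_level k"
    using x by (simp only: fermi_level_add fermi_level_scaleC fermi_level_one)
  have one: "?\<tau> 1 = 1" "?\<eta> 1 = 1" using state_embed[OF st] st\<eta> unfolding is_state_def by blast+
  have \<tau>z: "?\<tau> z = 0" unfolding z_def by (simp only: clinearD[OF lin] one) simp
  \<comment> \<open>The copy of \<open>z\<close> at the \<open>k\<close> sites starting from
    \<open>2 ^ (k + j)\<close>. As \<open>k < 2 ^ (k + j)\<close>, it ends below
    \<open>2 ^ (k + j + 1)\<close>, so copies with different indices are disjoint.\<close>
  define \<beta> where "\<beta> j = relocate (block_swap (Suc (k + j))) z" for j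
  have k: "l < 2 ^ (k + j)" if "l < k" for l j
    using that less_exp[of "k + j"] by linarith
  have \<beta>_level: "\<beta> i \<in> fermi_level (2 ^ (k + j))" if "i < j" for i j
  proof (rule fermi_level_mono)
    show "(2::nat) ^ Suc (k + i) \<le> 2 ^ (k + j)" using that by (intro power_increasing) auto
    show "\<beta> i \<in> fermi_level (2 ^ Suc (k + i))"
      unfolding \<beta>_def by (rule relocate_level[OF z]) (use k[of _ i] in \<open>simp add: block_swap_low\<close>)
  qed
  have less: "?\<tau> (star (\<beta> i) * \<beta> j) = 0" if "i < j" for i j
    using factorizing_shift[OF f st fermi_level_star[OF \<beta>_level[OF that]] z, of "block_swap (Suc (k + j))"]
    by (simp add: block_swap_low k \<tau>z flip: \<beta>_def)
  have off: "?\<tau> (star (\<beta> i) * \<beta> j) = 0" if "i \<noteq> j" for i j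
    using less[of i j] less[of j i] pos_fun_hermitian[OF pos, of "\<beta> i" "\<beta> j"] that
    by (cases "i < j") auto
  have diag: "?\<tau> (star (\<beta> j) * \<beta> j) = ?\<tau> (star z * z)" for j
    using symmetric_relocate[OF \<omega> finite_perm_block_swap, of "k + j" "star z * z"]
      bij_is_inj[OF finite_perm_bij[OF finite_perm_block_swap]]
    by (simp add: \<beta>_def relocate_mult relocate_star)
  have "(real m * cmod (?\<eta> z))\<^sup>2 \<le> real m * (Re (?\<tau> (star z * z)) / t)" for m
  proof -
    define A where "A = (\<Sum>j<m. \<beta> j)"
    have "?\<eta> A = of_nat m * ?\<eta> z"
      by (simp add: A_def clinear_sum[OF lin\<eta>] \<beta>_def symmetric_relocate[OF \<phi> finite_perm_block_swap])
    then have "(real m * cmod (?\<eta> z))\<^sup>2 = (cmod (?\<eta> A))\<^sup>2" by (simp add: norm_mult)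
    also have "\<dots> \<le> (gns_seminorm ?\<eta> A)\<^sup>2"
      by (intro power_mono state_norm_le_gns_seminorm[OF st\<eta>]) simp
    also have "\<dots> = Re (?\<eta> (star A * A))" by (rule gns_seminorm_sq[OF is_state_pos_fun[OF st\<eta>]])
    \<comment> \<open>Domination passes from \<open>\<phi>\<close> to \<open>\<omega>\<close>, for
      which only the diagonal terms of the double sum remain.\<close>
    also have "\<dots> \<le> Re (?\<tau> (star A * A)) / t"
      using t(2)[of "embed A"] t(1) by (simp add: embed_mult embed_star field_simps)
    also have "?\<tau> (star A * A) = (\<Sum>i<m. \<Sum>j<m. if i = j then ?\<tau> (star z * z) else 0)"
      unfolding A_def star_sum sum_product clinear_sum[OF lin]
      by (intro sum.cong HOL.refl) (auto simp: off diag)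
    also have "\<dots> = of_nat m * ?\<tau> (star z * z)" by simp
    finally show ?thesis by simp
  qed
  from quadratic_le_linear_imp_zero[OF this] have "?\<eta> z = 0" by simp
  moreover have "?\<eta> z = ?\<eta> x - ?\<tau> x" unfolding z_def by (simp only: clinearD[OF lin\<eta>] one) simp
  ultimately show "?\<eta> x = ?\<tau> x" by simp
qed

text \<open>Each component of a convex decomposition of \<open>\<omega>\<close>, multiplied by its
  weight, is dominated by \<open>\<omega>\<close> because the other component is positive.\<close>

lemma factorizing_extreme:
  assumes \<omega>: "symmetric_state \<omega>" and f: "factorizing \<omega>"
  shows "is_extreme_in \<omega> {\<phi>. symmetric_state \<phi>}"
  unfolding is_extreme_in_def
proof (intro conjI ballI allI impI)
  show "\<omega> \<in> {\<phi>. symmetric_state \<phi>}" using \<omega> by simp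
  fix \<phi> \<psi> and t :: real
  assume \<phi>: "\<phi> \<in> {\<phi>. symmetric_state \<phi>}" and \<psi>: "\<psi> \<in> {\<phi>. symmetric_state \<phi>}"
    and t: "0 < t \<and> t < 1 \<and> (\<forall>x. \<omega> x = of_real t * \<phi> x + of_real (1 - t) * \<psi> x)"
  have "0 \<le> Re (\<phi> (star x * x))" "0 \<le> Re (\<psi> (star x * x))" for x
    using \<phi> \<psi> by (auto intro!: pos_fun_nonneg(1) is_state_pos_fun symmetric_state_is_state)
  moreover have "Re (\<omega> x) = t * Re (\<phi> x) + (1 - t) * Re (\<psi> x)" for x
    using t by simp
  ultimately have le: "t * Re (\<phi> (star x * x)) \<le> Re (\<omega> (star x * x))"
    "(1 - t) * Re (\<psi> (star x * x)) \<le> Re (\<omega> (star x * x))" for x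
    using t by simp_all
  show "\<phi> = \<omega>"
    by (rule factorizing_dominates[OF \<omega> f _ _ le(1)]) (use \<phi> t in auto)
  show "\<psi> = \<omega>"
    by (rule factorizing_dominates[OF \<omega> f _ _ le(2)]) (use \<psi> t in auto)
qed

section \<open>From extremality to factorization\<close>

lemma extreme_proportional:
  fixes \<omega> :: "'a::graded_cstar_algebra fermi_inf \<Rightarrow> complex"
  assumes ext: "is_extreme_in \<omega> {\<phi>. symmetric_state \<phi>}"
    and \<phi>: "pos_fun \<phi>" "\<And>\<sigma> x. finite_perm \<sigma> \<Longrightarrow> \<phi> (perm_action \<sigma> x) = \<phi> x"
    and \<psi>: "pos_fun \<psi>" "\<And>\<sigma> x. finite_perm \<sigma> \<Longrightarrow> \<psi> (perm_action \<sigma> x) = \<psi> x"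
    and sum: "\<And>x. \<omega> x = \<phi> x + \<psi> x" and t: "\<phi> 1 = of_real t" "0 < t" "t < 1"
  shows "\<phi> x = of_real t * \<omega> x"
proof -
  \<comment> \<open>Dividing by the value at 1 turns both summands into symmetric states, and
    \<open>\<omega>\<close> into their convex combination with weights \<open>t\<close> and
    \<open>1 - t\<close>.\<close>
  have sym: "symmetric_state (\<lambda>x. \<eta> x / of_real s)"
    if "pos_fun \<eta>" "\<And>\<sigma> x. finite_perm \<sigma> \<Longrightarrow> \<eta> (perm_action \<sigma> x) = \<eta> x" "\<eta> 1 = of_real s" "0 < s"
    for \<eta> :: "'a fermi_inf \<Rightarrow> complex" and s :: real
    using that by (auto simp: symmetric_state_def is_state_def pos_fun_def clinear_def add_divide_distrib
        intro!: nonneg_Reals_divide_I)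
  have "\<omega> 1 = 1"
    using ext by (simp add: is_extreme_in_def symmetric_state_def is_state_def)
  then have \<psi>1: "\<psi> 1 = of_real (1 - t)" using sum[of 1] t(1) by (simp add: algebra_simps)
  have "\<omega> x = of_real t * (\<phi> x / of_real t) + of_real (1 - t) * (\<psi> x / of_real (1 - t))" for x
    using t by (simp add: sum)
  moreover have "symmetric_state (\<lambda>x. \<phi> x / of_real t)" by (rule sym[OF \<phi> t(1,2)])
  moreover have "symmetric_state (\<lambda>x. \<psi> x / of_real (1 - t))"
    using sym[OF \<psi> \<psi>1] \<open>t < 1\<close> by simp
  moreover have "\<phi>' = \<omega>" if "symmetric_state \<phi>'" "symmetric_state \<psi>'"
    "\<And>x. \<omega> x = of_real t * \<phi>' x + of_real (1 - t) * \<psi>' x" for \<phi>' \<psi>'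
    using ext that t(2,3) unfolding is_extreme_in_def mem_Collect_eq by blast
  ultimately have "(\<lambda>x. \<phi> x / of_real t) = \<omega>" by blast
  then have "\<phi> x / of_real t = \<omega> x" by (rule fun_cong)
  then show ?thesis using t by (simp add: field_simps)
qed

text \<open>The functional \<open>x \<mapsto> \<omega>(x a)\<close>, with \<open>a\<close> placed at infinity.\<close>

lemma tail_functional:
  fixes \<omega> :: "'a::graded_cstar_algebra fermi_inf \<Rightarrow> complex"
  assumes \<omega>: "symmetric_state \<omega>"
  obtains \<phi> where "continuous_on UNIV \<phi>"
    "\<And>n x. x \<in> fermi_level n \<Longrightarrow> \<phi> (embed x) = \<omega> (embed (x * site n a))"
proof -
  have st: "is_state \<omega>" using \<omega> by (rule symmetric_state_is_state)
  then have lin: "clinear \<omega>" by (simp add: is_state_def)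
  \<comment> \<open>The least level is an arbitrary choice: by symmetry every level containing
    \<open>x\<close> gives the same value.\<close>
  define T where "T x = \<omega> (embed (x * site (LEAST n. x \<in> fermi_level n) a))" for x
  have T: "T x = \<omega> (embed (x * site n a))" if "x \<in> fermi_level n" for x n
  proof -
    have "x \<in> fermi_level (LEAST n. x \<in> fermi_level n)" using that by (rule LeastI)
    moreover have "(LEAST n. x \<in> fermi_level n) \<le> n" using that by (rule Least_le)
    ultimately show ?thesis unfolding T_def by (rule symmetric_site_shift[OF \<omega>, symmetric])
  qed
  have "T (x - y) = T x - T y" for x y
  proof -
    obtain n where x: "x \<in> fermi_level n" and y: "y \<in> fermi_level n" by (rule fermi_level_common)
    have "x + (- 1) *\<^sub>C y \<in> fermi_level n" using x y by (intro fermi_level_add fermi_level_scaleC)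
    then have "x - y \<in> fermi_level n" by simp
    then show ?thesis
      by (simp add: T[OF x] T[OF y] T left_diff_distrib embed_diff clinearD[OF lin])
  qed
  moreover have "cmod (T x) \<le> norm a * cstar_seminorm x" for x
  proof -
    obtain n where x: "x \<in> fermi_level n" using fermi_level_ex by blast
    have "cmod (T x) \<le> norm (embed x * embed (site n a))"
      unfolding T[OF x] embed_mult by (rule state_norm_le[OF st])
    also have "\<dots> \<le> cstar_seminorm x * cstar_seminorm (site n a)"
      using norm_mult_ineq[of "embed x" "embed (site n a)"] by (simp add: norm_embed)
    also have "\<dots> \<le> cstar_seminorm x * norm a"
      using fermi_norm_least[OF gns_bound_site[of a n]]
      by (intro mult_left_mono) (simp_all add: cstar_seminorm_fermi_alg_def fermi_norm_nonneg)
    finally show ?thesis by (simp add: mult.commute)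
  qed
  ultimately obtain \<phi> where "continuous_on UNIV \<phi>" "\<And>x. \<phi> (embed x) = T x"
    using completion_extend[of T "norm a"] norm_ge_zero by blast
  then show ?thesis using T that by simp
qed

text \<open>Choose \<open>N\<close> beyond the level of the element and beyond all points moved by
  \<open>\<sigma>\<close>. Then \<open>\<sigma>\<close> fixes site \<open>N\<close>, where
  \<open>a\<close> may be placed, and the symmetry of \<open>\<omega>\<close> applies; continuity
  covers the completion.\<close>

lemma tail_functional_symmetric:
  assumes \<omega>: "symmetric_state \<omega>" and \<phi>: "continuous_on UNIV \<phi>"
    "\<And>n x. x \<in> fermi_level n \<Longrightarrow> \<phi> (embed x) = \<omega> (embed (x * site n a))"
    and \<sigma>: "finite_perm \<sigma>"
  shows "\<phi> (perm_action \<sigma> x) = \<phi> x"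
proof -
  have bij: "bij \<sigma>" using \<sigma> by (rule finite_perm_bij)
  have "\<phi> (perm_action \<sigma> (embed x)) = \<phi> (embed x)" for x
  proof -
    obtain m where m: "x \<in> fermi_level m" using fermi_level_ex by blast
    obtain M where M: "{k. \<sigma> k \<noteq> k} \<subseteq> {..<M}"
      using \<sigma> unfolding finite_perm_def finite_nat_iff_bounded by blast
    define N where "N = max m M"
    have outside: "\<sigma> k = k" if "N \<le> k" for k using M that by (force simp: N_def)
    have "\<sigma> i < N" if "i < N" for i
    proof (rule ccontr)
      assume "\<not> \<sigma> i < N"
      then have "\<sigma> (\<sigma> i) = \<sigma> i" by (simp add: outside)
      then have "\<sigma> i = i" using bij by (meson bij_is_inj injD)
      then show False using \<open>\<not> \<sigma> i < N\<close> that by simp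
    qed
    moreover have x: "x \<in> fermi_level N" using fermi_level_mono[OF _ m, of N] by (simp add: N_def)
    ultimately have "relocate \<sigma> x \<in> fermi_level N" by (blast intro: relocate_level)
    then have "\<phi> (perm_action \<sigma> (embed x)) = \<omega> (embed (relocate \<sigma> (x * site N a)))"
      by (simp add: bij \<phi>(2) relocate_snoc[OF x] outside)
    then show ?thesis by (simp add: symmetric_relocate[OF \<omega> \<sigma>] \<phi>(2)[OF x])
  qed
  then have "(\<lambda>x. \<phi> (perm_action \<sigma> x)) = \<phi>"
    by (intro completion_continuous_eq \<phi>(1) continuous_on_compose2[OF \<phi>(1)] perm_action_continuous bij) auto
  then show ?thesis by (rule fun_cong)
qed

text \<open>The element \<open>x'\<close> is \<open>x\<close> or its image under the grading, according to the parity of \<open>c\<close>.\<close>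

lemma site_level_commute:
  assumes "x \<in> fermi_level n"
  shows "\<exists>x'. \<forall>c. parity p c \<longrightarrow> site n c * x = x' * site n c \<and> site n c * x' = x * site n c"
  using assms
proof (induction x rule: fermi_level_homog_induct)
  case zero
  show ?case by (rule exI[of _ 0]) simp
next
  case (add x y)
  then obtain x' y' where
    "\<forall>c. parity p c \<longrightarrow> site n c * x = x' * site n c \<and> site n c * x' = x * site n c"
    "\<forall>c. parity p c \<longrightarrow> site n c * y = y' * site n c \<and> site n c * y' = y * site n c" by blast
  then show ?case by (intro exI[of _ "x' + y'"]) (simp add: distrib_left distrib_right)
next
  case (scale z x)
  then obtain x' where "\<forall>c. parity p c \<longrightarrow> site n c * x = x' * site n c \<and> site n c * x' = x * site n c"
    by blast
  then show ?case by (intro exI[of _ "z *\<^sub>C x'"]) simp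
next
  case (tens P a)
  have "site n c * tens n a = crossing_sign n P p *\<^sub>C (tens n a * site n c)" if "parity p c" for c
    using site_site_prod_commute[OF tens, of n "\<lambda>i. i" p c] that by (simp add: site_prod_id)
  \<comment> \<open>The sign is its own inverse, which gives the second of the two
    relations.\<close>
  moreover have "crossing_sign n P p * crossing_sign n P p = 1"
    unfolding crossing_sign_def prod.distrib[symmetric] by (rule prod.neutral) auto
  ultimately show ?case by (intro exI[of _ "crossing_sign n P p *\<^sub>C tens n a"]) simp
qed

text \<open>With \<open>x'\<close> from \<open>site_level_commute\<close>, the witness is
  \<open>x' * site n c\<close>: moving \<open>site n (star c)\<close> to the left past
  \<open>x\<close> and then past \<open>star x\<close> replaces them by \<open>x'\<close> and
  \<open>star x'\<close>.\<close>

lemma site_star_mult_square: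
  assumes x: "x \<in> fermi_level n" and c: "parity p c"
  shows "\<exists>w. star x * x * site n (star c * c) = star w * w"
proof -
  obtain x' where x': "\<And>c. parity p c \<Longrightarrow> site n c * x = x' * site n c"
    "\<And>c. parity p c \<Longrightarrow> site n c * x' = x * site n c"
    using site_level_commute[OF x, of p] by blast
  have c': "parity p (star c)" using c by (auto simp: parity_def grading_star)
  have s: "star x * site n (star c) = site n (star c) * star x'"
    using arg_cong[OF x'(1)[OF c], of star] by (simp add: star_mult site_star)
  have "star x * x * site n (star c * c) = star x * (x * site n (star c)) * site n c"
    by (simp add: site_mult mult.assoc)
  also have "\<dots> = star x * site n (star c) * x' * site n c"
    by (simp add: x'(2)[OF c', symmetric] mult.assoc)
  also have "\<dots> = star (x' * site n c) * (x' * site n c)"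
    by (simp add: s star_mult site_star mult.assoc)
  finally show ?thesis by blast
qed

text \<open>\<open>c\<close> may be inhomogeneous. The cross terms of its even and odd parts make up
  the odd part of \<open>star c * c\<close>, which vanishes here.\<close>

lemma even_square_parts:
  fixes c :: "'a::graded_cstar_algebra"
  assumes "parity False (star c * c)"
  defines "d \<equiv> \<lambda>p. graded_part p c"
  shows "star c * c = star (d False) * d False + star (d True) * d True"
proof -
  have d: "grading (d p) = (if p then - d p else d p)" for p
    by (simp add: d_def grading_graded_part)
  have "star c * c = star (d False + d True) * (d False + d True)"
    by (simp add: d_def graded_part_sum)
  also have "\<dots> = (star (d False) * d False + star (d True) * d True) +
      (star (d False) * d True + star (d True) * d False)" (is "_ = ?e + ?o")
    by (simp add: star_add distrib_left distrib_right add_ac)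
  finally have "star c * c = ?e + ?o" .
  moreover have "graded_part False ?e = ?e" "graded_part False ?o = 0"
    using graded_part_eq_iff[of False ?e] graded_part_other[of ?o True False]
    by (simp_all add: d grading_add grading_mult grading_star)
  moreover have "graded_part False (star c * c) = star c * c"
    using assms(1) by (simp add: graded_part_eq_iff parity_def)
  ultimately show ?thesis by (metis add.right_neutral graded_part_add)
qed

text \<open>\<open>a\<close> splits into two squares of homogeneous elements. Multiplying
  \<open>star x * x\<close> by either of them, placed beyond \<open>x\<close>, again gives a square,
  on which \<open>\<omega>\<close> is nonnegative.\<close>

lemma tail_functional_pos:
  fixes \<omega> :: "'a::graded_cstar_algebra fermi_inf \<Rightarrow> complex"
  assumes \<omega>: "is_state \<omega>" and \<phi>: "continuous_on UNIV \<phi>"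
    "\<And>n x. x \<in> fermi_level n \<Longrightarrow> \<phi> (embed x) = \<omega> (embed (x * site n a))"
    and a: "parity False a" "a = star c * c"
  shows "pos_fun \<phi>"
proof (rule completion_pos_fun[OF \<phi>(1)])
  have lin: "clinear \<omega>" using \<omega> by (simp add: is_state_def)
  have pos: "\<omega> (embed (star w * w)) \<in> \<real>\<^sub>\<ge>\<^sub>0" for w
    using \<omega> by (simp add: is_state_def embed_mult embed_star)
  have "\<phi> (embed (star x * x)) \<in> \<real>\<^sub>\<ge>\<^sub>0" for x
  proof -
    obtain n where x: "x \<in> fermi_level n" using fermi_level_ex by blast
    define d where "d p = graded_part p c" for p
    have "a = star (d False) * d False + star (d True) * d True"
      using even_square_parts[of c] a by (simp add: d_def)
    moreover obtain v w where "star x * x * site n (star (d False) * d False) = star v * v"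
      "star x * x * site n (star (d True) * d True) = star w * w"
      using site_star_mult_square[OF x parity_graded_part] unfolding d_def by meson
    ultimately have "star x * x * site n a = star v * v + star w * w"
      by (simp add: clinearD[OF site_clinear] distrib_left)
    moreover have "\<phi> (embed (star x * x)) = \<omega> (embed (star x * x * site n a))"
      by (rule \<phi>(2)[OF fermi_level_mult[OF fermi_level_star[OF x] x]])
    ultimately show ?thesis
      using pos[of v] pos[of w] by (simp add: embed_add clinearD[OF lin] nonneg_Reals_add_I)
  qed
  moreover have "clinear (\<lambda>x. \<phi> (embed x))"
    unfolding clinear_def
  proof (intro conjI allI)
    fix z and x y :: "'a fermi_alg"
    obtain n where n: "x \<in> fermi_level n" "y \<in> fermi_level n" by (rule fermi_level_common)
    show "\<phi> (embed (x + y)) = \<phi> (embed x) + \<phi> (embed y)"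
      using n by (simp add: \<phi>(2)[where n = n] fermi_level_add distrib_right embed_add[of "_ * _"] clinearD[OF lin])
    show "\<phi> (embed (z *\<^sub>C x)) = z *\<^sub>C \<phi> (embed x)"
      using n by (simp add: \<phi>(2)[where n = n] fermi_level_scaleC embed_scaleC[of _ "_ * _"] clinearD[OF lin])
  qed
  ultimately show "pos_fun (\<lambda>x. \<phi> (embed x))" by (simp add: pos_fun_def)
qed

text \<open>\<open>F\<close> is preserved by sums and scalar multiples. This reduces the claim to
  odd elements, for which both sides vanish, and to even self-adjoint elements of norm less than
  1.\<close>

lemma extreme_factorizing:
  fixes \<omega> :: "'a::graded_cstar_algebra fermi_inf \<Rightarrow> complex"
  assumes \<omega>: "symmetric_state \<omega>" and ext: "is_extreme_in \<omega> {\<phi>. symmetric_state \<phi>}"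
  shows "factorizing \<omega>"
  unfolding factorizing_def
proof (intro allI ballI)
  fix n and x :: "'a fermi_alg" and a :: 'a
  assume x: "x \<in> fermi_level n"
  have st: "is_state \<omega>" using \<omega> by (rule symmetric_state_is_state)
  then have lin: "clinear \<omega>" and one: "\<omega> 1 = 1" by (simp_all add: is_state_def)
  define F where "F a \<longleftrightarrow> \<omega> (embed (x * site n a)) = \<omega> (embed x) * \<omega> (embed (site 0 a))" for a
  note site_lin = clinearD[OF site_clinear] distrib_left right_diff_distrib
    embed_add embed_diff embed_scaleC clinearD[OF lin]
  have add: "F (a + b)" if "F a" "F b" for a b using that by (simp add: F_def site_lin)
  have scale: "F (c *\<^sub>C a)" if "F a" for a c using that by (simp add: F_def site_lin)
  have contr: "F h" if h: "parity False h" "star h = h" "norm h < 1" for h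
  proof -
    \<comment> \<open>\<open>?a 1\<close> and \<open>?a (- 1)\<close> are \<open>(1 - h) / 2\<close>
      and \<open>(1 + h) / 2\<close>, two even elements of the form \<open>star c * c\<close> with
      sum 1. Their tail functionals decompose \<open>\<omega>\<close>.\<close>
    let ?a = "\<lambda>r. (1/2) *\<^sub>C (1 - r *\<^sub>C h)"
    have sq: "\<exists>c. ?a r = star c * c" if "r = 1 \<or> r = - 1" for r
    proof -
      have "star (r *\<^sub>C h) = r *\<^sub>C h" "norm (r *\<^sub>C h) < 1"
        using that h by auto
      then obtain c where c: "star c = c" "c * c = 1 - r *\<^sub>C h" using cstar_sqrt_exists by blast
      \<comment> \<open>Absorbs the factor 1/2 into the square root.\<close>
      define u where "u = complex_of_real (sqrt (1/2))"
      have u: "cnj u * u = 1/2" by (simp add: u_def flip: of_real_mult)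
      have "star (u *\<^sub>C c) * (u *\<^sub>C c) = (cnj u * u) *\<^sub>C (c * c)" by (simp add: c(1) mult.commute)
      then show ?thesis by (metis c(2) u)
    qed
    have even: "parity False (?a r)" for r
      using h(1) by (simp add: parity_def grading_diff)
    obtain \<phi> where \<phi>: "continuous_on UNIV \<phi>"
      "\<And>n x. x \<in> fermi_level n \<Longrightarrow> \<phi> (embed x) = \<omega> (embed (x * site n (?a 1)))"
      using tail_functional[OF \<omega>, of "?a 1"] by blast
    obtain \<psi> where \<psi>: "continuous_on UNIV \<psi>"
      "\<And>n x. x \<in> fermi_level n \<Longrightarrow> \<psi> (embed x) = \<omega> (embed (x * site n (?a (- 1))))"
      using tail_functional[OF \<omega>, of "?a (- 1)"] by blast
    have pos: "pos_fun \<phi>" "pos_fun \<psi>"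
      using tail_functional_pos[OF st \<phi> even] tail_functional_pos[OF st \<psi> even] sq[of 1] sq[of "- 1"] by blast+
    have "\<omega> = (\<lambda>y. \<phi> y + \<psi> y)"
    proof (rule completion_continuous_eq)
      show "\<omega> (embed y) = \<phi> (embed y) + \<psi> (embed y)" for y
      proof -
        obtain m where m: "y \<in> fermi_level m" using fermi_level_ex by blast
        have "?a 1 + ?a (- 1) = (1::'a)" by (simp add: half_half flip: scaleC_add_right)
        then have "site m (?a 1) + site m (?a (- 1)) = 1"
          by (metis clinearD(1)[OF site_clinear] site_one)
        then have "\<omega> (embed (y * (site m (?a 1) + site m (?a (- 1))))) = \<omega> (embed y)"
          by simp
        then show ?thesis unfolding distrib_left by (simp only: \<phi>(2)[OF m] \<psi>(2)[OF m] embed_add clinearD[OF lin])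
      qed
    qed (intro continuous_intros \<phi>(1) \<psi>(1) state_continuous[OF st])+
    then have sum: "\<omega> y = \<phi> y + \<psi> y" for y by (rule fun_cong)
    define r where "r = \<omega> (embed (site 0 h))"
    have \<phi>1: "\<phi> 1 = (1 - r) / 2"
      using \<phi>(2)[OF fermi_level_one[of 0]] by (simp add: r_def site_lin one)
    have "norm (embed (site 0 h)) \<le> norm h"
      using fermi_norm_least[OF gns_bound_site[of h 0]] by (simp add: norm_embed cstar_seminorm_fermi_alg_def)
    \<comment> \<open>The strict bound on \<open>norm h\<close> puts the weight \<open>t\<close>
      strictly between 0 and 1.\<close>
    then have r: "cmod r < 1"
      using state_norm_le[OF st, of "embed (site 0 h)"] h(3) by (simp add: r_def)
    define t where "t = (1 - Re r) / 2"
    have "\<phi> 1 = of_real (Re (\<phi> 1))" using pos_fun_nonneg(2)[OF pos(1), of 1] by simp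
    then have t: "\<phi> 1 = of_real t" by (simp add: \<phi>1 t_def)
    have "0 < t" "t < 1" using r abs_Re_le_cmod[of r] by (auto simp: t_def)
    then have "\<phi> (embed x) = of_real t * \<omega> (embed x)"
      using extreme_proportional[OF ext pos(1) tail_functional_symmetric[OF \<omega> \<phi>]
          pos(2) tail_functional_symmetric[OF \<omega> \<psi>] sum t] by blast
    then have "\<omega> (embed (x * site n (?a 1))) = (1 - r) / 2 * \<omega> (embed x)"
      using t \<phi>1 \<phi>(2)[OF x] by simp
    then have "\<omega> (embed x) - \<omega> (embed (x * site n h)) = (1 - r) * \<omega> (embed x)"
      by (simp add: site_lin)
    then show "F h" by (simp add: F_def r_def algebra_simps)
  qed
  have selfadj: "F h" if h: "parity False h" "star h = h" for h
  proof -
    \<comment> \<open>Rescales \<open>h\<close> to norm less than 1; the added 1 covers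
      \<open>h = 0\<close>.\<close>
    define r where "r = 1 / (norm h + 1)"
    have r: "0 < r" "r * norm h < 1" by (simp_all add: r_def add_nonneg_pos divide_less_eq)
    have "F (complex_of_real r *\<^sub>C h)"
      by (rule contr) (use h r in \<open>simp_all add: parity_def norm_scaleC\<close>)
    from scale[OF this, of "1 / complex_of_real r"] show ?thesis using r by simp
  qed
  have even: "F a" if a: "parity False a" for a
  proof -
    \<comment> \<open>Decomposition into self-adjoint elements: the factor \<open>\<i>\<close> makes
      \<open>a - star a\<close> self-adjoint.\<close>
    have "a = (1/2) *\<^sub>C (a + star a) + (- \<i>/2) *\<^sub>C (\<i> *\<^sub>C (a - star a))"
      by (simp add: half_half flip: scaleC_add_right)
    moreover have "F (a + star a)" "F (\<i> *\<^sub>C (a - star a))"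
      by (rule selfadj; use a in \<open>simp add: parity_def grading_add grading_diff grading_star star_add star_diff
          add.commute flip: scaleC_minus_right\<close>)+
    ultimately show ?thesis using add scale by metis
  qed
  have odd: "F a" if a: "parity True a" for a
    using symmetric_odd_vanish[OF \<omega> x a] symmetric_odd_vanish[OF \<omega> fermi_level_one[of 0] a] by (simp add: F_def)
  have "F (graded_part False a + graded_part True a)"
    by (intro add even odd parity_graded_part)
  then show "\<omega> (embed (x * site n a)) = \<omega> (embed x) * \<omega> (embed (site 0 a))"
    by (simp add: graded_part_sum F_def)
qed

theorem proposition3p5:
  fixes \<omega> :: "'a::graded_cstar_algebra fermi_inf \<Rightarrow> complex"
  assumes "symmetric_state \<omega>"
  shows "(is_extreme_in \<omega> {\<phi>. symmetric_state \<phi>} \<longleftrightarrow> strongly_clustering \<omega>) \<and>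
    (strongly_clustering \<omega> \<longleftrightarrow> (\<exists>\<rho>. even_state \<rho> \<and> \<omega> = inf_product_state \<rho>))"
  using assms extreme_factorizing factorizing_extreme clustering_factorizing factorizing_clustering
    factorizing_product_state product_state_factorizing by metis

end
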